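(* Let $\mathbb K$ be a field and $M$ a finitely generated, cancellative binoid that is torsion-free up to nilpotence. Let $U=D(\mathfrak A)=\bigcup D(P)$ be a combinatorial open subset of $\operatorname{Spec}\mathbb K[M]$ such that $\{D(P)\}$, with each $P$ a monomial, is an acyclic covering for the Zariski sheaf of abelian groups $\mathscr F$ on $U$. Then \[ \mathrm H^j_{\mathrm{Zar}}(U,\mathscr F)=\mathrm H^j_{\mathrm{comb}}(U,\mathscr F) \] for all $j\geq0$.
   Context: A (commutative) binoid is a commutative monoid $(M,+,0)$ with an absorbing element $\infty$; $M^\bullet=M\smallsetminus\{\infty\}$. $M$ is cancellative if $a+b=a+c\neq\infty$ implies $b=c$, and torsion-free up to nilpotence if $na=nb\neq\infty$ with $n\geq1$ implies $a=b$. The binoid algebra $\mathbb K[M]$ is the $\mathbb K$-algebra with $\mathbb K$-basis $\{T^a\mid a\in M^\bullet\}$ and multiplication $T^aT^b=T^{a+b}$, where $T^\infty=0$; the monomials are the scalar multiples of the $T^a$. An ideal of $M$ is a subset $I\ni\infty$ with $I+M\subseteq I$, and $\mathbb K[I]$ is the ideal of $\mathbb K[M]$ spanned by the $T^a$, $a\in I$. Ideals of the form $\mathbb K[I]$ are called combinatorial. The combinatorial topology on $\operatorname{Spec}\mathbb K[M]$ has as open sets (the combinatorial open subsets) the sets $D(\mathfrak A)$ with $\mathfrak A$ a combinatorial ideal; a basis is given by the $D(P)$ with $P$ a monomial. $\mathrm H^j_{\mathrm{Zar}}(U,\mathscr F)$ is sheaf cohomology of $\mathscr F$ on $U$ with the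 Zariski topology. $\mathrm H^j_{\mathrm{comb}}(U,\mathscr F)$ is sheaf cohomology on $U$ with the combinatorial topology of the sheaf $\mathscr F^{\mathrm{comb}}$, the restriction of $\mathscr F$ to the combinatorial open subsets. A covering is acyclic for $\mathscr F$ if for every finite intersection $V$ of its members $\mathrm H^k_{\mathrm{Zar}}(V,\mathscr F|_V)=0$ for all $k\geq1$. *)

theory Defs
  imports
    "HOL-Library.Poly_Mapping"
    "HOL-Library.Extended_Nat"
    "HOL-Algebra.Ideal"
    "HOL-Algebra.Product_Groups"
    "HOL-Analysis.Abstract_Topology"
begin

section \<open>Binoids\<close>

class binoid = comm_monoid_add + infinity +
  assumes add_infinity [simp]: "a + \<infinity> = \<infinity>"
begin

lemma infinity_add [simp]: "\<infinity> + a = \<infinity>"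
  by (metis add_infinity add.commute)

inductive_set binoid_generated :: "'a set \<Rightarrow> 'a set" for A where
  zero: "0 \<in> binoid_generated A"
| infinity: "\<infinity> \<in> binoid_generated A"
| gen: "a \<in> A \<Longrightarrow> a \<in> binoid_generated A"
| add: "a \<in> binoid_generated A \<Longrightarrow> b \<in> binoid_generated A \<Longrightarrow> a + b \<in> binoid_generated A"

definition binoid_ideal :: "'a set \<Rightarrow> bool" where
  "binoid_ideal I \<longleftrightarrow> \<infinity> \<in> I \<and> (\<forall>a\<in>I. \<forall>b. a + b \<in> I)"

end

definition finitely_generated_binoid :: "'m::binoid itself \<Rightarrow> bool" where
  "finitely_generated_binoid _ \<longleftrightarrow> (\<exists>A::'m set. finite A \<and> binoid_generated A = UNIV)"

definition cancellative_binoid :: "'m::binoid itself \<Rightarrow> bool" where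
  "cancellative_binoid _ \<longleftrightarrow> (\<forall>a b c::'m. a + b = a + c \<and> a + c \<noteq> \<infinity> \<longrightarrow> b = c)"

text \<open>The multiple \<open>n a\<close> is written as the sum \<open>\<Sum>i<n. a\<close>.\<close>

definition torsion_free_up_to_nilpotence :: "'m::binoid itself \<Rightarrow> bool" where
  "torsion_free_up_to_nilpotence _ \<longleftrightarrow>
     (\<forall>(a::'m) b. \<forall>n::nat\<ge>1. (\<Sum>i<n. a) = (\<Sum>i<n. b) \<and> (\<Sum>i<n. b) \<noteq> \<infinity> \<longrightarrow> a = b)"


section \<open>The binoid algebra\<close>

text \<open>
  An element of the algebra is a finitely supported function on \<open>M\<close> with coefficient \<open>0\<close> at
  \<open>\<infinity>\<close>.  The product is the product of the monoid algebra (the multiplication of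
  \<open>Poly_Mapping\<close>), in which the coefficient at \<open>\<infinity>\<close> is then erased, since \<open>T\<^sup>\<infinity> = 0\<close>.
\<close>

definition erase_infinity :: "('m::binoid \<Rightarrow>\<^sub>0 'k::zero) \<Rightarrow> 'm \<Rightarrow>\<^sub>0 'k" where
  "erase_infinity f = Poly_Mapping.update \<infinity> 0 f"

definition binoid_algebra :: "('m::binoid \<Rightarrow>\<^sub>0 'k::field) ring" where
  "binoid_algebra =
     \<lparr>carrier = {f. Poly_Mapping.lookup f \<infinity> = 0},
      monoid.mult = (\<lambda>f g. erase_infinity (f * g)),
      one = erase_infinity 1,
      zero = 0,
      add = (+)\<rparr>"

definition T :: "'m::binoid \<Rightarrow> 'm \<Rightarrow>\<^sub>0 'k::field" where
  "T a = (if a = \<infinity> then 0 else Poly_Mapping.single a 1)"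

definition monomial :: "('m::binoid \<Rightarrow>\<^sub>0 'k::field) \<Rightarrow> bool" where
  "monomial P \<longleftrightarrow> (\<exists>c a. P = Poly_Mapping.map ((*) c) (T a))"

definition ideal_span :: "'m::binoid set \<Rightarrow> ('m \<Rightarrow>\<^sub>0 'k::field) set" where
  "ideal_span I = {f \<in> carrier binoid_algebra. Poly_Mapping.keys f \<subseteq> I}"

definition combinatorial_ideal :: "('m::binoid \<Rightarrow>\<^sub>0 'k::field) set \<Rightarrow> bool" where
  "combinatorial_ideal \<AA> \<longleftrightarrow> (\<exists>I. binoid_ideal I \<and> \<AA> = ideal_span I)"

lemma lookup_erase_infinity:
  "Poly_Mapping.lookup (erase_infinity f) a = (if a = \<infinity> then 0 else Poly_Mapping.lookup f a)"
  by (simp add: erase_infinity_def lookup_update)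

lemma erase_infinity_add: "erase_infinity (f + g) = erase_infinity f + erase_infinity g"
  by (rule poly_mapping_eqI) (simp add: lookup_erase_infinity lookup_add)

lemma erase_infinity_single:
  "erase_infinity (Poly_Mapping.single a c) = (if a = \<infinity> then 0 else Poly_Mapping.single a c)"
  by (rule poly_mapping_eqI) (auto simp: lookup_erase_infinity lookup_single when_def)

lemma erase_infinity_idem:
  "Poly_Mapping.lookup f \<infinity> = 0 \<Longrightarrow> erase_infinity f = f"
  by (rule poly_mapping_eqI) (simp add: lookup_erase_infinity)

lemma erase_infinity_split:
  fixes f :: "'m::binoid \<Rightarrow>\<^sub>0 'k::field"
  shows "f = erase_infinity f + Poly_Mapping.single \<infinity> (Poly_Mapping.lookup f \<infinity>)"
  by (rule poly_mapping_eqI) (auto simp: lookup_erase_infinity lookup_single lookup_add when_def)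

lemma erase_infinity_single_mult:
  fixes f :: "'m::binoid \<Rightarrow>\<^sub>0 'k::field"
  shows "erase_infinity (f * Poly_Mapping.single \<infinity> c) = 0"
proof (rule poly_mapping_eqI)
  fix a
  have "Poly_Mapping.keys (f * Poly_Mapping.single \<infinity> c) \<subseteq> {\<infinity>}"
    using keys_mult[of f "Poly_Mapping.single \<infinity> c"] by (auto split: if_splits)
  then show "Poly_Mapping.lookup (erase_infinity (f * Poly_Mapping.single \<infinity> c)) a
      = Poly_Mapping.lookup 0 a"
    by (auto simp: lookup_erase_infinity in_keys_iff)
qed

lemma erase_infinity_mult_right:
  fixes f g :: "'m::binoid \<Rightarrow>\<^sub>0 'k::field"
  shows "erase_infinity (f * erase_infinity g) = erase_infinity (f * g)"
proof -
  have "erase_infinity (f * g) = erase_infinity (f * erase_infinity g +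
      f * Poly_Mapping.single \<infinity> (Poly_Mapping.lookup g \<infinity>))"
    by (metis erase_infinity_split distrib_left)
  then show ?thesis by (simp add: erase_infinity_add erase_infinity_single_mult)
qed

lemma erase_infinity_mult_left:
  fixes f g :: "'m::binoid \<Rightarrow>\<^sub>0 'k::field"
  shows "erase_infinity (erase_infinity f * g) = erase_infinity (f * g)"
  by (metis erase_infinity_mult_right mult.commute)

lemma T_mult: "T a \<otimes>\<^bsub>binoid_algebra\<^esub> T b = T (a + b)"
  by (auto simp: binoid_algebra_def T_def mult_single erase_infinity_single)
    (rule poly_mapping_eqI, simp add: lookup_erase_infinity)+

lemma cring_binoid_algebra: "cring (binoid_algebra :: ('m::binoid \<Rightarrow>\<^sub>0 'k::field) ring)"
proof (rule cringI)
  show "abelian_group (binoid_algebra :: ('m::binoid \<Rightarrow>\<^sub>0 'k::field) ring)"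
  proof (rule abelian_groupI)
    fix f :: "'m \<Rightarrow>\<^sub>0 'k"
    assume "f \<in> carrier binoid_algebra"
    then show "\<exists>g\<in>carrier binoid_algebra. g \<oplus>\<^bsub>binoid_algebra\<^esub> f = \<zero>\<^bsub>binoid_algebra\<^esub>"
      by (intro bexI[of _ "- f"]) (auto simp: binoid_algebra_def)
  qed (auto simp: binoid_algebra_def lookup_add algebra_simps)
  show "comm_monoid (binoid_algebra :: ('m::binoid \<Rightarrow>\<^sub>0 'k::field) ring)"
    by (rule comm_monoidI)
      (auto simp: binoid_algebra_def lookup_erase_infinity erase_infinity_mult_left
        erase_infinity_mult_right erase_infinity_idem ac_simps)
qed (auto simp: binoid_algebra_def erase_infinity_add[symmetric] algebra_simps)


section \<open>The Zariski and the combinatorial topology on the spectrum\<close>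

definition Spec :: "('m::binoid \<Rightarrow>\<^sub>0 'k::field) set set" where
  "Spec = {\<pp>. primeideal \<pp> binoid_algebra}"

text \<open>For a single element \<open>P\<close> the set \<open>D(P)\<close> is \<open>D {P}\<close>.\<close>

definition D :: "('m::binoid \<Rightarrow>\<^sub>0 'k::field) set \<Rightarrow> ('m \<Rightarrow>\<^sub>0 'k) set set" where
  "D S = {\<pp> \<in> Spec. \<not> S \<subseteq> \<pp>}"

definition zariski_topology :: "('m::binoid \<Rightarrow>\<^sub>0 'k::field) set topology" where
  "zariski_topology = topology (\<lambda>U. \<exists>\<aa>. ideal \<aa> binoid_algebra \<and> U = D \<aa>)"

definition combinatorial_topology :: "('m::binoid \<Rightarrow>\<^sub>0 'k::field) set topology" where
  "combinatorial_topology = topology (\<lambda>U. \<exists>\<AA>. combinatorial_ideal \<AA> \<and> U = D \<AA>)"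

lemma openin_zariski_topology:
  "openin (zariski_topology :: ('m::binoid \<Rightarrow>\<^sub>0 'k::field) set topology) U \<longleftrightarrow>
     (\<exists>\<aa>. ideal \<aa> binoid_algebra \<and> U = D \<aa>)"
proof -
  interpret R: cring "binoid_algebra :: ('m \<Rightarrow>\<^sub>0 'k) ring" by (rule cring_binoid_algebra)
  let ?R = "binoid_algebra :: ('m \<Rightarrow>\<^sub>0 'k) ring"
  have int: "\<exists>\<cc>. ideal \<cc> ?R \<and> D \<aa> \<inter> D \<bb> = D \<cc>"
    if a: "ideal \<aa> ?R" and b: "ideal \<bb> ?R" for \<aa> \<bb>
  proof (intro exI[of _ "\<aa> \<inter> \<bb>"] conjI)
    show "ideal (\<aa> \<inter> \<bb>) ?R" by (rule R.i_intersect[OF a b])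
    have "\<not> \<aa> \<inter> \<bb> \<subseteq> \<pp>" if p: "primeideal \<pp> ?R" and ab: "\<not> \<aa> \<subseteq> \<pp>" "\<not> \<bb> \<subseteq> \<pp>" for \<pp>
    proof -
      obtain x y where xy: "x \<in> \<aa>" "x \<notin> \<pp>" "y \<in> \<bb>" "y \<notin> \<pp>"
        using ab by (metis subsetI)
      have c: "x \<in> carrier ?R" "y \<in> carrier ?R"
        using ideal.Icarr[OF a] ideal.Icarr[OF b] xy by simp_all
      have "x \<otimes>\<^bsub>?R\<^esub> y \<in> \<aa> \<inter> \<bb>"
        using ideal.I_r_closed[OF a xy(1) c(2)] ideal.I_l_closed[OF b xy(3) c(1)] by simp
      moreover have "x \<otimes>\<^bsub>?R\<^esub> y \<notin> \<pp>" using xy primeideal.I_prime[OF p c] by metis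
      ultimately show ?thesis by blast
    qed
    then show "D \<aa> \<inter> D \<bb> = D (\<aa> \<inter> \<bb>)" by (auto simp: D_def Spec_def)
  qed
  have un: "\<exists>\<cc>. ideal \<cc> ?R \<and> \<Union>\<U> = D \<cc>"
    if U: "\<forall>W\<in>\<U>. \<exists>\<aa>. ideal \<aa> ?R \<and> W = D \<aa>" for \<U>
  proof -
    define S where "S = \<Union>{\<aa>. ideal \<aa> ?R \<and> D \<aa> \<in> \<U>}"
    have S: "S \<subseteq> carrier ?R" by (auto simp: S_def dest: ideal.Icarr)
    have "genideal ?R S \<subseteq> \<pp> \<longleftrightarrow> S \<subseteq> \<pp>" if "primeideal \<pp> ?R" for \<pp>
      using R.genideal_self[OF S] R.genideal_minimal[OF primeideal.axioms(1)[OF that], of S]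
      by blast
    then have "D (genideal ?R S) = D S" by (auto simp: D_def Spec_def)
    also have "D S = \<Union>\<U>"
    proof
      show "D S \<subseteq> \<Union>\<U>" by (force simp: D_def S_def)
      show "\<Union>\<U> \<subseteq> D S" using U by (force simp: D_def S_def)
    qed
    finally show ?thesis using R.genideal_ideal[OF S] by metis
  qed
  have "istopology (\<lambda>U. \<exists>\<aa>. ideal \<aa> ?R \<and> U = D \<aa>)"
    unfolding istopology_def using int un by blast
  then show ?thesis by (simp add: zariski_topology_def topology_inverse')
qed

lemma openin_combinatorial_topology:
  "openin (combinatorial_topology :: ('m::binoid \<Rightarrow>\<^sub>0 'k::field) set topology) U \<longleftrightarrow>
     (\<exists>\<AA>. combinatorial_ideal \<AA> \<and> U = D \<AA>)"
proof -
  interpret R: cring "binoid_algebra :: ('m \<Rightarrow>\<^sub>0 'k) ring" by (rule cring_binoid_algebra)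
  let ?R = "binoid_algebra :: ('m \<Rightarrow>\<^sub>0 'k) ring"
  let ?D = "\<lambda>I. D (ideal_span I :: ('m \<Rightarrow>\<^sub>0 'k) set)"
  have mono: "(ideal_span I :: ('m \<Rightarrow>\<^sub>0 'k) set) \<subseteq> ideal_span J" if "I \<subseteq> J" for I J :: "'m set"
    using that by (auto simp: ideal_span_def)
  have int: "?D I \<inter> ?D J = ?D (I \<inter> J)" if I: "binoid_ideal I" and J: "binoid_ideal J" for I J
  proof
    show "?D (I \<inter> J) \<subseteq> ?D I \<inter> ?D J"
      using mono[of "I \<inter> J" I] mono[of "I \<inter> J" J] by (auto simp: D_def)
    show "?D I \<inter> ?D J \<subseteq> ?D (I \<inter> J)"
    proof
      fix \<pp> assume p: "\<pp> \<in> ?D I \<inter> ?D J"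
      then have prime: "primeideal \<pp> ?R" by (simp add: D_def Spec_def)
      obtain f g where fg: "f \<in> ideal_span I" "f \<notin> \<pp>" "g \<in> ideal_span J" "g \<notin> \<pp>"
        using p by (auto simp: D_def)
      have "a + b \<in> I \<inter> J" if "a \<in> I" "b \<in> J" for a b
        using I J that by (metis IntI add.commute binoid_ideal_def)
      then have "Poly_Mapping.keys (f * g) \<subseteq> I \<inter> J"
        using keys_mult[of f g] fg by (fastforce simp: ideal_span_def)
      then have "f \<otimes>\<^bsub>?R\<^esub> g \<in> ideal_span (I \<inter> J)"
        by (auto simp: ideal_span_def binoid_algebra_def lookup_erase_infinity in_keys_iff
            split: if_splits)
      moreover have "f \<otimes>\<^bsub>?R\<^esub> g \<notin> \<pp>"
        using primeideal.I_prime[OF prime] fg by (auto simp: ideal_span_def)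
      ultimately show "\<pp> \<in> ?D (I \<inter> J)" using prime by (auto simp: D_def Spec_def)
    qed
  qed
  have un: "\<Union>(?D ` \<I>) = ?D (\<Union>\<I> \<union> {\<infinity>})" for \<I> :: "'m set set"
  proof
    show "\<Union>(?D ` \<I>) \<subseteq> ?D (\<Union>\<I> \<union> {\<infinity>})"
    proof
      fix \<pp> assume "\<pp> \<in> \<Union>(?D ` \<I>)"
      then obtain I where "I \<in> \<I>" "\<pp> \<in> ?D I" by auto
      then show "\<pp> \<in> ?D (\<Union>\<I> \<union> {\<infinity>})"
        using mono[of I "\<Union>\<I> \<union> {\<infinity>}"] by (auto simp: D_def)
    qed
    show "?D (\<Union>\<I> \<union> {\<infinity>}) \<subseteq> \<Union>(?D ` \<I>)"
    proof (rule ccontr)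
      assume "\<not> ?thesis"
      then obtain \<pp> where p: "\<pp> \<in> ?D (\<Union>\<I> \<union> {\<infinity>})" "\<And>I. I \<in> \<I> \<Longrightarrow> \<pp> \<notin> ?D I" by auto
      then have prime: "primeideal \<pp> ?R" by (simp add: D_def Spec_def)
      interpret \<pp>: primeideal \<pp> ?R by (rule prime)
      have sub: "ideal_span I \<subseteq> \<pp>" if "I \<in> \<I>" for I
        using p that by (auto simp: D_def)
      obtain f where f: "f \<in> ideal_span (\<Union>\<I> \<union> {\<infinity>})" "f \<notin> \<pp>"
        using p(1) by (auto simp: D_def)
      let ?mono = "\<lambda>a. Poly_Mapping.single a (Poly_Mapping.lookup f a)"
      have mono_in: "?mono a \<in> \<pp>" if a: "a \<in> Poly_Mapping.keys f" for a
      proof -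
        have "a \<noteq> \<infinity>" using f(1) a by (auto simp: ideal_span_def binoid_algebra_def in_keys_iff)
        moreover obtain I where "I \<in> \<I>" "a \<in> I"
          using f(1) a \<open>a \<noteq> \<infinity>\<close> unfolding ideal_span_def by blast
        ultimately have "?mono a \<in> ideal_span I"
          by (auto simp: ideal_span_def binoid_algebra_def lookup_single)
        then show ?thesis using sub[OF \<open>I \<in> \<I>\<close>] by blast
      qed
      have "(\<Sum>a\<in>A. ?mono a) \<in> \<pp>" if "finite A" "A \<subseteq> Poly_Mapping.keys f" for A
        using that
      proof (induction A)
        case empty
        show ?case using \<pp>.zero_closed by (simp add: binoid_algebra_def)
      next
        case (insert a A)
        then have "?mono a \<oplus>\<^bsub>?R\<^esub> (\<Sum>a\<in>A. ?mono a) \<in> \<pp>"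
          using \<pp>.a_closed mono_in by auto
        then show ?case using insert by (simp add: binoid_algebra_def)
      qed
      moreover have "(\<Sum>a\<in>Poly_Mapping.keys f. ?mono a) = f"
        by (rule poly_mapping_eqI)
          (auto simp: lookup_sum lookup_single when_def sum.delta in_keys_iff)
      ultimately show False using f(2) by (metis finite_keys order_refl)
    qed
  qed
  have "istopology (\<lambda>U. \<exists>\<AA>. combinatorial_ideal \<AA> \<and> U = (D \<AA> :: ('m \<Rightarrow>\<^sub>0 'k) set set))"
    unfolding istopology_def
  proof (intro conjI allI impI)
    fix S T' :: "('m \<Rightarrow>\<^sub>0 'k) set set"
    assume "\<exists>\<AA>. combinatorial_ideal \<AA> \<and> S = D \<AA>" "\<exists>\<AA>. combinatorial_ideal \<AA> \<and> T' = D \<AA>"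
    then obtain I J where IJ: "binoid_ideal I" "S = ?D I" "binoid_ideal J" "T' = ?D J"
      by (auto simp: combinatorial_ideal_def)
    then have "binoid_ideal (I \<inter> J)" by (auto simp: binoid_ideal_def)
    then show "\<exists>\<AA>. combinatorial_ideal \<AA> \<and> S \<inter> T' = D \<AA>"
      using int[of I J] IJ by (auto simp: combinatorial_ideal_def)
  next
    fix \<U> :: "('m \<Rightarrow>\<^sub>0 'k) set set set"
    assume "\<forall>W\<in>\<U>. \<exists>\<AA>. combinatorial_ideal \<AA> \<and> W = D \<AA>"
    then have "\<U> = ?D ` {I. binoid_ideal I \<and> ?D I \<in> \<U>}"
      by (fastforce simp: combinatorial_ideal_def)
    then have "\<Union>\<U> = ?D (\<Union>{I. binoid_ideal I \<and> ?D I \<in> \<U>} \<union> {\<infinity>})" by (metis un)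
    moreover have "binoid_ideal (\<Union>{I. binoid_ideal I \<and> ?D I \<in> \<U>} \<union> {\<infinity>})"
      by (auto simp: binoid_ideal_def)
    ultimately show "\<exists>\<AA>. combinatorial_ideal \<AA> \<and> \<Union>\<U> = D \<AA>"
      unfolding combinatorial_ideal_def by blast
  qed
  then show ?thesis by (simp add: combinatorial_topology_def topology_inverse')
qed

section \<open>Sheaves of abelian groups\<close>

text \<open>
  A presheaf on a space \<open>X\<close> only matters on the open sets of \<open>X\<close>.  Hence the restriction of a
  presheaf to an open subspace, or to a coarser topology on the same points, is given by the
  same data \<open>F\<close>, considered with respect to the new space.
\<close>

record ('p, 'a) ab_presheaf =
  sections :: "'p set \<Rightarrow> 'a monoid"
  restriction :: "'p set \<Rightarrow> 'p set \<Rightarrow> 'a \<Rightarrow> 'a"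

definition presheaf :: "'p topology \<Rightarrow> ('p, 'a) ab_presheaf \<Rightarrow> bool" where
  "presheaf X F \<longleftrightarrow>
     (\<forall>U. openin X U \<longrightarrow> comm_group (sections F U)) \<and>
     (\<forall>U V. openin X U \<and> openin X V \<and> V \<subseteq> U \<longrightarrow>
        restriction F U V \<in> hom (sections F U) (sections F V)) \<and>
     (\<forall>U. openin X U \<longrightarrow> (\<forall>s\<in>carrier (sections F U). restriction F U U s = s)) \<and>
     (\<forall>U V W. openin X U \<and> openin X V \<and> openin X W \<and> W \<subseteq> V \<and> V \<subseteq> U \<longrightarrow>
        (\<forall>s\<in>carrier (sections F U).
           restriction F V W (restriction F U V s) = restriction F U W s))"

definition sheaf :: "'p topology \<Rightarrow> ('p, 'a) ab_presheaf \<Rightarrow> bool" where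
  "sheaf X F \<longleftrightarrow> presheaf X F \<and>
     (\<forall>\<U>. (\<forall>W\<in>\<U>. openin X W) \<longrightarrow>
        (\<forall>s\<in>carrier (sections F (\<Union>\<U>)). \<forall>t\<in>carrier (sections F (\<Union>\<U>)).
           (\<forall>W\<in>\<U>. restriction F (\<Union>\<U>) W s = restriction F (\<Union>\<U>) W t) \<longrightarrow> s = t) \<and>
        (\<forall>f. (\<forall>W\<in>\<U>. f W \<in> carrier (sections F W)) \<and>
             (\<forall>V\<in>\<U>. \<forall>W\<in>\<U>. restriction F V (V \<inter> W) (f V) = restriction F W (V \<inter> W) (f W)) \<longrightarrow>
           (\<exists>s\<in>carrier (sections F (\<Union>\<U>)). \<forall>W\<in>\<U>. restriction F (\<Union>\<U>) W s = f W)))"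

text \<open>
  A germ at \<open>x\<close> is an equivalence class of pairs \<open>(V, s)\<close>, where \<open>s\<close> is a section over the open
  neighbourhood \<open>V\<close> of \<open>x\<close>.  It is represented by a chosen element of the class, so that the
  stalks of iterated constructions stay inside one type.
\<close>

definition germ_equiv ::
    "'p topology \<Rightarrow> ('p, 'a) ab_presheaf \<Rightarrow> 'p \<Rightarrow> 'p set \<times> 'a \<Rightarrow> 'p set \<times> 'a \<Rightarrow> bool" where
  "germ_equiv X F x = (\<lambda>(V, s) (W, t).
     openin X V \<and> x \<in> V \<and> s \<in> carrier (sections F V) \<and>
     openin X W \<and> x \<in> W \<and> t \<in> carrier (sections F W) \<and>
     (\<exists>N. openin X N \<and> x \<in> N \<and> N \<subseteq> V \<inter> W \<and> restriction F V N s = restriction F W N t))"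

definition germ :: "'p topology \<Rightarrow> ('p, 'a) ab_presheaf \<Rightarrow> 'p \<Rightarrow> 'p set \<Rightarrow> 'a \<Rightarrow> 'p set \<times> 'a" where
  "germ X F x V s = (SOME r. germ_equiv X F x r (V, s))"

definition stalk :: "'p topology \<Rightarrow> ('p, 'a) ab_presheaf \<Rightarrow> 'p \<Rightarrow> ('p set \<times> 'a) monoid" where
  "stalk X F x =
     \<lparr>carrier = {germ X F x V s | V s. openin X V \<and> x \<in> V \<and> s \<in> carrier (sections F V)},
      monoid.mult = (\<lambda>(V, s) (W, t). germ X F x (V \<inter> W)
        (restriction F V (V \<inter> W) s \<otimes>\<^bsub>sections F (V \<inter> W)\<^esub> restriction F W (V \<inter> W) t)),
      one = germ X F x (topspace X) \<one>\<^bsub>sections F (topspace X)\<^esub>\<rparr>"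


section \<open>Sheaf cohomology via the Godement resolution\<close>

text \<open>
  Let \<open>G F\<close> be the sheaf \<open>U \<mapsto> \<Prod>x\<in>U. F\<^sub>x\<close> with the canonical map \<open>\<eta>\<^sub>F : F \<rightarrow> G F\<close>.  The sheaves
  \<open>C\<^sup>n = G\<^sup>n\<^sup>+\<^sup>1 F\<close> form the standard (Godement) flasque resolution \<open>0 \<rightarrow> F \<rightarrow> C\<^sup>0 \<rightarrow> C\<^sup>1 \<rightarrow> \<dots>\<close> of \<open>F\<close>, with the
  differentials \<open>\<delta>\<^sub>n : G\<^sup>n F \<rightarrow> G\<^sup>n\<^sup>+\<^sup>1 F\<close> given by the alternating sum
  \<open>\<Sum>i\<le>n. (-1)\<^sup>i G\<^sup>i \<eta>\<close> (with \<open>\<eta>\<close> taken at \<open>G\<^sup>n\<^sup>-\<^sup>i F\<close>); equivalently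
  \<open>\<delta>\<^sub>0 = \<eta>\<^sub>F\<close> and \<open>\<delta>\<^sub>n\<^sub>+\<^sub>1 = \<eta> - G \<delta>\<^sub>n\<close>.  The sheaf cohomology of \<open>F\<close> is the cohomology
  of the complex of global sections of \<open>C\<^sup>0 \<rightarrow> C\<^sup>1 \<rightarrow> \<dots>\<close>.

  The sections of all \<open>G\<^sup>n F\<close> live in the following type: either a section of \<open>F\<close>, or a
  family of germs.  The groups of sections are written multiplicatively.
\<close>

datatype ('p, 'a) godement = Section (the_section: 'a)
  | Germs (germ_at: "'p \<Rightarrow> 'p set \<times> ('p, 'a) godement")

definition transport_group :: "('a \<Rightarrow> 'b) \<Rightarrow> ('b \<Rightarrow> 'a) \<Rightarrow> 'a monoid \<Rightarrow> 'b monoid" where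
  "transport_group c d A =
     \<lparr>carrier = c ` carrier A, monoid.mult = (\<lambda>s t. c (d s \<otimes>\<^bsub>A\<^esub> d t)), one = c \<one>\<^bsub>A\<^esub>\<rparr>"

definition base_presheaf :: "('p, 'a) ab_presheaf \<Rightarrow> ('p, ('p, 'a) godement) ab_presheaf" where
  "base_presheaf F =
     \<lparr>sections = (\<lambda>U. transport_group Section the_section (sections F U)),
      restriction = (\<lambda>U V s. Section (restriction F U V (the_section s)))\<rparr>"

definition godement_sheaf ::
    "'p topology \<Rightarrow> ('p, ('p, 'a) godement) ab_presheaf \<Rightarrow> ('p, ('p, 'a) godement) ab_presheaf" where
  "godement_sheaf X F =
     \<lparr>sections = (\<lambda>U. transport_group Germs germ_at (product_group U (stalk X F))),
      restriction = (\<lambda>U V s. Germs (restrict (germ_at s) V))\<rparr>"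

definition godement_unit ::
    "'p topology \<Rightarrow> ('p, ('p, 'a) godement) ab_presheaf \<Rightarrow> 'p set \<Rightarrow>
       ('p, 'a) godement \<Rightarrow> ('p, 'a) godement" where
  "godement_unit X F U s = Germs (\<lambda>x\<in>U. germ X F x U s)"

text \<open>The map \<open>G \<phi>\<close> induced by a morphism \<open>\<phi>\<close> of presheaves with target \<open>F'\<close>.\<close>

definition godement_map ::
    "'p topology \<Rightarrow> ('p, ('p, 'a) godement) ab_presheaf \<Rightarrow>
       ('p set \<Rightarrow> ('p, 'a) godement \<Rightarrow> ('p, 'a) godement) \<Rightarrow>
       'p set \<Rightarrow> ('p, 'a) godement \<Rightarrow> ('p, 'a) godement" where
  "godement_map X F' \<phi> U s =
     Germs (\<lambda>x\<in>U. case germ_at s x of (V, t) \<Rightarrow> germ X F' x V (\<phi> V t))"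

primrec godement_power ::
    "'p topology \<Rightarrow> ('p, 'a) ab_presheaf \<Rightarrow> nat \<Rightarrow> ('p, ('p, 'a) godement) ab_presheaf" where
  "godement_power X F 0 = base_presheaf F"
| "godement_power X F (Suc n) = godement_sheaf X (godement_power X F n)"

primrec godement_diff ::
    "'p topology \<Rightarrow> ('p, 'a) ab_presheaf \<Rightarrow> nat \<Rightarrow> 'p set \<Rightarrow>
       ('p, 'a) godement \<Rightarrow> ('p, 'a) godement" where
  "godement_diff X F 0 = godement_unit X (godement_power X F 0)"
| "godement_diff X F (Suc n) = (\<lambda>U s.
     let A = sections (godement_power X F (Suc (Suc n))) U in
       godement_unit X (godement_power X F (Suc n)) U s \<otimes>\<^bsub>A\<^esub>
       inv\<^bsub>A\<^esub> (godement_map X (godement_power X F (Suc n)) (godement_diff X F n) U s))"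

definition godement_complex ::
    "'p topology \<Rightarrow> ('p, 'a) ab_presheaf \<Rightarrow> nat \<Rightarrow> ('p, 'a) godement monoid" where
  "godement_complex X F j = sections (godement_power X F (Suc j)) (topspace X)"

definition cocycles ::
    "'p topology \<Rightarrow> ('p, 'a) ab_presheaf \<Rightarrow> nat \<Rightarrow> ('p, 'a) godement set" where
  "cocycles X F j = kernel (godement_complex X F j) (godement_complex X F (Suc j))
     (godement_diff X F (Suc j) (topspace X))"

fun coboundaries ::
    "'p topology \<Rightarrow> ('p, 'a) ab_presheaf \<Rightarrow> nat \<Rightarrow> ('p, 'a) godement set" where
  "coboundaries X F 0 = {\<one>\<^bsub>godement_complex X F 0\<^esub>}"
| "coboundaries X F (Suc j) =
     godement_diff X F (Suc j) (topspace X) ` carrier (godement_complex X F j)"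

definition sheaf_cohomology ::
    "'p topology \<Rightarrow> ('p, 'a) ab_presheaf \<Rightarrow> nat \<Rightarrow> ('p, 'a) godement set monoid" where
  "sheaf_cohomology X F j =
     (godement_complex X F j)\<lparr>carrier := cocycles X F j\<rparr> Mod coboundaries X F j"

definition H_Zar ::
    "('m::binoid \<Rightarrow>\<^sub>0 'k::field) set set \<Rightarrow> (('m \<Rightarrow>\<^sub>0 'k) set, 'a) ab_presheaf \<Rightarrow> nat \<Rightarrow>
       (('m \<Rightarrow>\<^sub>0 'k) set, 'a) godement set monoid" where
  "H_Zar U F j = sheaf_cohomology (subtopology zariski_topology U) F j"

definition H_comb ::
    "('m::binoid \<Rightarrow>\<^sub>0 'k::field) set set \<Rightarrow> (('m \<Rightarrow>\<^sub>0 'k) set, 'a) ab_presheaf \<Rightarrow> nat \<Rightarrow>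
       (('m \<Rightarrow>\<^sub>0 'k) set, 'a) godement set monoid" where
  "H_comb U F j = sheaf_cohomology (subtopology combinatorial_topology U) F j"

definition acyclic_covering ::
    "('m::binoid \<Rightarrow>\<^sub>0 'k::field) set set set \<Rightarrow> ('m \<Rightarrow>\<^sub>0 'k) set set \<Rightarrow>
       (('m \<Rightarrow>\<^sub>0 'k) set, 'a) ab_presheaf \<Rightarrow> bool" where
  "acyclic_covering \<V> U F \<longleftrightarrow>
     (\<forall>V\<in>\<V>. openin (subtopology zariski_topology U) V) \<and> U = \<Union>\<V> \<and>
     (\<forall>\<W>. \<W> \<subseteq> \<V> \<and> finite \<W> \<and> \<W> \<noteq> {} \<longrightarrow>
        (\<forall>k\<ge>1. trivial_group (H_Zar (\<Inter>\<W>) F k)))"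

end

theory Submission
  imports Defs
begin

text \<open>
  Both cohomologies agree with the Cech cohomology of \<open>F\<close> on the covering.  In the double complex of
  Cech cochains with values in the Godement resolution, the rows are exact because a Godement sheaf
  is a product of stalks: choosing for every point a member of the covering that contains it gives a
  contracting homotopy.  The columns are exact because the covering is acyclic.  For the Zariski
  topology this is the hypothesis.  For the combinatorial topology a nonempty finite intersection
  of members is \<open>D(T\<^sup>a)\<close> for some \<open>a\<close>, and it contains a point lying in no smaller combinatorial open
  set: the kernel of the evaluation \<open>K[M] \<rightarrow> K\<close> sending \<open>T\<^sup>b\<close> to \<open>1\<close> if \<open>b\<close> divides a multiple of \<open>a\<close>, and
  to \<open>0\<close> otherwise.  Taking the stalk at this point is taking sections, which is exact.
\<close>

section \<open>Double complexes with exact rows and columns\<close>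

text \<open>The two Godement resolutions are never compared with each other: their stalks are formed
  in different topologies. The Cech group between them is defined by sections and restrictions over
  intersections of members of the covering only, so it is literally the same group for both
  topologies. Neither a total complex nor a spectral sequence is formed. The comparison moves along
  the antidiagonals of the augmented double complex one square at a time, through groups of elements
  killed by both differentials, modulo images of the composite differential. Two obstacles shape the
  rest. Acyclicity is a statement about resolutions computed inside each intersection, whereas the
  double complex uses the resolution of the whole space; since germs are chosen representatives, the
  two are isomorphic but need not be equal, and cocycles have to be transported. Empty intersections
  contain no point at all and are handled by the triviality of sections over the empty set.\<close>

lemma comm_group_update_carrier:
  assumes "comm_group G" "subgroup H G"
  shows "comm_group (G\<lparr>carrier := H\<rparr>)"
proof -
  interpret G: comm_group G by fact
  interpret H: group "G\<lparr>carrier := H\<rparr>"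
    using assms by (intro subgroup.subgroup_is_group) (auto intro: G.is_group)
  show ?thesis
    using subgroup.subset[OF assms(2)] by (intro H.group_comm_groupI) (auto intro: G.m_comm)
qed

text \<open>The composite of \<open>f\<close> with the projection to \<open>G Mod B\<close> is onto
  with this preimage as kernel, so the first isomorphism theorem applies.\<close>

lemma FactGroup_preimage_iso:
  assumes Y: "group Y" and B: "B \<lhd> G" and f: "f \<in> hom Y G" "f ` carrier Y = carrier G"
  shows "Y Mod {y \<in> carrier Y. f y \<in> B} \<cong> G Mod B"
proof -
  interpret Y: group Y by fact
  interpret B: normal B G by fact
  interpret Q: group "G Mod B" by (rule B.factorgroup_is_group)
  define h where "h = (\<lambda>y. B #>\<^bsub>G\<^esub> f y)"
  have fc: "f y \<in> carrier G" if "y \<in> carrier Y" for y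
    using f that by blast
  interpret h: group_hom Y "G Mod B" h
  proof unfold_locales
    show "h \<in> hom Y (G Mod B)"
      using f(1) fc by (auto simp: hom_def h_def carrier_FactGroup B.rcos_sum)
  qed
  have "h ` carrier Y = carrier (G Mod B)"
    unfolding h_def carrier_FactGroup by (simp add: f(2)[symmetric] image_image)
  then have "Y Mod kernel Y (G Mod B) h \<cong> G Mod B"
    by (rule h.FactGroup_iso)
  moreover have "kernel Y (G Mod B) h = {y \<in> carrier Y. f y \<in> B}"
    using fc B.rcos_const B.subgroup_axioms
    by (auto simp: kernel_def h_def) (metis B.rcos_self B.is_group B.subgroup_axioms B.rcos_self)
  ultimately show ?thesis by simp
qed

text \<open>Both quotients are \<open>Y\<close> modulo one subgroup, the common preimage of
  \<open>B\<close> and \<open>C\<close>. A zigzag through \<open>Y\<close> thus gives an isomorphism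
  without choosing preimages or checking well-definedness.\<close>

lemma FactGroup_iso_of_correspondence:
  assumes Y: "group Y" and G: "comm_group G" and H: "comm_group H"
    and f: "f \<in> hom Y G" "f ` carrier Y = Z" and g: "g \<in> hom Y H" "g ` carrier Y = W"
    and B: "subgroup B G" "B \<subseteq> Z" and C: "subgroup C H" "C \<subseteq> W"
    and eq: "\<And>y. y \<in> carrier Y \<Longrightarrow> f y \<in> B \<longleftrightarrow> g y \<in> C"
  shows "G\<lparr>carrier := Z\<rparr> Mod B \<cong> H\<lparr>carrier := W\<rparr> Mod C"
proof -
  interpret Y: group Y by fact
  have half: "Y Mod {y \<in> carrier Y. f y \<in> B} \<cong> G\<lparr>carrier := f ` carrier Y\<rparr> Mod B"
    if G: "comm_group G" and f: "f \<in> hom Y G" and B: "subgroup B G" "B \<subseteq> f ` carrier Y"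
    for G :: "('x, 'y) monoid_scheme" and f B
  proof (rule FactGroup_preimage_iso[OF Y])
    interpret G: comm_group G by fact
    interpret f: group_hom Y G f using f by unfold_locales
    have Z: "subgroup (f ` carrier Y) G" by (rule f.img_is_subgroup)
    interpret GZ: comm_group "G\<lparr>carrier := f ` carrier Y\<rparr>"
      by (rule comm_group_update_carrier[OF G Z])
    show "B \<lhd> G\<lparr>carrier := f ` carrier Y\<rparr>"
      by (intro GZ.subgroup_imp_normal G.subgroup_incl B Z)
    show "f \<in> hom Y (G\<lparr>carrier := f ` carrier Y\<rparr>)"
      using f by (auto simp: hom_def)
  qed auto
  have "group (Y Mod {y \<in> carrier Y. f y \<in> B})"
  proof -
    interpret G: comm_group G by fact
    interpret f: group_hom Y G f using f by unfold_locales
    have "subgroup {y \<in> carrier Y. f y \<in> B} Y"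
      using B(1) by unfold_locales
        (auto simp: subgroup.m_closed subgroup.one_closed subgroup.m_inv_closed)
    \<comment> \<open>\<open>Y\<close> need not be abelian, but conjugation becomes trivial after
      applying \<open>f\<close> because \<open>G\<close> is.\<close>
    moreover have "y \<otimes>\<^bsub>Y\<^esub> x \<otimes>\<^bsub>Y\<^esub> inv\<^bsub>Y\<^esub> y \<in> {y \<in> carrier Y. f y \<in> B}"
      if "x \<in> {y \<in> carrier Y. f y \<in> B}" "y \<in> carrier Y" for x y
    proof -
      have "f (y \<otimes>\<^bsub>Y\<^esub> x \<otimes>\<^bsub>Y\<^esub> inv\<^bsub>Y\<^esub> y) = f x"
        using that G.m_comm[of "f y" "f x"] by (simp add: G.m_assoc)
      then show ?thesis using that by auto
    qed
    ultimately show ?thesis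
      by (intro normal.factorgroup_is_group) (auto simp: Y.normal_inv_iff)
  qed
  moreover have "{y \<in> carrier Y. f y \<in> B} = {y \<in> carrier Y. g y \<in> C}"
    using eq by auto
  moreover note half[OF G f(1) B(1), unfolded f(2), OF B(2)]
    half[OF H g(1) C(1), unfolded g(2), OF C(2)]
  ultimately show ?thesis
    by (simp add: iso_trans[OF group.iso_sym])
qed

text \<open>Index 0 is the augmentation in each direction. Exactness in direction \<open>d\<close>
  is required only for second index at least 1, and in direction \<open>e\<close> only for first
  index at least 1. What remains free is the cohomology of the two edges \<open>E 0 q\<close> and
  \<open>E p 0\<close>, which is to be compared. The squares commute instead of anticommuting
  because no total complex is formed.\<close>

locale double_complex =
  fixes E :: "nat \<Rightarrow> nat \<Rightarrow> 'c monoid"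
    and d e :: "nat \<Rightarrow> nat \<Rightarrow> 'c \<Rightarrow> 'c"
  assumes grp: "comm_group (E p q)"
    and d_hom: "d p q \<in> hom (E p q) (E (Suc p) q)"
    and e_hom: "e p q \<in> hom (E p q) (E p (Suc q))"
    and dd: "x \<in> carrier (E p q) \<Longrightarrow> d (Suc p) q (d p q x) = \<one>\<^bsub>E (Suc (Suc p)) q\<^esub>"
    and ee: "x \<in> carrier (E p q) \<Longrightarrow> e p (Suc q) (e p q x) = \<one>\<^bsub>E p (Suc (Suc q))\<^esub>"
    and de: "x \<in> carrier (E p q) \<Longrightarrow> d p (Suc q) (e p q x) = e (Suc p) q (d p q x)"
    and d_inj: "x \<in> carrier (E 0 (Suc q)) \<Longrightarrow> d 0 (Suc q) x = \<one>\<^bsub>E (Suc 0) (Suc q)\<^esub> \<Longrightarrow>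
      x = \<one>\<^bsub>E 0 (Suc q)\<^esub>"
    and d_exact: "x \<in> carrier (E (Suc p) (Suc q)) \<Longrightarrow>
      d (Suc p) (Suc q) x = \<one>\<^bsub>E (Suc (Suc p)) (Suc q)\<^esub> \<Longrightarrow>
      x \<in> d p (Suc q) ` carrier (E p (Suc q))"
    and e_inj: "x \<in> carrier (E (Suc p) 0) \<Longrightarrow> e (Suc p) 0 x = \<one>\<^bsub>E (Suc p) (Suc 0)\<^esub> \<Longrightarrow>
      x = \<one>\<^bsub>E (Suc p) 0\<^esub>"
    and e_exact: "x \<in> carrier (E (Suc p) (Suc q)) \<Longrightarrow>
      e (Suc p) (Suc q) x = \<one>\<^bsub>E (Suc p) (Suc (Suc q))\<^esub> \<Longrightarrow>
      x \<in> e (Suc p) q ` carrier (E (Suc p) q)"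
begin

lemma transpose: "double_complex (\<lambda>p q. E q p) (\<lambda>p q. e q p) (\<lambda>p q. d q p)"
  by (rule double_complex.intro)
    (fact grp d_hom e_hom dd ee de[symmetric] d_inj d_exact e_inj e_exact)+

lemma d_group_hom: "group_hom (E p q) (E (Suc p) q) (d p q)"
  using grp[of p q] grp[of "Suc p" q] d_hom
  by (simp add: group_hom_def group_hom_axioms_def comm_group.axioms)

lemma e_group_hom: "group_hom (E p q) (E p (Suc q)) (e p q)"
  using grp[of p q] grp[of p "Suc q"] e_hom
  by (simp add: group_hom_def group_hom_axioms_def comm_group.axioms)

lemma ones:
  "d p q \<one>\<^bsub>E p q\<^esub> = \<one>\<^bsub>E (Suc p) q\<^esub>" "e p q \<one>\<^bsub>E p q\<^esub> = \<one>\<^bsub>E p (Suc q)\<^esub>"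
  "\<one>\<^bsub>E p q\<^esub> \<in> carrier (E p q)"
  using group_hom.hom_one[OF d_group_hom] group_hom.hom_one[OF e_group_hom]
    comm_groupE(2)[OF grp] by auto

definition Z :: "nat \<Rightarrow> nat \<Rightarrow> 'c set" where
  "Z p q = {x \<in> carrier (E p q). d p q x = \<one>\<^bsub>E (Suc p) q\<^esub> \<and> e p q x = \<one>\<^bsub>E p (Suc q)\<^esub>}"

text \<open>The corner \<open>(0, 0)\<close> is treated as if \<open>E 0 0\<close> were trivial, because the complexes along the
  two edges have no coboundaries in degree zero.\<close>

definition B :: "nat \<Rightarrow> nat \<Rightarrow> 'c set" where
  "B p q = (if p = 0 \<and> q = 0 then {\<one>\<^bsub>E (Suc 0) (Suc 0)\<^esub>}
     else d p (Suc q) ` e p q ` carrier (E p q))"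

lemma de_image: "d p (Suc q) ` e p q ` carrier (E p q) = e (Suc p) q ` d p q ` carrier (E p q)"
  unfolding image_image by (rule image_cong) (auto simp: de)

lemma subgroup_B: "subgroup (B p q) (E (Suc p) (Suc q))"
proof (cases "p = 0 \<and> q = 0")
  case True
  interpret group "E (Suc 0) (Suc 0)" using grp by (rule comm_group.axioms)
  show ?thesis using True triv_subgroup by (simp add: B_def)
next
  case False
  interpret d: group_hom "E p (Suc q)" "E (Suc p) (Suc q)" "d p (Suc q)" by (rule d_group_hom)
  interpret e: group_hom "E p q" "E p (Suc q)" "e p q" by (rule e_group_hom)
  show ?thesis
    using False d.subgroup_img_is_subgroup[OF e.img_is_subgroup] by (auto simp: B_def)
qed

lemma Z_group: "subgroup (Z p q) (E p q)"
proof -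
  interpret d: group_hom "E p q" "E (Suc p) q" "d p q" by (rule d_group_hom)
  interpret e: group_hom "E p q" "E p (Suc q)" "e p q" by (rule e_group_hom)
  have "Z p q = kernel (E p q) (E (Suc p) q) (d p q) \<inter> kernel (E p q) (E p (Suc q)) (e p q)"
    by (auto simp: Z_def kernel_def)
  then show ?thesis
    using d.subgroup_kernel e.subgroup_kernel d.G.subgroups_Inter_pair by metis
qed

lemma B_subset_Z: "B p q \<subseteq> Z (Suc p) (Suc q)"
proof (cases "p = 0 \<and> q = 0")
  case True
  then show ?thesis using Z_group[of 1 1] by (auto simp: B_def subgroup.one_closed)
next
  case False
  have "d p (Suc q) (e p q x) \<in> Z (Suc p) (Suc q)" if "x \<in> carrier (E p q)" for x
  proof -
    interpret d: group_hom "E p (Suc q)" "E (Suc p) (Suc q)" "d p (Suc q)" by (rule d_group_hom)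
    interpret e: group_hom "E p q" "E p (Suc q)" "e p q" by (rule e_group_hom)
    interpret d': group_hom "E p q" "E (Suc p) q" "d p q" by (rule d_group_hom)
    show ?thesis using that by (auto simp: Z_def dd) (simp add: de ee)
  qed
  then show ?thesis using False by (auto simp: B_def)
qed

text \<open>A group of Bott-Chern type: bicocycles modulo the image of the composite of the two
  differentials, labelled by the corner where the composite starts. It links the two edges because
  it is constant on antidiagonals up to isomorphism.\<close>

definition H :: "nat \<Rightarrow> nat \<Rightarrow> 'c set monoid" where
  "H p q = (E (Suc p) (Suc q))\<lparr>carrier := Z (Suc p) (Suc q)\<rparr> Mod B p q"

text \<open>The span consists of the \<open>y\<close> at position \<open>(Suc p, Suc q)\<close> with
  \<open>d (e y)\<close> trivial: \<open>e\<close> and \<open>d\<close> map them onto the bicocycles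
  at the two neighbouring positions, by column and by row exactness. The exceptional corner of
  \<open>B\<close> does not occur, since each of the two label pairs contains a successor.\<close>

lemma H_step: "H p (Suc q) \<cong> H (Suc p) q"
proof -
  let ?C = "E (Suc p) (Suc q)"
  let ?Yc = "{y \<in> carrier ?C. d (Suc p) (Suc (Suc q)) (e (Suc p) (Suc q) y) = \<one>\<^bsub>E (Suc (Suc p)) (Suc (Suc q))\<^esub>}"
  interpret d: group_hom "E (Suc p) (Suc q)" "E (Suc (Suc p)) (Suc q)" "d (Suc p) (Suc q)"
    by (rule d_group_hom)
  interpret e: group_hom "E (Suc p) (Suc q)" "E (Suc p) (Suc (Suc q))" "e (Suc p) (Suc q)"
    by (rule e_group_hom)
  interpret d': group_hom "E (Suc p) (Suc (Suc q))" "E (Suc (Suc p)) (Suc (Suc q))"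
    "d (Suc p) (Suc (Suc q))"
    by (rule d_group_hom)
  interpret C: comm_group ?C by (rule grp)
  have Y: "subgroup ?Yc ?C"
    by unfold_locales auto
  interpret Y: group "?C\<lparr>carrier := ?Yc\<rparr>"
    by (rule comm_group.axioms(2), rule comm_group_update_carrier[OF grp Y])
  have eq: "e (Suc p) (Suc q) y \<in> B p (Suc q) \<longleftrightarrow> d (Suc p) (Suc q) y \<in> B (Suc p) q"
    if y: "y \<in> carrier ?C" for y
  proof -
    interpret dl: group_hom "E p (Suc q)" "E (Suc p) (Suc q)" "d p (Suc q)" by (rule d_group_hom)
    interpret eu: group_hom "E (Suc p) q" "E (Suc p) (Suc q)" "e (Suc p) q" by (rule e_group_hom)
    \<comment> \<open>A condition symmetric in the two directions: \<open>e y\<close> is a boundary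
      iff \<open>y\<close> lies in the image of \<open>d\<close> up to the kernel of
      \<open>e\<close>, which is the image of \<open>e\<close>; for \<open>d y\<close> the roles are
      exchanged.\<close>
    let ?P = "\<exists>w\<in>carrier (E p (Suc q)). \<exists>v\<in>carrier (E (Suc p) q).
      y = d p (Suc q) w \<otimes>\<^bsub>?C\<^esub> e (Suc p) q v"
    have 1: "e (Suc p) (Suc q) y \<in> B p (Suc q) \<longleftrightarrow> ?P"
    proof
      assume "e (Suc p) (Suc q) y \<in> B p (Suc q)"
      then obtain w where w: "w \<in> carrier (E p (Suc q))"
        "e (Suc p) (Suc q) y = e (Suc p) (Suc q) (d p (Suc q) w)"
        unfolding B_def de_image by auto
      then have "e (Suc p) (Suc q) (inv\<^bsub>?C\<^esub> (d p (Suc q) w) \<otimes>\<^bsub>?C\<^esub> y) = \<one>\<^bsub>E (Suc p) (Suc (Suc q))\<^esub>"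
        using y by simp
      then obtain v where v: "v \<in> carrier (E (Suc p) q)"
        "inv\<^bsub>?C\<^esub> (d p (Suc q) w) \<otimes>\<^bsub>?C\<^esub> y = e (Suc p) q v"
        using e_exact[of "inv\<^bsub>?C\<^esub> (d p (Suc q) w) \<otimes>\<^bsub>?C\<^esub> y" p q] w y by auto
      then have "y = d p (Suc q) w \<otimes>\<^bsub>?C\<^esub> e (Suc p) q v"
        using w y by (metis d.G.inv_solve_left dl.hom_closed eu.hom_closed)
      then show ?P using w v by blast
    next
      assume ?P
      then obtain w v where "w \<in> carrier (E p (Suc q))" "v \<in> carrier (E (Suc p) q)"
        "y = d p (Suc q) w \<otimes>\<^bsub>?C\<^esub> e (Suc p) q v" by blast
      then show "e (Suc p) (Suc q) y \<in> B p (Suc q)"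
        unfolding B_def de_image by (auto simp: ee)
    qed
    have 2: "d (Suc p) (Suc q) y \<in> B (Suc p) q \<longleftrightarrow> ?P"
    proof
      assume "d (Suc p) (Suc q) y \<in> B (Suc p) q"
      then obtain v where v: "v \<in> carrier (E (Suc p) q)"
        "d (Suc p) (Suc q) y = d (Suc p) (Suc q) (e (Suc p) q v)"
        unfolding B_def by auto
      then have "d (Suc p) (Suc q) (inv\<^bsub>?C\<^esub> (e (Suc p) q v) \<otimes>\<^bsub>?C\<^esub> y) = \<one>\<^bsub>E (Suc (Suc p)) (Suc q)\<^esub>"
        using y by simp
      then obtain w where w: "w \<in> carrier (E p (Suc q))"
        "inv\<^bsub>?C\<^esub> (e (Suc p) q v) \<otimes>\<^bsub>?C\<^esub> y = d p (Suc q) w"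
        using d_exact[of "inv\<^bsub>?C\<^esub> (e (Suc p) q v) \<otimes>\<^bsub>?C\<^esub> y" p q] v y by auto
      then have "y = e (Suc p) q v \<otimes>\<^bsub>?C\<^esub> d p (Suc q) w"
        using v y by (metis d.G.inv_solve_left dl.hom_closed eu.hom_closed)
      then show ?P using w v C.m_comm by (metis dl.hom_closed eu.hom_closed)
    next
      assume ?P
      then obtain w v where "w \<in> carrier (E p (Suc q))" "v \<in> carrier (E (Suc p) q)"
        "y = d p (Suc q) w \<otimes>\<^bsub>?C\<^esub> e (Suc p) q v" by blast
      then show "d (Suc p) (Suc q) y \<in> B (Suc p) q"
        unfolding B_def by (auto simp: dd)
    qed
    show ?thesis using 1 2 by simp
  qed
  show ?thesis
    unfolding H_def
  proof (rule FactGroup_iso_of_correspondence[OF Y.is_group grp grp, where f = "e (Suc p) (Suc q)"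
      and g = "d (Suc p) (Suc q)"])
    show "e (Suc p) (Suc q) \<in> hom (?C\<lparr>carrier := ?Yc\<rparr>) (E (Suc p) (Suc (Suc q)))"
      "d (Suc p) (Suc q) \<in> hom (?C\<lparr>carrier := ?Yc\<rparr>) (E (Suc (Suc p)) (Suc q))"
      by (auto simp: hom_def)
    show "e (Suc p) (Suc q) ` carrier (?C\<lparr>carrier := ?Yc\<rparr>) = Z (Suc p) (Suc (Suc q))"
      using e_exact by (fastforce simp: Z_def ee)
    show "d (Suc p) (Suc q) ` carrier (?C\<lparr>carrier := ?Yc\<rparr>) = Z (Suc (Suc p)) (Suc q)"
      using d_exact by (fastforce simp: Z_def dd de)
  qed (use eq subgroup_B B_subset_Z in auto)
qed

lemma H_iso: "H 0 n \<cong> H n 0"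
proof -
  have "p \<le> n \<Longrightarrow> H 0 n \<cong> H p (n - p)" for p
  proof (induction p)
    case 0
    then show ?case by simp
  next
    case (Suc p)
    then have "H p (n - p) \<cong> H (Suc p) (n - Suc p)"
      using H_step[of p "n - Suc p"] by (simp add: Suc_diff_Suc)
    then show ?case using Suc by (meson iso_trans Suc_leD)
  qed
  from this[of n] show ?thesis by simp
qed

text \<open>Index 0 of the column is the augmentation, so degree \<open>n\<close> sits at index
  \<open>Suc n\<close>, and degree 0 has no coboundaries although \<open>e 0 0\<close> maps into
  it.\<close>

definition edge_cohomology :: "nat \<Rightarrow> 'c set monoid" where
  "edge_cohomology n =
     (E 0 (Suc n))\<lparr>carrier := kernel (E 0 (Suc n)) (E 0 (Suc (Suc n))) (e 0 (Suc n))\<rparr> Mod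
     (if n = 0 then {\<one>\<^bsub>E 0 (Suc 0)\<^esub>} else e 0 n ` carrier (E 0 n))"

lemma group_edge_cohomology: "group (edge_cohomology n)"
proof -
  interpret e: group_hom "E 0 (Suc n)" "E 0 (Suc (Suc n))" "e 0 (Suc n)" by (rule e_group_hom)
  interpret e': group_hom "E 0 n" "E 0 (Suc n)" "e 0 n" by (rule e_group_hom)
  interpret K: comm_group
    "(E 0 (Suc n))\<lparr>carrier := kernel (E 0 (Suc n)) (E 0 (Suc (Suc n))) (e 0 (Suc n))\<rparr>"
    by (rule comm_group_update_carrier[OF grp e.subgroup_kernel])
  have "subgroup (if n = 0 then {\<one>\<^bsub>E 0 (Suc 0)\<^esub>} else e 0 n ` carrier (E 0 n)) (E 0 (Suc n))"
    using e'.img_is_subgroup e.G.triv_subgroup by auto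
  moreover have "(if n = 0 then {\<one>\<^bsub>E 0 (Suc 0)\<^esub>} else e 0 n ` carrier (E 0 n)) \<subseteq>
      kernel (E 0 (Suc n)) (E 0 (Suc (Suc n))) (e 0 (Suc n))"
    using ones by (auto simp: kernel_def ee)
  ultimately show ?thesis
    unfolding edge_cohomology_def
    by (intro K.abelian_FactGroup[THEN comm_group.axioms(2)] e.G.subgroup_incl e.subgroup_kernel)
qed

text \<open>The map is \<open>d\<close>, injective on the column with first index 0. Every bicocycle
  is some \<open>d y\<close> by row exactness; since \<open>d\<close> then kills \<open>e y\<close>,
  injectivity one step further shows that \<open>y\<close> is a cocycle.\<close>

lemma edge_cohomology_iso: "edge_cohomology n \<cong> H 0 n"
proof -
  let ?C = "E 0 (Suc n)" and ?K = "kernel (E 0 (Suc n)) (E 0 (Suc (Suc n))) (e 0 (Suc n))"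
  let ?B = "if n = 0 then {\<one>\<^bsub>E 0 (Suc 0)\<^esub>} else e 0 n ` carrier (E 0 n)"
  interpret e: group_hom "E 0 (Suc n)" "E 0 (Suc (Suc n))" "e 0 (Suc n)" by (rule e_group_hom)
  interpret e': group_hom "E 0 n" "E 0 (Suc n)" "e 0 n" by (rule e_group_hom)
  interpret d: group_hom "E 0 (Suc n)" "E (Suc 0) (Suc n)" "d 0 (Suc n)" by (rule d_group_hom)
  interpret d': group_hom "E 0 (Suc (Suc n))" "E (Suc 0) (Suc (Suc n))" "d 0 (Suc (Suc n))"
    by (rule d_group_hom)
  interpret K: group "?C\<lparr>carrier := ?K\<rparr>"
    by (rule comm_group.axioms(2), rule comm_group_update_carrier[OF grp e.subgroup_kernel])
  have inj: "inj_on (d 0 (Suc n)) (carrier ?C)"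
    using d_inj by (auto simp: d.inj_on_one_iff)
  have B: "B 0 n = d 0 (Suc n) ` ?B"
    using ones by (auto simp: B_def image_image)
  have Bc: "?B \<subseteq> carrier ?C"
    using ones by auto
  have Bs: "subgroup ?B ?C"
    using e'.img_is_subgroup e.G.triv_subgroup by auto
  show ?thesis
    unfolding edge_cohomology_def H_def
  proof (rule FactGroup_iso_of_correspondence[OF K.is_group grp grp, where f = id and g = "d 0 (Suc n)"])
    show "id \<in> hom (?C\<lparr>carrier := ?K\<rparr>) ?C" "d 0 (Suc n) \<in> hom (?C\<lparr>carrier := ?K\<rparr>) (E (Suc 0) (Suc n))"
      by (auto simp: hom_def kernel_def)
    show "id ` carrier (?C\<lparr>carrier := ?K\<rparr>) = ?K"
      by simp
    show "d 0 (Suc n) ` carrier (?C\<lparr>carrier := ?K\<rparr>) = Z (Suc 0) (Suc n)"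
    proof
      show "d 0 (Suc n) ` carrier (?C\<lparr>carrier := ?K\<rparr>) \<subseteq> Z (Suc 0) (Suc n)"
        by (auto simp: kernel_def Z_def dd de[symmetric])
      show "Z (Suc 0) (Suc n) \<subseteq> d 0 (Suc n) ` carrier (?C\<lparr>carrier := ?K\<rparr>)"
      proof
        fix x assume x: "x \<in> Z (Suc 0) (Suc n)"
        then obtain y where y: "y \<in> carrier ?C" "x = d 0 (Suc n) y"
          using d_exact[of x 0 n] by (auto simp: Z_def)
        then have "e 0 (Suc n) y = \<one>\<^bsub>E 0 (Suc (Suc n))\<^esub>"
          using x d_inj[of "e 0 (Suc n) y" "Suc n"] by (auto simp: Z_def de)
        then show "x \<in> d 0 (Suc n) ` carrier (?C\<lparr>carrier := ?K\<rparr>)"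
          using y by (auto simp: kernel_def)
      qed
    qed
    show "?B \<subseteq> ?K"
      using ones by (auto simp: kernel_def ee)
    show "id y \<in> ?B \<longleftrightarrow> d 0 (Suc n) y \<in> B 0 n" if "y \<in> carrier (?C\<lparr>carrier := ?K\<rparr>)" for y
      using inj_on_image_mem_iff[OF inj _ Bc, of y] that unfolding B by (auto simp: kernel_def)
  qed (use subgroup_B B_subset_Z Bs in auto)
qed

end

text \<open>\<open>Z\<close>, \<open>B\<close> and \<open>H\<close> are symmetric under exchange of
  the two directions, so the group at \<open>(n, 0)\<close> is the one at \<open>(0, n)\<close> of
  the transposed complex and is isomorphic to the cohomology of the other edge.\<close>

theorem (in double_complex) edge_cohomology_transpose:
  "edge_cohomology n \<cong> double_complex.edge_cohomology (\<lambda>p q. E q p) (\<lambda>p q. d q p) n"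
proof -
  interpret t: double_complex "\<lambda>p q. E q p" "\<lambda>p q. e q p" "\<lambda>p q. d q p" by (rule transpose)
  have Z: "t.Z p q = Z q p" for p q by (auto simp: t.Z_def Z_def)
  have B: "t.B p q = B q p" for p q
    using de_image by (auto simp: t.B_def B_def)
  have H: "t.H p q = H q p" for p q by (simp add: t.H_def H_def Z B)
  interpret C: comm_group "E (Suc n) (Suc 0)" by (rule grp)
  have "edge_cohomology n \<cong> H n 0"
    using edge_cohomology_iso H_iso by (rule iso_trans)
  moreover have "H n 0 \<cong> t.edge_cohomology n"
  proof (rule group.iso_sym)
    show "group (t.edge_cohomology n)" by (rule t.group_edge_cohomology)
    show "t.edge_cohomology n \<cong> H n 0" using t.edge_cohomology_iso[of n] by (simp add: H)
  qed
  ultimately show ?thesis by (rule iso_trans)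
qed

section \<open>Germs and the Godement sheaf\<close>

lemma group_homI_comm:
  assumes "comm_group G" "comm_group H" "h \<in> hom G H"
  shows "group_hom G H h"
  using assms by (simp add: group_hom_def group_hom_axioms_def comm_group.axioms)

section \<open>Germs and stalks of a presheaf of abelian groups\<close>

locale presheaf_on =
  fixes X :: "'p topology" and P :: "('p, 'b) ab_presheaf"
  assumes presheaf: "presheaf X P"
begin

lemma comm_group_sections: "openin X U \<Longrightarrow> comm_group (sections P U)"
  using presheaf by (auto simp: presheaf_def)

lemma restriction_hom:
  "openin X U \<Longrightarrow> openin X V \<Longrightarrow> V \<subseteq> U \<Longrightarrow> restriction P U V \<in> hom (sections P U) (sections P V)"
  using presheaf by (auto simp: presheaf_def)

lemma restriction_group_hom:
  "openin X U \<Longrightarrow> openin X V \<Longrightarrow> V \<subseteq> U \<Longrightarrow>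
    group_hom (sections P U) (sections P V) (restriction P U V)"
  by (intro group_homI_comm comm_group_sections restriction_hom)

lemma restriction_closed [simp]:
  "openin X U \<Longrightarrow> openin X V \<Longrightarrow> V \<subseteq> U \<Longrightarrow> s \<in> carrier (sections P U) \<Longrightarrow>
    restriction P U V s \<in> carrier (sections P V)"
  using restriction_hom by (rule hom_in_carrier)

lemma restriction_id [simp]:
  "openin X U \<Longrightarrow> s \<in> carrier (sections P U) \<Longrightarrow> restriction P U U s = s"
  using presheaf by (auto simp: presheaf_def)

lemma restriction_restriction [simp]:
  "openin X U \<Longrightarrow> openin X V \<Longrightarrow> openin X W \<Longrightarrow> W \<subseteq> V \<Longrightarrow> V \<subseteq> U \<Longrightarrow> s \<in> carrier (sections P U) \<Longrightarrow>
    restriction P V W (restriction P U V s) = restriction P U W s"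
  using presheaf unfolding presheaf_def by blast

lemma restriction_mult:
  "openin X U \<Longrightarrow> openin X V \<Longrightarrow> V \<subseteq> U \<Longrightarrow> s \<in> carrier (sections P U) \<Longrightarrow> t \<in> carrier (sections P U) \<Longrightarrow>
    restriction P U V (s \<otimes>\<^bsub>sections P U\<^esub> t) =
    restriction P U V s \<otimes>\<^bsub>sections P V\<^esub> restriction P U V t"
  using restriction_hom by (auto simp: hom_def)

definition valid :: "'p \<Rightarrow> 'p set \<Rightarrow> 'b \<Rightarrow> bool" where
  "valid x V s \<longleftrightarrow> openin X V \<and> x \<in> V \<and> s \<in> carrier (sections P V)"

lemma germ_equiv_iff:
  "germ_equiv X P x (V, s) (W, t) \<longleftrightarrow> valid x V s \<and> valid x W t \<and>
     (\<exists>N. openin X N \<and> x \<in> N \<and> N \<subseteq> V \<inter> W \<and> restriction P V N s = restriction P W N t)"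
  by (auto simp: germ_equiv_def valid_def)

lemma germ_equiv_refl: "valid x V s \<Longrightarrow> germ_equiv X P x (V, s) (V, s)"
  by (auto simp: germ_equiv_iff valid_def)

lemma germ_equiv_sym: "germ_equiv X P x r q \<Longrightarrow> germ_equiv X P x q r"
  by (cases r; cases q) (auto simp: germ_equiv_iff eq_commute Int_commute)

lemma germ_equiv_trans:
  assumes "germ_equiv X P x r q" "germ_equiv X P x q p"
  shows "germ_equiv X P x r p"
proof -
  obtain V s W t Y u where eq: "r = (V, s)" "q = (W, t)" "p = (Y, u)"
    by (metis prod.exhaust)
  obtain N where N: "openin X N" "x \<in> N" "N \<subseteq> V \<inter> W" "restriction P V N s = restriction P W N t"
    using assms(1) by (auto simp: eq germ_equiv_iff)
  obtain N' where N': "openin X N'" "x \<in> N'" "N' \<subseteq> W \<inter> Y"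
      "restriction P W N' t = restriction P Y N' u"
    using assms(2) by (auto simp: eq germ_equiv_iff)
  have v: "valid x V s" "valid x W t" "valid x Y u"
    using assms by (auto simp: eq germ_equiv_iff)
  have o: "openin X (N \<inter> N')" using N N' by auto
  have "restriction P V (N \<inter> N') s = restriction P N (N \<inter> N') (restriction P V N s)"
    using v N(1-3) o by (simp add: valid_def)
  also have "\<dots> = restriction P N (N \<inter> N') (restriction P W N t)"
    by (simp only: N(4))
  also have "\<dots> = restriction P W (N \<inter> N') t"
    using v N(1-3) o by (simp add: valid_def)
  also have "\<dots> = restriction P N' (N \<inter> N') (restriction P W N' t)"
    using v N'(1-3) o by (simp add: valid_def)
  also have "\<dots> = restriction P N' (N \<inter> N') (restriction P Y N' u)"
    by (simp only: N'(4))
  also have "\<dots> = restriction P Y (N \<inter> N') u"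
    using v N'(1-3) o by (simp add: valid_def)
  finally show ?thesis
    using v N N' o by (auto simp: eq germ_equiv_iff intro!: exI[of _ "N \<inter> N'"])
qed

lemma germ_equiv_germ:
  assumes "valid x V s"
  shows "germ_equiv X P x (germ X P x V s) (V, s)"
  unfolding germ_def using germ_equiv_refl[OF assms] by (rule someI)

text \<open>Equivalent pairs satisfy the same predicate under \<open>SOME\<close>, so the choice
  returns one representative for the whole class, and equality of germs becomes an ordinary
  equation.\<close>

lemma germ_cong:
  assumes "germ_equiv X P x (V, s) (W, t)"
  shows "germ X P x V s = germ X P x W t"
proof -
  have "germ_equiv X P x r (V, s) \<longleftrightarrow> germ_equiv X P x r (W, t)" for r
    using assms germ_equiv_trans germ_equiv_sym by blast
  then show ?thesis by (simp add: germ_def)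
qed

lemma germ_eq_iff:
  assumes "valid x V s" "valid x W t"
  shows "germ X P x V s = germ X P x W t \<longleftrightarrow>
    (\<exists>N. openin X N \<and> x \<in> N \<and> N \<subseteq> V \<inter> W \<and> restriction P V N s = restriction P W N t)"
proof -
  have "germ X P x V s = germ X P x W t \<longleftrightarrow> germ_equiv X P x (V, s) (W, t)"
    using germ_equiv_germ[OF assms(1)] germ_equiv_germ[OF assms(2)] germ_cong
      germ_equiv_trans germ_equiv_sym by metis
  then show ?thesis using assms by (simp add: germ_equiv_iff)
qed

lemma germ_restriction:
  assumes "openin X V" "openin X N" "x \<in> N" "N \<subseteq> V" "s \<in> carrier (sections P V)"
  shows "germ X P x N (restriction P V N s) = germ X P x V s"
  using assms by (subst germ_eq_iff) (auto simp: valid_def intro!: exI[of _ N])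

lemma carrier_stalk:
  "carrier (stalk X P x) = {germ X P x V s |V s. valid x V s}"
  by (auto simp: stalk_def valid_def)

lemma germ_in_stalk [intro]:
  "openin X V \<Longrightarrow> x \<in> V \<Longrightarrow> s \<in> carrier (sections P V) \<Longrightarrow> germ X P x V s \<in> carrier (stalk X P x)"
  by (auto simp: carrier_stalk valid_def)

text \<open>The chosen representative belongs to its own class. This is what lets
  \<open>godement_map\<close> and the product of the stalk open a germ by pattern matching.\<close>

lemma stalk_elem:
  assumes "g \<in> carrier (stalk X P x)" "g = (V, s)"
  shows "valid x V s" "germ X P x V s = g"
proof -
  obtain W t where *: "valid x W t" "g = germ X P x W t"
    using assms by (auto simp: carrier_stalk)
  then have "germ_equiv X P x (V, s) (W, t)"
    using germ_equiv_germ[of x W t] assms by simp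
  then show "valid x V s" "germ X P x V s = g"
    using * germ_cong by (auto simp: germ_equiv_iff)
qed

lemma stalk_cases:
  assumes "g \<in> carrier (stalk X P x)"
  obtains V s where "openin X V" "x \<in> V" "s \<in> carrier (sections P V)" "g = germ X P x V s"
  using assms by (auto simp: carrier_stalk valid_def)

text \<open>The product is defined on the chosen representatives. They agree with \<open>s\<close>
  and \<open>t\<close> on a small neighbourhood \<open>O'\<close>, and equality of the two products
  there is all that a germ sees.\<close>

lemma germ_mult:
  assumes V: "openin X V" "x \<in> V" and s: "s \<in> carrier (sections P V)" and t: "t \<in> carrier (sections P V)"
  shows "germ X P x V s \<otimes>\<^bsub>stalk X P x\<^esub> germ X P x V t = germ X P x V (s \<otimes>\<^bsub>sections P V\<^esub> t)"
proof -
  interpret V: comm_group "sections P V" by (rule comm_group_sections[OF V(1)])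
  obtain W s' where W: "germ X P x V s = (W, s')" by fastforce
  obtain Y t' where Y: "germ X P x V t = (Y, t')" by fastforce
  have "germ_equiv X P x (W, s') (V, s)" "germ_equiv X P x (Y, t') (V, t)"
    using germ_equiv_germ[of x V s] germ_equiv_germ[of x V t] assms W Y by (auto simp: valid_def)
  then obtain M N where M: "openin X M" "x \<in> M" "M \<subseteq> W \<inter> V" "restriction P W M s' = restriction P V M s"
    and N: "openin X N" "x \<in> N" "N \<subseteq> Y \<inter> V" "restriction P Y N t' = restriction P V N t"
    and W': "valid x W s'" and Y': "valid x Y t'"
    by (auto simp: germ_equiv_iff)
  define O' where "O' = M \<inter> N"
  have O': "openin X O'" "x \<in> O'" "O' \<subseteq> M" "O' \<subseteq> N" "O' \<subseteq> V" "O' \<subseteq> W \<inter> Y"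
    using M N by (auto simp: O'_def)
  have WY: "openin X (W \<inter> Y)" using W' Y' by (auto simp: valid_def)
  interpret WY: comm_group "sections P (W \<inter> Y)" by (rule comm_group_sections[OF WY])
  have s: "restriction P W O' s' = restriction P V O' s"
    using M O' W' assms restriction_restriction[of W M O' s'] restriction_restriction[of V M O' s]
    by (simp add: valid_def)
  have t: "restriction P Y O' t' = restriction P V O' t"
    using N O' Y' assms restriction_restriction[of Y N O' t'] restriction_restriction[of V N O' t]
    by (simp add: valid_def)
  have "germ X P x V s \<otimes>\<^bsub>stalk X P x\<^esub> germ X P x V t = germ X P x (W \<inter> Y)
        (restriction P W (W \<inter> Y) s' \<otimes>\<^bsub>sections P (W \<inter> Y)\<^esub> restriction P Y (W \<inter> Y) t')"
    by (simp add: W Y stalk_def)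
  also have "\<dots> = germ X P x V (s \<otimes>\<^bsub>sections P V\<^esub> t)"
  proof (subst germ_eq_iff)
    show "valid x (W \<inter> Y) (restriction P W (W \<inter> Y) s' \<otimes>\<^bsub>sections P (W \<inter> Y)\<^esub> restriction P Y (W \<inter> Y) t')"
      "valid x V (s \<otimes>\<^bsub>sections P V\<^esub> t)"
      using W' Y' WY assms by (auto simp: valid_def)
    have "restriction P (W \<inter> Y) O' (restriction P W (W \<inter> Y) s' \<otimes>\<^bsub>sections P (W \<inter> Y)\<^esub> restriction P Y (W \<inter> Y) t')
        = restriction P V O' (s \<otimes>\<^bsub>sections P V\<^esub> t)"
      using W' Y' WY O' assms s t by (simp add: restriction_mult valid_def)
    then show "\<exists>N. openin X N \<and> x \<in> N \<and> N \<subseteq> W \<inter> Y \<inter> V \<and>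
       restriction P (W \<inter> Y) N (restriction P W (W \<inter> Y) s' \<otimes>\<^bsub>sections P (W \<inter> Y)\<^esub> restriction P Y (W \<inter> Y) t')
        = restriction P V N (s \<otimes>\<^bsub>sections P V\<^esub> t)"
      using O' by blast
  qed
  finally show ?thesis .
qed

lemma stalk_cases2:
  assumes "g \<in> carrier (stalk X P x)" "h \<in> carrier (stalk X P x)"
  obtains V s t where "openin X V" "x \<in> V" "s \<in> carrier (sections P V)" "g = germ X P x V s"
    "t \<in> carrier (sections P V)" "h = germ X P x V t"
proof -
  obtain V s where V: "openin X V" "x \<in> V" "s \<in> carrier (sections P V)" "g = germ X P x V s"
    using assms(1) by (rule stalk_cases)
  obtain W t where W: "openin X W" "x \<in> W" "t \<in> carrier (sections P W)" "h = germ X P x W t"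
    using assms(2) by (rule stalk_cases)
  show thesis
  proof (rule that[of "V \<inter> W" "restriction P V (V \<inter> W) s" "restriction P W (V \<inter> W) t"])
    show "openin X (V \<inter> W)" using V W by auto
    then show "restriction P V (V \<inter> W) s \<in> carrier (sections P (V \<inter> W))"
      "restriction P W (V \<inter> W) t \<in> carrier (sections P (V \<inter> W))"
      "g = germ X P x (V \<inter> W) (restriction P V (V \<inter> W) s)"
      "h = germ X P x (V \<inter> W) (restriction P W (V \<inter> W) t)"
      using V W by (auto simp: germ_restriction)
  qed (use V W in auto)
qed

lemma one_stalk:
  assumes "openin X V" "x \<in> V"
  shows "\<one>\<^bsub>stalk X P x\<^esub> = germ X P x V \<one>\<^bsub>sections P V\<^esub>"
proof -
  have V: "V \<subseteq> topspace X" using assms openin_subset by auto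
  interpret h: group_hom "sections P (topspace X)" "sections P V" "restriction P (topspace X) V"
    using assms V by (intro restriction_group_hom) auto
  show ?thesis
    using germ_restriction[of "topspace X" V x "\<one>\<^bsub>sections P (topspace X)\<^esub>"] assms V
    by (simp add: stalk_def)
qed

lemma comm_group_stalk:
  assumes x: "x \<in> topspace X"
  shows "comm_group (stalk X P x)"
proof (rule comm_groupI)
  fix f g assume "f \<in> carrier (stalk X P x)" "g \<in> carrier (stalk X P x)"
  then obtain V s t where V: "openin X V" "x \<in> V" "s \<in> carrier (sections P V)" "f = germ X P x V s"
    "t \<in> carrier (sections P V)" "g = germ X P x V t"
    by (rule stalk_cases2)
  interpret V: comm_group "sections P V" by (rule comm_group_sections[OF V(1)])
  show "f \<otimes>\<^bsub>stalk X P x\<^esub> g \<in> carrier (stalk X P x)"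
    using V by (auto simp: germ_mult)
  show "f \<otimes>\<^bsub>stalk X P x\<^esub> g = g \<otimes>\<^bsub>stalk X P x\<^esub> f"
    using V by (auto simp: germ_mult V.m_comm)
next
  interpret T: comm_group "sections P (topspace X)" by (rule comm_group_sections) simp
  show "\<one>\<^bsub>stalk X P x\<^esub> \<in> carrier (stalk X P x)"
    using x by (auto simp: one_stalk[of "topspace X"])
next
  fix f assume f: "f \<in> carrier (stalk X P x)"
  then obtain V s where V: "openin X V" "x \<in> V" "s \<in> carrier (sections P V)" "f = germ X P x V s"
    by (rule stalk_cases)
  interpret V: comm_group "sections P V" by (rule comm_group_sections[OF V(1)])
  show "\<one>\<^bsub>stalk X P x\<^esub> \<otimes>\<^bsub>stalk X P x\<^esub> f = f"
    using V by (auto simp: germ_mult one_stalk[of V])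
  show "\<exists>y\<in>carrier (stalk X P x). y \<otimes>\<^bsub>stalk X P x\<^esub> f = \<one>\<^bsub>stalk X P x\<^esub>"
    using V by (intro bexI[of _ "germ X P x V (inv\<^bsub>sections P V\<^esub> s)"])
      (auto simp: germ_mult one_stalk[of V])
next
  fix f g h assume f: "f \<in> carrier (stalk X P x)" and g: "g \<in> carrier (stalk X P x)"
    and h: "h \<in> carrier (stalk X P x)"
  obtain V s t where V: "openin X V" "x \<in> V" "s \<in> carrier (sections P V)" "f = germ X P x V s"
    "t \<in> carrier (sections P V)" "g = germ X P x V t"
    using f g by (rule stalk_cases2)
  obtain W u where W: "openin X W" "x \<in> W" "u \<in> carrier (sections P W)" "h = germ X P x W u"
    using h by (rule stalk_cases)
  define N where "N = V \<inter> W"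
  have N: "openin X N" "x \<in> N" "N \<subseteq> V" "N \<subseteq> W" using V W by (auto simp: N_def)
  interpret N: comm_group "sections P N" by (rule comm_group_sections[OF N(1)])
  define s' where "s' = restriction P V N s"
  define t' where "t' = restriction P V N t"
  define u' where "u' = restriction P W N u"
  have "f = germ X P x N s'" "g = germ X P x N t'" "h = germ X P x N u'"
    "s' \<in> carrier (sections P N)" "t' \<in> carrier (sections P N)" "u' \<in> carrier (sections P N)"
    using V W N by (auto simp: germ_restriction s'_def t'_def u'_def)
  then show "f \<otimes>\<^bsub>stalk X P x\<^esub> g \<otimes>\<^bsub>stalk X P x\<^esub> h = f \<otimes>\<^bsub>stalk X P x\<^esub> (g \<otimes>\<^bsub>stalk X P x\<^esub> h)"
    using N by (simp add: germ_mult N.m_assoc)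
qed

end

section \<open>The Godement sheaf as a product of stalks\<close>

lemma sections_godement_sheaf:
  "carrier (sections (godement_sheaf X P) V) = Germs ` (\<Pi>\<^sub>E x\<in>V. carrier (stalk X P x))"
  "\<one>\<^bsub>sections (godement_sheaf X P) V\<^esub> = Germs (\<lambda>x\<in>V. \<one>\<^bsub>stalk X P x\<^esub>)"
  "s \<otimes>\<^bsub>sections (godement_sheaf X P) V\<^esub> t =
    Germs (\<lambda>x\<in>V. germ_at s x \<otimes>\<^bsub>stalk X P x\<^esub> germ_at t x)"
  by (auto simp: godement_sheaf_def transport_group_def)

lemma restriction_godement_sheaf:
  "restriction (godement_sheaf X P) U V s = Germs (restrict (germ_at s) V)"
  by (simp add: godement_sheaf_def)

lemma godement_eqI:
  assumes "s \<in> carrier (sections (godement_sheaf X P) V)" "t \<in> carrier (sections (godement_sheaf X P) V)"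
    and "\<And>x. x \<in> V \<Longrightarrow> germ_at s x = germ_at t x"
  shows "s = t"
proof -
  obtain f g where "s = Germs f" "t = Germs g" "f \<in> (\<Pi>\<^sub>E x\<in>V. carrier (stalk X P x))"
    "g \<in> (\<Pi>\<^sub>E x\<in>V. carrier (stalk X P x))"
    using assms by (auto simp: sections_godement_sheaf)
  then show ?thesis using assms(3) by (auto intro!: PiE_ext[of f V _ g])
qed

lemma germ_at_closed:
  "s \<in> carrier (sections (godement_sheaf X P) V) \<Longrightarrow> x \<in> V \<Longrightarrow> germ_at s x \<in> carrier (stalk X P x)"
  by (auto simp: sections_godement_sheaf)

lemma Germs_closed:
  "(\<And>x. x \<in> V \<Longrightarrow> f x \<in> carrier (stalk X P x)) \<Longrightarrow>
    Germs (restrict f V) \<in> carrier (sections (godement_sheaf X P) V)"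
  by (auto simp: sections_godement_sheaf)

lemma transport_comm_group:
  assumes "\<And>a. dd (c a) = a" "comm_group A"
  shows "comm_group (transport_group c dd A)"
proof -
  interpret A: comm_group A by fact
  show ?thesis
    by (rule comm_groupI) (auto simp: transport_group_def assms(1) A.m_ac intro!: bexI[of _ "inv\<^bsub>A\<^esub> _"])
qed

lemma comm_group_product_group:
  assumes "\<And>i. i \<in> I \<Longrightarrow> comm_group (G i)"
  shows "comm_group (product_group I G)"
proof -
  interpret group "product_group I G"
    using assms by (intro product_group) (simp add: comm_group.axioms)
  show ?thesis
    using assms by (intro group_comm_groupI) (auto simp: PiE_iff comm_groupE(4) intro!: restrict_ext)
qed

lemma presheaf_base_presheaf:
  assumes "presheaf X F"
  shows "presheaf X (base_presheaf F)"
proof -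
  interpret presheaf_on X F by unfold_locales fact
  show ?thesis
    unfolding presheaf_def
    by (auto simp: base_presheaf_def transport_comm_group comm_group_sections restriction_mult)
      (auto simp: transport_group_def hom_def restriction_mult)
qed

locale godement_presheaf = presheaf_on X P
  for X :: "'p topology" and P :: "('p, ('p, 'a) godement) ab_presheaf"
begin

lemma comm_group_godement:
  assumes "openin X V"
  shows "comm_group (sections (godement_sheaf X P) V)"
proof -
  have "V \<subseteq> topspace X" using assms by (rule openin_subset)
  then have "comm_group (product_group V (stalk X P))"
    by (intro comm_group_product_group comm_group_stalk) auto
  then show ?thesis
    by (simp add: godement_sheaf_def transport_comm_group)
qed

lemma presheaf_godement_sheaf: "presheaf X (godement_sheaf X P)"
  unfolding presheaf_def
proof (intro conjI allI impI ballI)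
  show "restriction (godement_sheaf X P) U V \<in> hom (sections (godement_sheaf X P) U) (sections (godement_sheaf X P) V)"
    if "openin X U \<and> openin X V \<and> V \<subseteq> U" for U V
    using that by (auto simp: hom_def restriction_godement_sheaf sections_godement_sheaf
        Int_absorb1 PiE_iff intro!: imageI restrict_ext) blast
  show "restriction (godement_sheaf X P) U U s = s"
    if "openin X U" "s \<in> carrier (sections (godement_sheaf X P) U)" for U s
    using that by (auto simp: restriction_godement_sheaf sections_godement_sheaf)
  show "restriction (godement_sheaf X P) V W (restriction (godement_sheaf X P) U V s)
      = restriction (godement_sheaf X P) U W s"
    if "openin X U \<and> openin X V \<and> openin X W \<and> W \<subseteq> V \<and> V \<subseteq> U" for U V W s
    using that by (auto simp: restriction_godement_sheaf Int_absorb1)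
qed (rule comm_group_godement)

lemma inv_godement:
  assumes V: "openin X V" and s: "s \<in> carrier (sections (godement_sheaf X P) V)" and x: "x \<in> V"
  shows "germ_at (inv\<^bsub>sections (godement_sheaf X P) V\<^esub> s) x = inv\<^bsub>stalk X P x\<^esub> germ_at s x"
proof -
  have "x \<in> topspace X" using V x openin_subset by auto
  then have "group_hom (sections (godement_sheaf X P) V) (stalk X P x) (\<lambda>s. germ_at s x)"
    using x by (intro group_homI_comm comm_group_godement V comm_group_stalk)
      (auto simp: hom_def sections_godement_sheaf)
  from group_hom.hom_inv[OF this s] show ?thesis by simp
qed

end

lemma presheaf_godement_power:
  assumes "presheaf X F"
  shows "presheaf X (godement_power X F n)"
proof (induction n)
  case (Suc n)
  then interpret godement_presheaf X "godement_power X F n" by unfold_locales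
  show ?case by (simp add: presheaf_godement_sheaf)
qed (simp add: presheaf_base_presheaf assms)

section \<open>Functoriality of the Godement sheaf\<close>

definition presheaf_hom ::
    "'p topology \<Rightarrow> ('p, 'a) ab_presheaf \<Rightarrow> ('p, 'b) ab_presheaf \<Rightarrow> ('p set \<Rightarrow> 'a \<Rightarrow> 'b) \<Rightarrow> bool" where
  "presheaf_hom X P Q \<phi> \<longleftrightarrow>
     (\<forall>V. openin X V \<longrightarrow> \<phi> V \<in> hom (sections P V) (sections Q V)) \<and>
     (\<forall>V W. openin X V \<and> openin X W \<and> W \<subseteq> V \<longrightarrow>
        (\<forall>s\<in>carrier (sections P V). \<phi> W (restriction P V W s) = restriction Q V W (\<phi> V s)))"

lemma presheaf_homD:
  assumes "presheaf_hom X P Q \<phi>"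
  shows "openin X V \<Longrightarrow> \<phi> V \<in> hom (sections P V) (sections Q V)"
    and "openin X V \<Longrightarrow> s \<in> carrier (sections P V) \<Longrightarrow> \<phi> V s \<in> carrier (sections Q V)"
    and "openin X V \<Longrightarrow> s \<in> carrier (sections P V) \<Longrightarrow> t \<in> carrier (sections P V) \<Longrightarrow>
      \<phi> V (s \<otimes>\<^bsub>sections P V\<^esub> t) = \<phi> V s \<otimes>\<^bsub>sections Q V\<^esub> \<phi> V t"
    and "openin X V \<Longrightarrow> openin X W \<Longrightarrow> W \<subseteq> V \<Longrightarrow> s \<in> carrier (sections P V) \<Longrightarrow>
      \<phi> W (restriction P V W s) = restriction Q V W (\<phi> V s)"
  using assms by (auto simp: presheaf_hom_def hom_def)

lemma presheaf_hom_comp: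
  assumes "presheaf_hom X P Q \<phi>" "presheaf_hom X Q R \<psi>"
  shows "presheaf_hom X P R (\<lambda>V s. \<psi> V (\<phi> V s))"
  unfolding presheaf_hom_def hom_def
  using presheaf_homD(2-)[OF assms(1)] presheaf_homD(2-)[OF assms(2)] by auto

lemma presheaf_hom_coarser:
  assumes "presheaf_hom X P Q \<phi>" "\<And>V. openin Y V \<Longrightarrow> openin X V"
  shows "presheaf_hom Y P Q \<phi>"
  using assms by (auto simp: presheaf_hom_def)

lemma presheaf_hom_div:
  assumes Q: "presheaf X Q" and \<phi>: "presheaf_hom X P Q \<phi>" and \<psi>: "presheaf_hom X P Q \<psi>"
  shows "presheaf_hom X P Q (\<lambda>V s. \<phi> V s \<otimes>\<^bsub>sections Q V\<^esub> inv\<^bsub>sections Q V\<^esub> \<psi> V s)"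
proof -
  interpret Q: presheaf_on X Q by unfold_locales fact
  show ?thesis
    unfolding presheaf_hom_def
  proof (intro conjI allI impI ballI)
    fix V assume V: "openin X V"
    interpret V: comm_group "sections Q V" by (rule Q.comm_group_sections[OF V])
    show "(\<lambda>s. \<phi> V s \<otimes>\<^bsub>sections Q V\<^esub> inv\<^bsub>sections Q V\<^esub> \<psi> V s) \<in> hom (sections P V) (sections Q V)"
      using presheaf_homD(2,3)[OF \<phi> V] presheaf_homD(2,3)[OF \<psi> V]
      by (auto simp: hom_def V.inv_mult_group V.m_ac)
  next
    fix V W s assume "openin X V \<and> openin X W \<and> W \<subseteq> V" and s: "s \<in> carrier (sections P V)"
    then have V: "openin X V" and W: "openin X W" and WV: "W \<subseteq> V" by auto
    interpret h: group_hom "sections Q V" "sections Q W" "restriction Q V W"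
      by (rule Q.restriction_group_hom[OF V W WV])
    show "\<phi> W (restriction P V W s) \<otimes>\<^bsub>sections Q W\<^esub> inv\<^bsub>sections Q W\<^esub> \<psi> W (restriction P V W s) =
       restriction Q V W (\<phi> V s \<otimes>\<^bsub>sections Q V\<^esub> inv\<^bsub>sections Q V\<^esub> \<psi> V s)"
      using presheaf_homD(2,4)[OF \<phi> V] presheaf_homD(2,4)[OF \<psi> V] V W WV s by simp
  qed
qed

lemma (in godement_presheaf) godement_unit_hom:
  "presheaf_hom X P (godement_sheaf X P) (godement_unit X P)"
  unfolding presheaf_hom_def
proof (intro conjI allI impI ballI)
  fix V assume V: "openin X V"
  show "godement_unit X P V \<in> hom (sections P V) (sections (godement_sheaf X P) V)"
    using V by (auto simp: hom_def godement_unit_def Germs_closed germ_in_stalk)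
      (auto simp: sections_godement_sheaf germ_mult intro!: restrict_ext)
next
  fix V W s assume "openin X V \<and> openin X W \<and> W \<subseteq> V" and s: "s \<in> carrier (sections P V)"
  then show "godement_unit X P W (restriction P V W s) =
      restriction (godement_sheaf X P) V W (godement_unit X P V s)"
    by (auto simp: godement_unit_def restriction_godement_sheaf germ_restriction Int_absorb1
        intro!: restrict_ext)
qed

lemma germ_at_godement_unit: "x \<in> V \<Longrightarrow> germ_at (godement_unit X P V s) x = germ X P x V s"
  by (simp add: godement_unit_def)

text \<open>A morphism between presheaves on the same points, where the source lives on a topology whose
  open sets are open for the topology of the target.  This covers both a morphism on one space and
  the comparison of an open subspace with the whole space.\<close>

locale presheaf_morphism =
  Y: godement_presheaf Y P + X: godement_presheaf X Q
  for Y X :: "'p topology" and P Q :: "('p, ('p, 'a) godement) ab_presheaf" +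
  fixes \<phi> :: "'p set \<Rightarrow> ('p, 'a) godement \<Rightarrow> ('p, 'a) godement"
  assumes coarser: "openin Y V \<Longrightarrow> openin X V"
    and morphism: "presheaf_hom Y P Q \<phi>"
begin

lemmas mor = presheaf_homD[OF morphism]

lemma germ_morphism_cong:
  assumes "Y.valid x V s" "Y.valid x W t" "germ Y P x V s = germ Y P x W t"
  shows "germ X Q x V (\<phi> V s) = germ X Q x W (\<phi> W t)"
proof -
  obtain N where N: "openin Y N" "x \<in> N" "N \<subseteq> V \<inter> W" "restriction P V N s = restriction P W N t"
    using assms by (subst (asm) Y.germ_eq_iff) auto
  have "restriction Q V N (\<phi> V s) = restriction Q W N (\<phi> W t)"
    using N assms mor(4)[of V N s] mor(4)[of W N t] by (auto simp: Y.valid_def)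
  then show ?thesis
    using assms N coarser mor(2) by (subst X.germ_eq_iff) (auto simp: X.valid_def Y.valid_def)
qed

text \<open>\<open>godement_map\<close> applies \<open>\<phi>\<close> to the chosen representative
  of each germ; here any other representative is shown to give the same value, so that the choice
  can be forgotten afterwards.\<close>

lemma godement_map_germ:
  assumes "x \<in> V" "germ_at s x = germ Y P x W t"
    "openin Y W" "x \<in> W" "t \<in> carrier (sections P W)"
  shows "germ_at (godement_map X Q \<phi> V s) x = germ X Q x W (\<phi> W t)"
proof -
  obtain W' t' where eq: "germ_at s x = (W', t')" by fastforce
  then have "(W', t') \<in> carrier (stalk Y P x)"
    using Y.germ_in_stalk[of W x t] assms by simp
  then have "Y.valid x W' t'" "germ Y P x W' t' = germ Y P x W t"
    using Y.stalk_elem[of "(W', t')"] eq assms by auto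
  then have "germ X Q x W' (\<phi> W' t') = germ X Q x W (\<phi> W t)"
    using assms by (intro germ_morphism_cong) (auto simp: Y.valid_def)
  then show ?thesis using assms(1) eq by (simp add: godement_map_def)
qed

lemma godement_map_closed:
  assumes V: "openin Y V" and s: "s \<in> carrier (sections (godement_sheaf Y P) V)"
  shows "godement_map X Q \<phi> V s \<in> carrier (sections (godement_sheaf X Q) V)"
proof -
  have "germ_at (godement_map X Q \<phi> V s) x \<in> carrier (stalk X Q x)" if x: "x \<in> V" for x
  proof -
    obtain W t where W: "openin Y W" "x \<in> W" "t \<in> carrier (sections P W)" "germ_at s x = germ Y P x W t"
      using germ_at_closed[OF s x] by (rule Y.stalk_cases)
    then show ?thesis
      using x mor(2) coarser by (auto simp: godement_map_germ)
  qed
  then show ?thesis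
    by (auto simp: godement_map_def intro!: Germs_closed)
qed

lemma godement_map_hom:
  "presheaf_hom Y (godement_sheaf Y P) (godement_sheaf X Q) (godement_map X Q \<phi>)"
  unfolding presheaf_hom_def
proof (intro conjI allI impI ballI)
  fix V assume V: "openin Y V"
  let ?GP = "godement_sheaf Y P" and ?GQ = "godement_sheaf X Q"
  show "godement_map X Q \<phi> V \<in> hom (sections ?GP V) (sections ?GQ V)"
  proof (rule homI)
    fix s t assume s: "s \<in> carrier (sections ?GP V)" and t: "t \<in> carrier (sections ?GP V)"
    interpret GP: comm_group "sections ?GP V" by (rule Y.comm_group_godement[OF V])
    interpret GQ: comm_group "sections ?GQ V" by (rule X.comm_group_godement[OF coarser[OF V]])
    show "godement_map X Q \<phi> V (s \<otimes>\<^bsub>sections ?GP V\<^esub> t)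
        = godement_map X Q \<phi> V s \<otimes>\<^bsub>sections ?GQ V\<^esub> godement_map X Q \<phi> V t"
    proof (rule godement_eqI)
      fix x assume x: "x \<in> V"
      obtain W a b where W: "openin Y W" "x \<in> W" "a \<in> carrier (sections P W)"
        "germ_at s x = germ Y P x W a" "b \<in> carrier (sections P W)" "germ_at t x = germ Y P x W b"
        using germ_at_closed[OF s x] germ_at_closed[OF t x] by (rule Y.stalk_cases2)
      interpret W: comm_group "sections P W" by (rule Y.comm_group_sections[OF W(1)])
      have "germ_at (s \<otimes>\<^bsub>sections ?GP V\<^esub> t) x = germ Y P x W (a \<otimes>\<^bsub>sections P W\<^esub> b)"
        using W x by (simp add: sections_godement_sheaf Y.germ_mult)
      then have "germ_at (godement_map X Q \<phi> V (s \<otimes>\<^bsub>sections ?GP V\<^esub> t)) x =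
          germ X Q x W (\<phi> W (a \<otimes>\<^bsub>sections P W\<^esub> b))"
        using W x by (intro godement_map_germ) auto
      also have "\<dots> = germ X Q x W (\<phi> W a) \<otimes>\<^bsub>stalk X Q x\<^esub> germ X Q x W (\<phi> W b)"
        using W coarser mor(2,3) by (simp add: X.germ_mult)
      finally show "germ_at (godement_map X Q \<phi> V (s \<otimes>\<^bsub>sections ?GP V\<^esub> t)) x =
          germ_at (godement_map X Q \<phi> V s \<otimes>\<^bsub>sections ?GQ V\<^esub> godement_map X Q \<phi> V t) x"
        using W x by (simp add: sections_godement_sheaf godement_map_germ)
    qed (use s t V in \<open>auto intro!: godement_map_closed GQ.m_closed\<close>)
  qed (rule godement_map_closed[OF V])
next
  fix V W s assume "openin Y V \<and> openin Y W \<and> W \<subseteq> V"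
  then show "godement_map X Q \<phi> W (restriction (godement_sheaf Y P) V W s) =
      restriction (godement_sheaf X Q) V W (godement_map X Q \<phi> V s)"
    by (auto simp: godement_map_def restriction_godement_sheaf Int_absorb1 intro!: restrict_ext)
qed

text \<open>Naturality of the unit, used both to show that consecutive differentials compose to the
  trivial map and to compare a subspace with the whole space.\<close>

lemma godement_map_unit:
  assumes V: "openin Y V" and s: "s \<in> carrier (sections P V)"
  shows "godement_map X Q \<phi> V (godement_unit Y P V s) = godement_unit X Q V (\<phi> V s)"
proof (rule godement_eqI)
  show "godement_map X Q \<phi> V (godement_unit Y P V s) \<in> carrier (sections (godement_sheaf X Q) V)"
    using presheaf_homD(2)[OF Y.godement_unit_hom V s] by (rule godement_map_closed[OF V])
  show "godement_unit X Q V (\<phi> V s) \<in> carrier (sections (godement_sheaf X Q) V)"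
    using presheaf_homD(2)[OF X.godement_unit_hom coarser[OF V] mor(2)[OF V s]] .
  show "germ_at (godement_map X Q \<phi> V (godement_unit Y P V s)) x = germ_at (godement_unit X Q V (\<phi> V s)) x"
    if x: "x \<in> V" for x
    using V s x by (subst godement_map_germ[OF x]) (auto simp: germ_at_godement_unit)
qed

text \<open>The hypothesis \<open>sub\<close> says that \<open>Y\<close> is an open subspace of \<open>X\<close>.\<close>

lemma godement_map_bij:
  assumes sub: "\<And>N V. openin X N \<Longrightarrow> openin Y V \<Longrightarrow> openin Y (N \<inter> V)"
    and bij: "\<And>V. openin Y V \<Longrightarrow> bij_betw (\<phi> V) (carrier (sections P V)) (carrier (sections Q V))"
    and V: "openin Y V"
  shows "bij_betw (godement_map X Q \<phi> V) (carrier (sections (godement_sheaf Y P) V))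
    (carrier (sections (godement_sheaf X Q) V))"
  unfolding bij_betw_def
proof
  show "inj_on (godement_map X Q \<phi> V) (carrier (sections (godement_sheaf Y P) V))"
  proof (rule inj_onI)
    fix s t assume s: "s \<in> carrier (sections (godement_sheaf Y P) V)"
      and t: "t \<in> carrier (sections (godement_sheaf Y P) V)"
      and eq: "godement_map X Q \<phi> V s = godement_map X Q \<phi> V t"
    show "s = t"
    proof (rule godement_eqI[OF s t])
      fix x assume x: "x \<in> V"
      obtain W a b where W: "openin Y W" "x \<in> W" "a \<in> carrier (sections P W)"
        "germ_at s x = germ Y P x W a" "b \<in> carrier (sections P W)" "germ_at t x = germ Y P x W b"
        using germ_at_closed[OF s x] germ_at_closed[OF t x] by (rule Y.stalk_cases2)
      have "germ X Q x W (\<phi> W a) = germ X Q x W (\<phi> W b)"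
        using eq x W godement_map_germ[of x V s W a] godement_map_germ[of x V t W b] by simp
      then obtain N where N: "openin X N" "x \<in> N" "N \<subseteq> W"
        "restriction Q W N (\<phi> W a) = restriction Q W N (\<phi> W b)"
        using W coarser mor(2) by (subst (asm) X.germ_eq_iff) (auto simp: X.valid_def)
      \<comment> \<open>\<open>N\<close> is only known to be open in \<open>X\<close>; being
        contained in \<open>W\<close> it is open in \<open>Y\<close>, where \<open>\<phi> N\<close>
        is injective.\<close>
      have NY: "openin Y N" using sub[OF N(1) W(1)] N(3) by (simp add: Int_absorb2)
      have "\<phi> N (restriction P W N a) = \<phi> N (restriction P W N b)"
        using N W NY by (simp add: mor(4))
      then have "restriction P W N a = restriction P W N b"
        using bij[OF NY] N W NY by (auto simp: bij_betw_def dest!: inj_onD)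
      then show "germ_at s x = germ_at t x"
        using W N NY by (auto simp: Y.germ_eq_iff Y.valid_def)
    qed
  qed
  show "godement_map X Q \<phi> V ` carrier (sections (godement_sheaf Y P) V) =
      carrier (sections (godement_sheaf X Q) V)"
  proof
    show "godement_map X Q \<phi> V ` carrier (sections (godement_sheaf Y P) V) \<subseteq>
        carrier (sections (godement_sheaf X Q) V)"
      using godement_map_closed[OF V] by blast
    show "carrier (sections (godement_sheaf X Q) V) \<subseteq>
        godement_map X Q \<phi> V ` carrier (sections (godement_sheaf Y P) V)"
    proof
      fix u assume u: "u \<in> carrier (sections (godement_sheaf X Q) V)"
      have "\<exists>W t. openin Y W \<and> x \<in> W \<and> t \<in> carrier (sections P W) \<and> germ_at u x = germ X Q x W (\<phi> W t)"
        if x: "x \<in> V" for x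
      proof -
        obtain N a where N: "openin X N" "x \<in> N" "a \<in> carrier (sections Q N)" "germ_at u x = germ X Q x N a"
          using germ_at_closed[OF u x] by (rule X.stalk_cases)
        \<comment> \<open>The representative is shrunk into \<open>V\<close> because surjectivity of
          \<open>\<phi>\<close> is available only over open sets of \<open>Y\<close>.\<close>
        let ?W = "N \<inter> V"
        have W: "openin Y ?W" "openin X ?W" using sub[OF N(1) V] coarser by auto
        have "restriction Q N ?W a \<in> carrier (sections Q ?W)"
          using N W by auto
        then obtain t where "t \<in> carrier (sections P ?W)" "\<phi> ?W t = restriction Q N ?W a"
          using bij[OF W(1)] by (metis bij_betw_imp_surj_on imageE)
        moreover have "germ X Q x ?W (restriction Q N ?W a) = germ_at u x"
          using N W x by (simp add: X.germ_restriction)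
        ultimately show ?thesis using W N x by (intro exI[of _ ?W] exI[of _ t]) auto
      qed
      then obtain W t where Wt: "\<And>x. x \<in> V \<Longrightarrow> openin Y (W x) \<and> x \<in> W x \<and>
          t x \<in> carrier (sections P (W x)) \<and> germ_at u x = germ X Q x (W x) (\<phi> (W x) (t x))"
        by metis
      define s where "s = Germs (\<lambda>x\<in>V. germ Y P x (W x) (t x))"
      have s: "s \<in> carrier (sections (godement_sheaf Y P) V)"
        unfolding s_def using Wt by (intro Germs_closed) auto
      have "germ_at (godement_map X Q \<phi> V s) x = germ_at u x" if x: "x \<in> V" for x
        using x Wt[OF x] by (subst godement_map_germ[OF x]) (auto simp: s_def)
      then have "godement_map X Q \<phi> V s = u"
        by (intro godement_eqI[OF godement_map_closed[OF V s] u])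
      then show "u \<in> godement_map X Q \<phi> V ` carrier (sections (godement_sheaf Y P) V)"
        using s by blast
    qed
  qed
qed

end

text \<open>Three topologies occur because the same functoriality serves composites of differentials
  on one space and composites of a differential with the map from an open subspace to the whole
  space.\<close>

lemma godement_map_comp:
  assumes "presheaf_morphism Y X P Q \<phi>" "presheaf_morphism X Z Q R \<psi>"
    and V: "openin Y V" and s: "s \<in> carrier (sections (godement_sheaf Y P) V)"
  shows "godement_map Z R \<psi> V (godement_map X Q \<phi> V s) = godement_map Z R (\<lambda>W t. \<psi> W (\<phi> W t)) V s"
proof -
  interpret f: presheaf_morphism Y X P Q \<phi> by fact
  interpret g: presheaf_morphism X Z Q R \<psi> by fact
  interpret c: presheaf_morphism Y Z P R "\<lambda>W t. \<psi> W (\<phi> W t)"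
    using f.Y.godement_presheaf_axioms g.X.godement_presheaf_axioms f.coarser g.coarser
      presheaf_hom_comp[OF f.morphism presheaf_hom_coarser[OF g.morphism f.coarser]]
    by (simp add: presheaf_morphism_def presheaf_morphism_axioms_def)
  show ?thesis
  proof (rule godement_eqI)
    show "godement_map Z R \<psi> V (godement_map X Q \<phi> V s) \<in> carrier (sections (godement_sheaf Z R) V)"
      by (intro g.godement_map_closed f.godement_map_closed f.coarser V s)
    show "godement_map Z R (\<lambda>W t. \<psi> W (\<phi> W t)) V s \<in> carrier (sections (godement_sheaf Z R) V)"
      by (intro c.godement_map_closed V s)
    fix x assume x: "x \<in> V"
    obtain W t where W: "openin Y W" "x \<in> W" "t \<in> carrier (sections P W)" "germ_at s x = germ Y P x W t"
      using germ_at_closed[OF s x] by (rule f.Y.stalk_cases)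
    show "germ_at (godement_map Z R \<psi> V (godement_map X Q \<phi> V s)) x =
        germ_at (godement_map Z R (\<lambda>W t. \<psi> W (\<phi> W t)) V s) x"
      using W x f.coarser f.mor(2)
      by (simp add: c.godement_map_germ[OF x W(4)] g.godement_map_germ[OF x f.godement_map_germ[OF x W(4)]])
  qed
qed

lemma godement_map_cong:
  assumes P: "presheaf Y P"
    and eq: "\<And>W t. openin Y W \<Longrightarrow> t \<in> carrier (sections P W) \<Longrightarrow> \<phi> W t = \<psi> W t"
    and V: "openin Y V" and s: "s \<in> carrier (sections (godement_sheaf Y P) V)"
  shows "godement_map X Q \<phi> V s = godement_map X Q \<psi> V s"
proof -
  interpret godement_presheaf Y P by unfold_locales fact
  have "(case germ_at s x of (W, t) \<Rightarrow> germ X Q x W (\<phi> W t)) =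
      (case germ_at s x of (W, t) \<Rightarrow> germ X Q x W (\<psi> W t))" if "x \<in> V" for x
    using stalk_elem(1)[OF germ_at_closed[OF s that]] eq by (auto simp: valid_def split: prod.split)
  then show ?thesis
    by (auto simp: godement_map_def intro!: restrict_ext)
qed

section \<open>The Godement complex\<close>

lemma presheaf_morphismI:
  assumes "presheaf Y P" "presheaf X Q" "\<And>V. openin Y V \<Longrightarrow> openin X V" "presheaf_hom Y P Q \<phi>"
  shows "presheaf_morphism Y X P Q \<phi>"
  using assms
  by (simp add: presheaf_morphism_def presheaf_morphism_axioms_def godement_presheaf_def presheaf_on_def)

lemma presheaf_coarser:
  assumes "presheaf X F" "\<And>V. openin Y V \<Longrightarrow> openin X V"
  shows "presheaf Y F"
proof -
  interpret presheaf_on X F by unfold_locales fact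
  show ?thesis
    unfolding presheaf_def
    by (intro conjI allI impI ballI) (auto simp: assms(2) comm_group_sections restriction_hom)
qed

lemma godement_map_one:
  assumes P: "presheaf X P" and V: "openin X V" and s: "s \<in> carrier (sections (godement_sheaf X P) V)"
    and Q: "presheaf X Q"
  shows "godement_map X Q (\<lambda>W t. \<one>\<^bsub>sections Q W\<^esub>) V s = \<one>\<^bsub>sections (godement_sheaf X Q) V\<^esub>"
proof -
  interpret P: godement_presheaf X P by unfold_locales fact
  interpret Q: godement_presheaf X Q by unfold_locales fact
  have "(case germ_at s x of (W, t) \<Rightarrow> germ X Q x W \<one>\<^bsub>sections Q W\<^esub>) = \<one>\<^bsub>stalk X Q x\<^esub>" if "x \<in> V" for x
    using P.stalk_elem(1)[OF germ_at_closed[OF s that]]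
    by (auto simp: P.valid_def Q.one_stalk split: prod.split)
  then show ?thesis
    by (auto simp: godement_map_def sections_godement_sheaf intro!: restrict_ext)
qed

declare godement_power.simps [simp del] godement_diff.simps [simp del]

text \<open>The simplifier folds instead of unfolding: facts about
  \<open>godement_sheaf X P\<close>, with \<open>P\<close> a Godement power, then read as facts
  about the next power.\<close>

lemma godement_power_Suc [simp]: "godement_sheaf X (godement_power X F n) = godement_power X F (Suc n)"
  by (simp add: godement_power.simps)

lemma godement_diff_0 [simp]: "godement_unit X (godement_power X F 0) = godement_diff X F 0"
  by (simp add: godement_diff.simps)

locale godement_resolution =
  fixes X :: "'p topology" and F :: "('p, 'a) ab_presheaf"
  assumes presheaf_F: "presheaf X F"
begin

abbreviation K :: "nat \<Rightarrow> ('p, ('p, 'a) godement) ab_presheaf" where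
  "K \<equiv> godement_power X F"

abbreviation \<delta> :: "nat \<Rightarrow> 'p set \<Rightarrow> ('p, 'a) godement \<Rightarrow> ('p, 'a) godement" where
  "\<delta> \<equiv> godement_diff X F"

lemma presheaf_K: "presheaf X (K n)"
  by (rule presheaf_godement_power[OF presheaf_F])

lemma godement_presheaf_K: "godement_presheaf X (K n)"
  by (simp add: godement_presheaf_def presheaf_on_def presheaf_K)

lemma comm_group_K: "openin X V \<Longrightarrow> comm_group (sections (K n) V)"
  by (rule presheaf_on.comm_group_sections[OF godement_presheaf.axioms[OF godement_presheaf_K]])

lemma diff_hom: "presheaf_hom X (K n) (K (Suc n)) (\<delta> n)"
proof (induction n)
  case 0
  interpret godement_presheaf X "K 0" by (rule godement_presheaf_K)
  show ?case using godement_unit_hom by simp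
next
  case (Suc n)
  interpret P: godement_presheaf X "K (Suc n)" by (rule godement_presheaf_K)
  interpret f: presheaf_morphism X X "K n" "K (Suc n)" "\<delta> n"
    by (rule presheaf_morphismI[OF presheaf_K presheaf_K _ Suc])
  have "presheaf_hom X (K (Suc n)) (K (Suc (Suc n))) (\<lambda>V s.
      godement_unit X (K (Suc n)) V s \<otimes>\<^bsub>sections (K (Suc (Suc n))) V\<^esub>
      inv\<^bsub>sections (K (Suc (Suc n))) V\<^esub> godement_map X (K (Suc n)) (\<delta> n) V s)"
    using P.godement_unit_hom f.godement_map_hom
    by (intro presheaf_hom_div presheaf_K) auto
  then show ?case by (simp add: Let_def godement_diff.simps)
qed

lemma diff_morphism: "presheaf_morphism X X (K n) (K (Suc n)) (\<delta> n)"
  by (rule presheaf_morphismI[OF presheaf_K presheaf_K _ diff_hom])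

lemma diff_group_hom: "openin X V \<Longrightarrow> group_hom (sections (K n) V) (sections (K (Suc n)) V) (\<delta> n V)"
  by (intro group_homI_comm comm_group_K presheaf_homD(1)[OF diff_hom])

lemma diff_Suc:
  "\<delta> (Suc n) V s = godement_unit X (K (Suc n)) V s \<otimes>\<^bsub>sections (K (Suc (Suc n))) V\<^esub>
      inv\<^bsub>sections (K (Suc (Suc n))) V\<^esub> godement_map X (K (Suc n)) (\<delta> n) V s"
  by (simp add: Let_def godement_diff.simps)

lemma germ_at_diff_0: "x \<in> V \<Longrightarrow> germ_at (\<delta> 0 V s) x = germ X (K 0) x V s"
  using germ_at_godement_unit[of x V X "K 0" s] by simp

text \<open>In additive notation a differential of positive level is
  \<open>\<eta> - G \<delta>\<close>, with \<open>\<delta>\<close> one level lower. The composite of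
  two of them expands to \<open>\<eta> \<delta> - G \<delta> \<eta> + G (\<delta> \<delta>)\<close>:
  the first two terms cancel by naturality of the unit, and the third is trivial by induction. At
  the bottom only the first cancellation is needed.\<close>

lemma diff_diff:
  assumes V: "openin X V" and s: "s \<in> carrier (sections (K n) V)"
  shows "\<delta> (Suc n) V (\<delta> n V s) = \<one>\<^bsub>sections (K (Suc (Suc n))) V\<^esub>"
  using V s
proof (induction n arbitrary: V s)
  case 0
  interpret f: presheaf_morphism X X "K 0" "K (Suc 0)" "\<delta> 0" by (rule diff_morphism)
  interpret G: comm_group "sections (K (Suc (Suc 0))) V" by (rule comm_group_K[OF 0(1)])
  have "godement_unit X (K (Suc 0)) V (\<delta> 0 V s) \<in> carrier (sections (K (Suc (Suc 0))) V)"
    using presheaf_homD(2)[OF f.X.godement_unit_hom 0(1) f.mor(2)[OF 0]] by simp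
  moreover have "godement_map X (K (Suc 0)) (\<delta> 0) V (\<delta> 0 V s) = godement_unit X (K (Suc 0)) V (\<delta> 0 V s)"
    using f.godement_map_unit[OF 0] by simp
  ultimately show ?case
    unfolding diff_Suc by simp
next
  case (Suc n)
  let ?G = "sections (K (Suc (Suc (Suc n)))) V"
  interpret f: presheaf_morphism X X "K n" "K (Suc n)" "\<delta> n" by (rule diff_morphism)
  interpret g: presheaf_morphism X X "K (Suc n)" "K (Suc (Suc n))" "\<delta> (Suc n)" by (rule diff_morphism)
  interpret G: comm_group ?G by (rule comm_group_K[OF Suc(2)])
  let ?g = "godement_map X (K (Suc (Suc n))) (\<delta> (Suc n)) V"
  interpret gg: group_hom "sections (K (Suc (Suc n))) V" ?G ?g
    using g.godement_map_hom by (intro group_homI_comm comm_group_K Suc(2)) (auto simp: presheaf_hom_def Suc(2))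
  let ?a = "godement_unit X (K (Suc n)) V s" and ?b = "godement_map X (K (Suc n)) (\<delta> n) V s"
  have s: "s \<in> carrier (sections (godement_sheaf X (K n)) V)" using Suc(3) by simp
  have a: "?a \<in> carrier (sections (K (Suc (Suc n))) V)"
    using presheaf_homD(2)[OF f.X.godement_unit_hom Suc(2,3)] by simp
  have b: "?b \<in> carrier (sections (K (Suc (Suc n))) V)"
    using f.godement_map_closed[OF Suc(2) s] by simp
  have "?g ?b = godement_map X (K (Suc (Suc n))) (\<lambda>W t. \<delta> (Suc n) W (\<delta> n W t)) V s"
    by (rule godement_map_comp[OF diff_morphism diff_morphism Suc(2) s])
  also have "\<dots> = godement_map X (K (Suc (Suc n))) (\<lambda>W t. \<one>\<^bsub>sections (K (Suc (Suc n))) W\<^esub>) V s"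
    by (rule godement_map_cong[OF presheaf_K Suc.IH Suc(2) s])
  also have "\<dots> = \<one>\<^bsub>?G\<^esub>"
    using godement_map_one[OF presheaf_K Suc(2) s presheaf_K] by simp
  finally have gb: "?g ?b = \<one>\<^bsub>?G\<^esub>" .
  have ga: "?g ?a = godement_unit X (K (Suc (Suc n))) V (\<delta> (Suc n) V s)"
    by (rule g.godement_map_unit[OF Suc(2,3)])
  have "?g (\<delta> (Suc n) V s) = ?g ?a"
    using a b gb unfolding diff_Suc[of n V s] by simp
  then show ?case
    using ga gg.hom_closed[OF a] unfolding diff_Suc[of "Suc n" V "\<delta> (Suc n) V s"] by simp
qed

end

text \<open>A point \<open>x\<close> all of whose neighbourhoods contain \<open>V\<close>: the stalk at \<open>x\<close> is the group of
  sections over \<open>V\<close>, so evaluation at \<open>x\<close> contracts the Godement complex over \<open>V\<close>.\<close>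

locale focal_point = godement_presheaf X P
  for X :: "'p topology" and P :: "('p, ('p, 'a) godement) ab_presheaf" +
  fixes V :: "'p set" and x :: 'p
  assumes V: "openin X V" "x \<in> V" and focal: "openin X N \<Longrightarrow> x \<in> N \<Longrightarrow> V \<subseteq> N"
begin

definition focal_value :: "('p, 'a) godement \<Rightarrow> ('p, 'a) godement" where
  "focal_value s = (case germ_at s x of (W, t) \<Rightarrow> restriction P W V t)"

lemma germ_focal_cases:
  assumes "s \<in> carrier (sections (godement_sheaf X P) V)"
  obtains t where "t \<in> carrier (sections P V)" "germ_at s x = germ X P x V t"
proof -
  obtain W t where W: "openin X W" "x \<in> W" "t \<in> carrier (sections P W)" "germ_at s x = germ X P x W t"
    using germ_at_closed[OF assms V(2)] by (rule stalk_cases)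
  show thesis
    by (rule that[of "restriction P W V t"]) (use W V focal[OF W(1,2)] in \<open>auto simp: germ_restriction\<close>)
qed

lemma focal_value_germ:
  assumes "t \<in> carrier (sections P V)" "germ_at s x = germ X P x V t"
  shows "focal_value s = t"
proof -
  obtain W u where eq: "germ_at s x = (W, u)" by fastforce
  then have W: "valid x W u" "germ X P x W u = germ X P x V t"
    using stalk_elem[of "(W, u)" x W u] germ_in_stalk[OF V assms(1)] assms(2) by auto
  then obtain N where N: "openin X N" "x \<in> N" "N \<subseteq> W \<inter> V" "restriction P W N u = restriction P V N t"
    using assms(1) V by (auto simp: germ_eq_iff valid_def)
  \<comment> \<open>\<open>N\<close> lies in \<open>V\<close> and, as a neighbourhood of
    \<open>x\<close>, also contains it.\<close>
  then have "N = V" using focal[of N] by auto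
  then show ?thesis
    using N(4) assms(1) V by (simp add: focal_value_def eq)
qed

lemma focal_value_unit:
  assumes "s \<in> carrier (sections P V)"
  shows "focal_value (godement_unit X P V s) = s"
  by (rule focal_value_germ[OF assms]) (simp add: germ_at_godement_unit V)

lemma focal_value_group_hom:
  "group_hom (sections (godement_sheaf X P) V) (sections P V) focal_value"
proof (rule group_homI_comm[OF comm_group_godement[OF V(1)] comm_group_sections[OF V(1)]], rule homI)
  fix s assume "s \<in> carrier (sections (godement_sheaf X P) V)"
  then show "focal_value s \<in> carrier (sections P V)"
    by (rule germ_focal_cases) (simp add: focal_value_germ)
next
  interpret G: comm_group "sections P V" by (rule comm_group_sections[OF V(1)])
  fix s s' assume s: "s \<in> carrier (sections (godement_sheaf X P) V)"
    and s': "s' \<in> carrier (sections (godement_sheaf X P) V)"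
  obtain t where t: "t \<in> carrier (sections P V)" "germ_at s x = germ X P x V t"
    using s by (rule germ_focal_cases)
  obtain t' where t': "t' \<in> carrier (sections P V)" "germ_at s' x = germ X P x V t'"
    using s' by (rule germ_focal_cases)
  have "germ_at (s \<otimes>\<^bsub>sections (godement_sheaf X P) V\<^esub> s') x = germ X P x V (t \<otimes>\<^bsub>sections P V\<^esub> t')"
    using t t' V by (simp add: sections_godement_sheaf germ_mult)
  then show "focal_value (s \<otimes>\<^bsub>sections (godement_sheaf X P) V\<^esub> s')
      = focal_value s \<otimes>\<^bsub>sections P V\<^esub> focal_value s'"
    using t t' by (simp add: focal_value_germ)
qed

end

lemma focal_value_godement_map:
  assumes "focal_point X P V x" "focal_point X Q V x" "presheaf_morphism X X P Q \<phi>"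
    and s: "s \<in> carrier (sections (godement_sheaf X P) V)"
  shows "focal_point.focal_value Q V x (godement_map X Q \<phi> V s) = \<phi> V (focal_point.focal_value P V x s)"
proof -
  interpret P: focal_point X P V x by fact
  interpret Q: focal_point X Q V x by fact
  interpret f: presheaf_morphism X X P Q \<phi> by fact
  obtain t where t: "t \<in> carrier (sections P V)" "germ_at s x = germ X P x V t"
    using s by (rule P.germ_focal_cases)
  then have "germ_at (godement_map X Q \<phi> V s) x = germ X Q x V (\<phi> V t)"
    by (intro f.godement_map_germ P.V)
  then show ?thesis
    using t f.mor(2)[OF P.V(1)] by (simp add: P.focal_value_germ Q.focal_value_germ)
qed

section \<open>Evaluation at a focal point as a contracting homotopy\<close>

context godement_resolution
begin

lemma focal_inj:
  assumes V: "openin X V" "x \<in> V" "\<And>N. openin X N \<Longrightarrow> x \<in> N \<Longrightarrow> V \<subseteq> N"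
    and s: "s \<in> carrier (sections (K 0) V)" "\<delta> 0 V s = \<one>\<^bsub>sections (K (Suc 0)) V\<^esub>"
  shows "s = \<one>\<^bsub>sections (K 0) V\<^esub>"
proof -
  interpret focal_point X "K 0" V x
    using godement_presheaf_K V by (simp add: focal_point_def focal_point_axioms_def)
  interpret h: group_hom "sections (godement_sheaf X (K 0)) V" "sections (K 0) V" focal_value
    by (rule focal_value_group_hom)
  have "s = focal_value (\<delta> 0 V s)" using focal_value_unit[OF s(1)] by simp
  also have "\<dots> = \<one>\<^bsub>sections (K 0) V\<^esub>" using s(2) h.hom_one by simp
  finally show ?thesis .
qed

text \<open>In additive notation, evaluation at \<open>x\<close> undoes \<open>\<eta>\<close> and
  turns \<open>G \<delta>\<close> into \<open>\<delta>\<close> of the evaluation. Applied to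
  \<open>\<delta> (Suc n) V s\<close> it gives \<open>s\<close> minus \<open>\<delta> n V\<close> of
  the value of \<open>s\<close> at \<open>x\<close>, so a cocycle is the coboundary of its value at
  \<open>x\<close>.\<close>

lemma focal_exact:
  assumes V: "openin X V" "x \<in> V" "\<And>N. openin X N \<Longrightarrow> x \<in> N \<Longrightarrow> V \<subseteq> N"
    and s: "s \<in> carrier (sections (K (Suc n)) V)" "\<delta> (Suc n) V s = \<one>\<^bsub>sections (K (Suc (Suc n))) V\<^esub>"
  shows "s \<in> \<delta> n V ` carrier (sections (K n) V)"
proof -
  have f: "focal_point X (K m) V x" for m
    using godement_presheaf_K V by (simp add: focal_point_def focal_point_axioms_def)
  interpret P: focal_point X "K n" V x by (rule f)
  interpret Q: focal_point X "K (Suc n)" V x by (rule f)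
  interpret f: presheaf_morphism X X "K n" "K (Suc n)" "\<delta> n" by (rule diff_morphism)
  interpret p: group_hom "sections (godement_sheaf X (K n)) V" "sections (K n) V" P.focal_value
    by (rule P.focal_value_group_hom)
  interpret q: group_hom "sections (K (Suc (Suc n))) V" "sections (K (Suc n)) V" Q.focal_value
    using Q.focal_value_group_hom by simp
  let ?a = "godement_unit X (K (Suc n)) V s" and ?b = "godement_map X (K (Suc n)) (\<delta> n) V s"
  let ?t = "P.focal_value s"
  have s': "s \<in> carrier (sections (godement_sheaf X (K n)) V)" using s by simp
  have t: "?t \<in> carrier (sections (K n) V)" using p.hom_closed[OF s'] .
  have a: "?a \<in> carrier (sections (K (Suc (Suc n))) V)"
    using presheaf_homD(2)[OF Q.godement_unit_hom V(1) s(1)] by simp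
  have b: "?b \<in> carrier (sections (K (Suc (Suc n))) V)"
    using f.godement_map_closed[OF V(1) s'] by simp
  have "\<one>\<^bsub>sections (K (Suc n)) V\<^esub> = Q.focal_value (\<delta> (Suc n) V s)"
    using s(2) q.hom_one by simp
  also have "\<dots> = Q.focal_value ?a \<otimes>\<^bsub>sections (K (Suc n)) V\<^esub> inv\<^bsub>sections (K (Suc n)) V\<^esub> Q.focal_value ?b"
    using a b by (simp add: diff_Suc)
  also have "\<dots> = s \<otimes>\<^bsub>sections (K (Suc n)) V\<^esub> inv\<^bsub>sections (K (Suc n)) V\<^esub> \<delta> n V ?t"
    using Q.focal_value_unit[OF s(1)]
      focal_value_godement_map[OF f[of n] f[of "Suc n"] diff_morphism s'] by simp
  finally have "s = \<delta> n V ?t"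
    using q.H.inv_solve_right[of "\<one>\<^bsub>sections (K (Suc n)) V\<^esub>" s "\<delta> n V ?t"] s(1) f.mor(2)[OF V(1) t] by simp
  then show ?thesis using t by blast
qed

end

section \<open>Restricting the Godement complex to an open subspace\<close>

text \<open>An open subspace and the whole space offer different neighbourhoods of a point, so
  \<open>SOME\<close> may choose different representatives of a germ, and the Godement powers over a
  common open set need not be equal. This map chooses the representatives anew in \<open>X\<close>
  at every level. The source topology is not an argument, because the germs are already given as
  pairs.\<close>

primrec godement_extend ::
    "'p topology \<Rightarrow> ('p, 'a) ab_presheaf \<Rightarrow> nat \<Rightarrow> 'p set \<Rightarrow> ('p, 'a) godement \<Rightarrow> ('p, 'a) godement" where
  "godement_extend X F 0 = (\<lambda>V s. s)"
| "godement_extend X F (Suc n) = godement_map X (godement_power X F n) (godement_extend X F n)"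

declare godement_extend.simps [simp del]

lemma godement_extend_Suc [simp]:
  "godement_map X (godement_power X F n) (godement_extend X F n) = godement_extend X F (Suc n)"
  by (simp add: godement_extend.simps)

locale open_subspace = godement_resolution X F
  for X :: "'p topology" and F :: "('p, 'a) ab_presheaf" +
  fixes S :: "'p set"
  assumes S: "openin X S"
begin

abbreviation Y :: "'p topology" where
  "Y \<equiv> subtopology X S"

lemma openin_Y: "openin Y V \<longleftrightarrow> openin X V \<and> V \<subseteq> S"
  using S by (rule openin_open_subtopology)

sublocale Y: godement_resolution Y F
  by unfold_locales (rule presheaf_coarser[OF presheaf_F], simp add: openin_Y)

abbreviation \<theta> :: "nat \<Rightarrow> 'p set \<Rightarrow> ('p, 'a) godement \<Rightarrow> ('p, 'a) godement" where
  "\<theta> \<equiv> godement_extend X F"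

lemma extend_morphism: "presheaf_morphism Y X (Y.K n) (K n) (\<theta> n)"
proof (induction n)
  case 0
  show ?case
    by (rule presheaf_morphismI[OF Y.presheaf_K presheaf_K])
      (auto simp: openin_Y presheaf_hom_def hom_def godement_power.simps godement_extend.simps)
next
  case (Suc n)
  interpret presheaf_morphism Y X "Y.K n" "K n" "\<theta> n" by (rule Suc)
  show ?case
    using godement_map_hom
    by (intro presheaf_morphismI[OF Y.presheaf_K presheaf_K]) (auto simp: openin_Y)
qed

lemma extend_bij:
  "openin Y V \<Longrightarrow> bij_betw (\<theta> n V) (carrier (sections (Y.K n) V)) (carrier (sections (K n) V))"
proof (induction n arbitrary: V)
  case 0
  then show ?case by (simp add: godement_power.simps godement_extend.simps bij_betw_def inj_on_def)
next
  case (Suc n)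
  interpret presheaf_morphism Y X "Y.K n" "K n" "\<theta> n" by (rule extend_morphism)
  show ?case
    using godement_map_bij[OF _ Suc.IH Suc.prems] by (auto simp: openin_Y)
qed

text \<open>The two parts of \<open>\<eta> - G \<delta>\<close> are transported separately: the unit
  by naturality, \<open>G \<delta>\<close> by functoriality and the induction hypothesis.\<close>

lemma extend_diff:
  "openin Y V \<Longrightarrow> s \<in> carrier (sections (Y.K n) V) \<Longrightarrow>
    \<theta> (Suc n) V (Y.\<delta> n V s) = \<delta> n V (\<theta> n V s)"
proof (induction n arbitrary: V s)
  case 0
  interpret presheaf_morphism Y X "Y.K 0" "K 0" "\<theta> 0" by (rule extend_morphism)
  have "\<theta> 0 V s = s" by (simp add: godement_extend.simps)
  then show ?case using godement_map_unit[OF 0] by simp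
next
  case (Suc n)
  interpret f: presheaf_morphism Y X "Y.K n" "K n" "\<theta> n" by (rule extend_morphism)
  interpret g: presheaf_morphism Y X "Y.K (Suc n)" "K (Suc n)" "\<theta> (Suc n)" by (rule extend_morphism)
  interpret dY: presheaf_morphism Y Y "Y.K n" "Y.K (Suc n)" "Y.\<delta> n" by (rule Y.diff_morphism)
  interpret h: group_hom "sections (Y.K (Suc (Suc n))) V" "sections (K (Suc (Suc n))) V" "\<theta> (Suc (Suc n)) V"
    using presheaf_homD(1)[OF presheaf_morphism.morphism[OF extend_morphism] Suc.prems(1)] Suc.prems(1)
    by (intro group_homI_comm Y.comm_group_K comm_group_K) (auto simp: openin_Y)
  have V: "openin X V" using Suc.prems by (simp add: openin_Y)
  have s: "s \<in> carrier (sections (godement_sheaf Y (Y.K n)) V)" using Suc.prems by simp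
  have a: "godement_unit Y (Y.K (Suc n)) V s \<in> carrier (sections (Y.K (Suc (Suc n))) V)"
    using presheaf_homD(2)[OF g.Y.godement_unit_hom Suc.prems] by simp
  have b: "godement_map Y (Y.K (Suc n)) (Y.\<delta> n) V s \<in> carrier (sections (Y.K (Suc (Suc n))) V)"
    using dY.godement_map_closed[OF Suc.prems(1) s] by simp
  have "\<theta> (Suc (Suc n)) V (godement_unit Y (Y.K (Suc n)) V s) = godement_unit X (K (Suc n)) V (\<theta> (Suc n) V s)"
    using g.godement_map_unit[OF Suc.prems] by simp
  moreover have "\<theta> (Suc (Suc n)) V (godement_map Y (Y.K (Suc n)) (Y.\<delta> n) V s) =
      godement_map X (K (Suc n)) (\<delta> n) V (\<theta> (Suc n) V s)"
  proof -
    have "\<theta> (Suc (Suc n)) V (godement_map Y (Y.K (Suc n)) (Y.\<delta> n) V s) =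
        godement_map X (K (Suc n)) (\<lambda>W t. \<theta> (Suc n) W (Y.\<delta> n W t)) V s"
      using godement_map_comp[OF Y.diff_morphism extend_morphism Suc.prems(1) s] by simp
    also have "\<dots> = godement_map X (K (Suc n)) (\<lambda>W t. \<delta> n W (\<theta> n W t)) V s"
      by (rule godement_map_cong[OF Y.presheaf_K Suc.IH Suc.prems(1) s])
    also have "\<dots> = godement_map X (K (Suc n)) (\<delta> n) V (\<theta> (Suc n) V s)"
      using godement_map_comp[OF extend_morphism diff_morphism Suc.prems(1) s] by simp
    finally show ?thesis .
  qed
  ultimately show ?case
    using h.hom_mult[OF a Y.comm_group_K[OF Suc.prems(1), THEN comm_group.axioms(2), THEN group.inv_closed, OF b]]
      h.hom_inv[OF b]
    unfolding Y.diff_Suc diff_Suc by simp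
qed

text \<open>Acyclicity concerns the resolution formed inside \<open>S\<close>, while exactness is
  wanted for the resolution of \<open>X\<close> over \<open>S\<close>. A cocycle is pulled back
  along \<open>\<theta>\<close>, bounded in the subspace, and the primitive is pushed forward.
  Degree \<open>Suc n\<close> sits at power \<open>Suc (Suc n)\<close>.\<close>

lemma exact_of_trivial_cohomology:
  assumes triv: "trivial_group (sheaf_cohomology Y F (Suc n))"
    and s: "s \<in> carrier (sections (K (Suc (Suc n))) S)"
      "\<delta> (Suc (Suc n)) S s = \<one>\<^bsub>sections (K (Suc (Suc (Suc n)))) S\<^esub>"
  shows "s \<in> \<delta> (Suc n) S ` carrier (sections (K (Suc n)) S)"
proof -
  have top: "topspace X \<inter> S = S" using openin_subset[OF S] by auto
  have SY: "openin Y S" using S by (simp add: openin_Y)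
  let ?G = "sections (Y.K (Suc (Suc n))) S"
  interpret h: group_hom "sections (Y.K (Suc (Suc (Suc n)))) S" "sections (K (Suc (Suc (Suc n)))) S"
      "\<theta> (Suc (Suc (Suc n))) S"
    using presheaf_homD(1)[OF presheaf_morphism.morphism[OF extend_morphism] SY]
    by (intro group_homI_comm Y.comm_group_K comm_group_K SY S)
  interpret e: group_hom "sections (Y.K (Suc n)) S" ?G "Y.\<delta> (Suc n) S"
    by (rule Y.diff_group_hom[OF SY])
  interpret e': group_hom ?G "sections (Y.K (Suc (Suc (Suc n)))) S" "Y.\<delta> (Suc (Suc n)) S"
    by (rule Y.diff_group_hom[OF SY])
  obtain t where t: "t \<in> carrier ?G" "\<theta> (Suc (Suc n)) S t = s"
    using extend_bij[OF SY, of "Suc (Suc n)"] s(1) by (metis bij_betw_imp_surj_on imageE)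
  have "\<theta> (Suc (Suc (Suc n))) S (Y.\<delta> (Suc (Suc n)) S t) = \<theta> (Suc (Suc (Suc n))) S \<one>\<^bsub>sections (Y.K (Suc (Suc (Suc n)))) S\<^esub>"
    using extend_diff[OF SY t(1)] t(2) s(2) h.hom_one by simp
  then have "Y.\<delta> (Suc (Suc n)) S t = \<one>\<^bsub>sections (Y.K (Suc (Suc (Suc n)))) S\<^esub>"
    using extend_bij[OF SY, of "Suc (Suc (Suc n))"] e'.hom_closed[OF t(1)] h.G.one_closed
    by (metis bij_betw_imp_inj_on inj_onD)
  then have "t \<in> cocycles Y F (Suc n)"
    using t by (simp add: cocycles_def godement_complex_def top kernel_def)
  moreover have "coboundaries Y F (Suc n) = Y.\<delta> (Suc n) S ` carrier (sections (Y.K (Suc n)) S)"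
    by (simp add: godement_complex_def top)
  \<comment> \<open>In a trivial quotient every coset is the neutral one; \<open>t\<close> lies in
    its own coset, hence among the coboundaries.\<close>
  ultimately have "coboundaries Y F (Suc n) #>\<^bsub>?G\<lparr>carrier := cocycles Y F (Suc n)\<rparr>\<^esub> t
      = coboundaries Y F (Suc n)"
    using triv by (auto simp: trivial_group_def sheaf_cohomology_def carrier_FactGroup godement_complex_def top)
  moreover have "t \<in> coboundaries Y F (Suc n) #>\<^bsub>?G\<lparr>carrier := cocycles Y F (Suc n)\<rparr>\<^esub> t"
    using t e.H.l_one e.hom_one e.G.one_closed
    unfolding r_coset_def by (auto simp: godement_complex_def top intro!: bexI[of _ "\<one>\<^bsub>sections (Y.K (Suc n)) S\<^esub>"])
  ultimately obtain u where u: "u \<in> carrier (sections (Y.K (Suc n)) S)" "t = Y.\<delta> (Suc n) S u"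
    by (auto simp: godement_complex_def top)
  then have "s = \<delta> (Suc n) S (\<theta> (Suc n) S u)"
    using extend_diff[OF SY u(1)] t(2) by simp
  then show ?thesis
    using extend_bij[OF SY, of "Suc n"] u(1) by (auto simp: bij_betw_def)
qed

end

section \<open>Exactness in degree zero\<close>

lemma sheaf_base_presheaf:
  assumes "sheaf X F"
  shows "sheaf X (base_presheaf F)"
  unfolding sheaf_def
proof (intro conjI allI impI ballI)
  show "presheaf X (base_presheaf F)"
    using assms by (auto simp: sheaf_def intro: presheaf_base_presheaf)
next
  fix \<U> s t
  assume "\<forall>W\<in>\<U>. openin X W" "s \<in> carrier (sections (base_presheaf F) (\<Union>\<U>))"
    "t \<in> carrier (sections (base_presheaf F) (\<Union>\<U>))"
    "\<forall>W\<in>\<U>. restriction (base_presheaf F) (\<Union>\<U>) W s = restriction (base_presheaf F) (\<Union>\<U>) W t"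
  then show "s = t"
    using assms by (auto simp: sheaf_def base_presheaf_def transport_group_def)
next
  fix \<U> f
  assume U: "\<forall>W\<in>\<U>. openin X W"
    and f: "(\<forall>W\<in>\<U>. f W \<in> carrier (sections (base_presheaf F) W)) \<and>
      (\<forall>V\<in>\<U>. \<forall>W\<in>\<U>. restriction (base_presheaf F) V (V \<inter> W) (f V) =
        restriction (base_presheaf F) W (V \<inter> W) (f W))"
  define g where "g = the_section \<circ> f"
  have fg: "f W = Section (g W)" "g W \<in> carrier (sections F W)" if "W \<in> \<U>" for W
    using f that by (auto simp: g_def base_presheaf_def transport_group_def)
  have "\<forall>V\<in>\<U>. \<forall>W\<in>\<U>. restriction F V (V \<inter> W) (g V) = restriction F W (V \<inter> W) (g W)"
    using f fg by (auto simp: base_presheaf_def)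
  then obtain s where "s \<in> carrier (sections F (\<Union>\<U>))" "\<forall>W\<in>\<U>. restriction F (\<Union>\<U>) W s = g W"
    using assms U fg unfolding sheaf_def by (metis (no_types, lifting))
  then show "\<exists>s\<in>carrier (sections (base_presheaf F) (\<Union>\<U>)).
      \<forall>W\<in>\<U>. restriction (base_presheaf F) (\<Union>\<U>) W s = f W"
    using fg by (intro bexI[of _ "Section s"]) (auto simp: base_presheaf_def transport_group_def)
qed

locale godement_sheaf_resolution = godement_resolution X F
  for X :: "'p topology" and F :: "('p, 'a) ab_presheaf" +
  assumes sheaf_F: "sheaf X F"
begin

lemma sheaf_K0: "sheaf X (K 0)"
  using sheaf_base_presheaf[OF sheaf_F] by (simp add: godement_power.simps)

text \<open>The covering to which the uniqueness axiom is applied consists of all open sets on which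
  \<open>s\<close> and \<open>t\<close> agree; equality of germs says that they exhaust
  \<open>V\<close>.\<close>

lemma sheaf_inj:
  assumes V: "openin X V" and s: "s \<in> carrier (sections (K 0) V)" and t: "t \<in> carrier (sections (K 0) V)"
    and eq: "\<And>x. x \<in> V \<Longrightarrow> germ X (K 0) x V s = germ X (K 0) x V t"
  shows "s = t"
proof -
  interpret godement_presheaf X "K 0" by (rule godement_presheaf_K)
  define \<U> where "\<U> = {N. openin X N \<and> N \<subseteq> V \<and> restriction (K 0) V N s = restriction (K 0) V N t}"
  have "x \<in> \<Union>\<U>" if x: "x \<in> V" for x
    using eq[OF x] V s t x by (subst (asm) germ_eq_iff) (auto simp: valid_def \<U>_def)
  then have VU: "\<Union>\<U> = V" by (auto simp: \<U>_def)
  have "\<forall>W\<in>\<U>. openin X W" "\<forall>W\<in>\<U>. restriction (K 0) (\<Union>\<U>) W s = restriction (K 0) (\<Union>\<U>) W t"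
    unfolding VU by (auto simp: \<U>_def)
  then show ?thesis
    using sheaf_K0 s t unfolding sheaf_def VU[symmetric] by blast
qed

lemma diff_0_inj:
  assumes V: "openin X V" and s: "s \<in> carrier (sections (K 0) V)" "\<delta> 0 V s = \<one>\<^bsub>sections (K (Suc 0)) V\<^esub>"
  shows "s = \<one>\<^bsub>sections (K 0) V\<^esub>"
proof (rule sheaf_inj[OF V s(1)])
  interpret h: group_hom "sections (K 0) V" "sections (K (Suc 0)) V" "\<delta> 0 V"
    by (rule diff_group_hom[OF V])
  show "\<one>\<^bsub>sections (K 0) V\<^esub> \<in> carrier (sections (K 0) V)" by simp
  have eq: "\<delta> 0 V s = \<delta> 0 V \<one>\<^bsub>sections (K 0) V\<^esub>" using s(2) by simp
  show "germ X (K 0) x V s = germ X (K 0) x V \<one>\<^bsub>sections (K 0) V\<^esub>" if "x \<in> V" for x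
    using that by (simp only: germ_at_diff_0[OF that, symmetric] eq)
qed

text \<open>The cocycle condition says \<open>\<eta> s = G \<eta> s\<close>. Read at a point
  \<open>y\<close>, it means that near \<open>y\<close> the family \<open>s\<close> consists of the
  germs of one section \<open>t\<close>. Such local sections have equal germs on overlaps, hence
  agree there, and they glue.\<close>

lemma diff_0_exact:
  assumes V: "openin X V" and s: "s \<in> carrier (sections (K (Suc 0)) V)"
    and ds: "\<delta> (Suc 0) V s = \<one>\<^bsub>sections (K (Suc (Suc 0))) V\<^esub>"
  shows "s \<in> \<delta> 0 V ` carrier (sections (K 0) V)"
proof -
  interpret f: presheaf_morphism X X "K 0" "K (Suc 0)" "\<delta> 0" by (rule diff_morphism)
  interpret G: comm_group "sections (K (Suc (Suc 0))) V" by (rule comm_group_K[OF V])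
  have s': "s \<in> carrier (sections (godement_sheaf X (K 0)) V)" using s by simp
  let ?a = "godement_unit X (K (Suc 0)) V s" and ?b = "godement_map X (K (Suc 0)) (\<delta> 0) V s"
  have a: "?a \<in> carrier (sections (K (Suc (Suc 0))) V)"
    using presheaf_homD(2)[OF f.X.godement_unit_hom V s] by simp
  have b: "?b \<in> carrier (sections (K (Suc (Suc 0))) V)"
    using f.godement_map_closed[OF V s'] by simp
  have ab: "?a = ?b"
    using ds a b G.inv_solve_right[of "\<one>\<^bsub>sections (K (Suc (Suc 0))) V\<^esub>" ?a ?b] unfolding diff_Suc by simp
  define good where "good = (\<lambda>N t. t \<in> carrier (sections (K 0) N) \<and>
    (\<forall>x\<in>N. germ_at s x = germ X (K 0) x N t))"
  define \<U> where "\<U> = {N. openin X N \<and> N \<subseteq> V \<and> (\<exists>t. good N t)}"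
  define g where "g = (\<lambda>N. SOME t. good N t)"
  have g: "good N (g N)" if "N \<in> \<U>" for N
    using that unfolding \<U>_def g_def by (auto intro: someI)
  have "y \<in> \<Union>\<U>" if y: "y \<in> V" for y
  proof -
    obtain W t where W: "openin X W" "y \<in> W" "t \<in> carrier (sections (K 0) W)" "germ_at s y = germ X (K 0) y W t"
      using germ_at_closed[OF s' y] by (rule f.Y.stalk_cases)
    \<comment> \<open>An equality of germs of families, not just of their values at
      \<open>y\<close>: it forces agreement on a whole neighbourhood.\<close>
    have "germ X (K (Suc 0)) y V s = germ X (K (Suc 0)) y W (\<delta> 0 W t)"
      using f.godement_map_germ[OF y W(4,1,2,3)] germ_at_godement_unit[OF y, of X "K (Suc 0)" s]
      by (simp add: ab)
    then obtain N where N: "openin X N" "y \<in> N" "N \<subseteq> V \<inter> W"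
      "restriction (K (Suc 0)) V N s = restriction (K (Suc 0)) W N (\<delta> 0 W t)"
      using W V y s f.mor(2)[OF W(1,3)] by (subst (asm) f.X.germ_eq_iff) (auto simp: f.X.valid_def)
    have eq: "restriction (K (Suc 0)) V N s = \<delta> 0 N (restriction (K 0) W N t)"
      using N W by (simp add: f.mor(4))
    have "germ_at s x = germ X (K 0) x N (restriction (K 0) W N t)" if x: "x \<in> N" for x
      using arg_cong[OF eq, of "\<lambda>s. germ_at s x"] x germ_at_diff_0[OF x]
        restriction_godement_sheaf[of X "K 0" V N s] by simp
    then have "good N (restriction (K 0) W N t)"
      using N W by (simp add: good_def)
    then show ?thesis using N by (auto simp: \<U>_def)
  qed
  then have VU: "\<Union>\<U> = V" by (auto simp: \<U>_def)
  have o: "openin X N" if "N \<in> \<U>" for N using that by (simp add: \<U>_def)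
  have gc: "g N \<in> carrier (sections (K 0) N)" if "N \<in> \<U>" for N
    using g[OF that] by (simp add: good_def)
  have comp: "restriction (K 0) N (N \<inter> M) (g N) = restriction (K 0) M (N \<inter> M) (g M)"
    if N: "N \<in> \<U>" and M: "M \<in> \<U>" for N M
  proof (rule sheaf_inj)
    show NM: "openin X (N \<inter> M)" using o N M by auto
    show "restriction (K 0) N (N \<inter> M) (g N) \<in> carrier (sections (K 0) (N \<inter> M))"
      "restriction (K 0) M (N \<inter> M) (g M) \<in> carrier (sections (K 0) (N \<inter> M))"
      using NM o gc N M by auto
    show "germ X (K 0) x (N \<inter> M) (restriction (K 0) N (N \<inter> M) (g N)) =
        germ X (K 0) x (N \<inter> M) (restriction (K 0) M (N \<inter> M) (g M))" if x: "x \<in> N \<inter> M" for x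
      using g[OF N] g[OF M] x NM o[OF N] o[OF M] by (simp add: f.Y.germ_restriction good_def) metis
  qed
  have "\<exists>t\<in>carrier (sections (K 0) (\<Union>\<U>)). \<forall>W\<in>\<U>. restriction (K 0) (\<Union>\<U>) W t = g W"
    using sheaf_K0 o gc comp unfolding sheaf_def by (metis (no_types, lifting))
  then obtain t where t: "t \<in> carrier (sections (K 0) V)" "\<And>N. N \<in> \<U> \<Longrightarrow> restriction (K 0) V N t = g N"
    unfolding VU by blast
  have "s = \<delta> 0 V t"
  proof (rule godement_eqI[OF s'])
    show "\<delta> 0 V t \<in> carrier (sections (godement_sheaf X (K 0)) V)"
      using f.mor(2)[OF V t(1)] by simp
    fix x assume x: "x \<in> V"
    then obtain N where N: "N \<in> \<U>" "x \<in> N" using VU by blast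
    have "germ_at s x = germ X (K 0) x N (restriction (K 0) V N t)"
      using g[OF N(1)] N t(2) by (simp add: good_def)
    also have "\<dots> = germ X (K 0) x V t"
      using V N t(1) by (intro f.Y.germ_restriction) (auto simp: \<U>_def)
    also have "\<dots> = germ_at (\<delta> 0 V t) x"
      using germ_at_diff_0[OF x] by simp
    finally show "germ_at s x = germ_at (\<delta> 0 V t) x" .
  qed
  then show ?thesis using t(1) by blast
qed

end

section \<open>The Cech complex of ordered cochains\<close>

text \<open>A cochain \<open>s\<close> of degree \<open>n - 1\<close> over \<open>W\<close> assigns to a list \<open>I\<close> of length \<open>n\<close> a section over
  \<open>W \<inter> \<Inter>(set I)\<close>.  The recursion is the cone formula
  \<open>(ds)\<^bsub>v # I\<^esub> = s\<^sub>I - (d s\<^sub>v)\<^sub>I\<close>, where \<open>s\<^sub>v = (\<lambda>J. s\<^bsub>v # J\<^esub>)\<close> is a cochain over \<open>W \<inter> v\<close>.\<close>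

fun cech_diff :: "('p, 'b) ab_presheaf \<Rightarrow> 'p set \<Rightarrow> ('p set list \<Rightarrow> 'b) \<Rightarrow> 'p set list \<Rightarrow> 'b" where
  "cech_diff P W s [] = \<one>\<^bsub>sections P W\<^esub>"
| "cech_diff P W s (v # I) =
     restriction P (W \<inter> \<Inter>(set I)) (W \<inter> v \<inter> \<Inter>(set I)) (s I) \<otimes>\<^bsub>sections P (W \<inter> v \<inter> \<Inter>(set I))\<^esub>
     inv\<^bsub>sections P (W \<inter> v \<inter> \<Inter>(set I))\<^esub> cech_diff P (W \<inter> v) (\<lambda>J. s (v # J)) I"

locale cech = presheaf_on X P
  for X :: "'p topology" and P :: "('p, 'b) ab_presheaf" +
  fixes \<V> :: "'p set set"
  assumes open_cover: "v \<in> \<V> \<Longrightarrow> openin X v"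
begin

text \<open>The index is the length of the lists at which the differential is evaluated, one more
  than that of the lists carrying \<open>s\<close>. Hence \<open>cochain 0\<close> is vacuous,
  matching the value of \<open>cech_diff\<close> at \<open>[]\<close>. The ambient set
  \<open>W\<close> varies because the recursion passes to \<open>W \<inter> v\<close>.\<close>

definition cochain :: "nat \<Rightarrow> 'p set \<Rightarrow> ('p set list \<Rightarrow> 'b) \<Rightarrow> bool" where
  "cochain n W s \<longleftrightarrow> (\<forall>J\<in>lists \<V>. Suc (length J) = n \<longrightarrow> s J \<in> carrier (sections P (W \<inter> \<Inter>(set J))))"

lemma cochain_Cons: "cochain (Suc n) W s \<Longrightarrow> v \<in> \<V> \<Longrightarrow> cochain n (W \<inter> v) (\<lambda>J. s (v # J))"
  unfolding cochain_def
  by (metis (no_types, lifting) Cons_in_lists_iff Inter_insert inf_assoc length_Cons list.simps(15))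

lemma cochainD:
  "cochain (Suc n) W s \<Longrightarrow> J \<in> lists \<V> \<Longrightarrow> length J = n \<Longrightarrow> s J \<in> carrier (sections P (W \<inter> \<Inter>(set J)))"
  by (auto simp: cochain_def)

lemma openin_cap: "openin X W \<Longrightarrow> I \<in> lists \<V> \<Longrightarrow> openin X (W \<inter> \<Inter>(set I))"
proof (induction I arbitrary: W)
  case (Cons v I)
  then have "openin X (W \<inter> v \<inter> \<Inter>(set I))" using open_cover by auto
  then show ?case by (simp add: Int_assoc)
qed simp

lemma cap_Cons: "W \<inter> \<Inter>(set (v # I)) = W \<inter> v \<inter> \<Inter>(set I)"
  by auto

lemma cech_diff_closed:
  assumes "openin X W" "I \<in> lists \<V>" "cochain (length I) W s"
  shows "cech_diff P W s I \<in> carrier (sections P (W \<inter> \<Inter>(set I)))"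
  using assms
proof (induction I arbitrary: W s)
  case Nil
  then show ?case using comm_groupE(2)[OF comm_group_sections] by simp
next
  case (Cons v I)
  let ?Z = "W \<inter> v \<inter> \<Inter>(set I)"
  have o: "openin X (W \<inter> v)" "openin X ?Z" "openin X (W \<inter> \<Inter>(set I))"
    using Cons.prems open_cover by (auto intro!: openin_cap)
  interpret Z: comm_group "sections P ?Z" by (rule comm_group_sections[OF o(2)])
  have "cech_diff P (W \<inter> v) (\<lambda>J. s (v # J)) I \<in> carrier (sections P ?Z)"
    using Cons.prems o by (intro Cons.IH) (auto intro!: cochain_Cons)
  moreover have "restriction P (W \<inter> \<Inter>(set I)) ?Z (s I) \<in> carrier (sections P ?Z)"
    using Cons.prems o by (intro restriction_closed cochainD[of "length I"]) auto
  ultimately show ?case unfolding cap_Cons by simp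
qed

lemma cech_diff_cong:
  assumes "I \<in> lists \<V>" "\<And>J. J \<in> lists \<V> \<Longrightarrow> Suc (length J) = length I \<Longrightarrow> s J = t J"
  shows "cech_diff P W s I = cech_diff P W t I"
  using assms
proof (induction I arbitrary: W s t)
  case (Cons v I)
  have "cech_diff P (W \<inter> v) (\<lambda>J. s (v # J)) I = cech_diff P (W \<inter> v) (\<lambda>J. t (v # J)) I"
  proof (rule Cons.IH)
    show "s (v # J) = t (v # J)" if "J \<in> lists \<V>" "Suc (length J) = length I" for J
      using Cons.hyps Cons.prems[of "v # J"] that by simp
  qed
  moreover have "s I = t I" using Cons.hyps Cons.prems by simp
  ultimately show ?case by simp
qed simp

lemma cech_diff_mult:
  assumes "openin X W" "I \<in> lists \<V>" "cochain (length I) W s" "cochain (length I) W t"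
  shows "cech_diff P W (\<lambda>J. s J \<otimes>\<^bsub>sections P (W \<inter> \<Inter>(set J))\<^esub> t J) I =
    cech_diff P W s I \<otimes>\<^bsub>sections P (W \<inter> \<Inter>(set I))\<^esub> cech_diff P W t I"
  using assms
proof (induction I arbitrary: W s t)
  case Nil
  then interpret comm_group "sections P W" by (intro comm_group_sections) simp
  show ?case by simp
next
  case (Cons v I)
  let ?Z = "W \<inter> v \<inter> \<Inter>(set I)" and ?V = "W \<inter> \<Inter>(set I)"
  have o: "openin X (W \<inter> v)" "openin X ?Z" "openin X ?V"
    using Cons.prems open_cover by (auto intro!: openin_cap)
  interpret r: group_hom "sections P ?V" "sections P ?Z" "restriction P ?V ?Z"
    using o by (intro restriction_group_hom) auto
  interpret Z: comm_group "sections P ?Z" by (rule comm_group_sections[OF o(2)])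
  have c: "cochain (length I) (W \<inter> v) (\<lambda>J. s (v # J))" "cochain (length I) (W \<inter> v) (\<lambda>J. t (v # J))"
    using Cons.prems by (auto intro!: cochain_Cons)
  have I: "I \<in> lists \<V>" using Cons.prems by simp
  have "cech_diff P (W \<inter> v) (\<lambda>J. s (v # J)) I \<in> carrier (sections P ?Z)"
    "cech_diff P (W \<inter> v) (\<lambda>J. t (v # J)) I \<in> carrier (sections P ?Z)"
    using cech_diff_closed[OF o(1) I] c by auto
  moreover have "s I \<in> carrier (sections P ?V)" "t I \<in> carrier (sections P ?V)"
    using Cons.prems by (auto intro!: cochainD[of "length I"])
  moreover have "cech_diff P (W \<inter> v) (\<lambda>J. s (v # J) \<otimes>\<^bsub>sections P (W \<inter> \<Inter>(set (v # J)))\<^esub> t (v # J)) I =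
      cech_diff P (W \<inter> v) (\<lambda>J. s (v # J)) I \<otimes>\<^bsub>sections P ?Z\<^esub> cech_diff P (W \<inter> v) (\<lambda>J. t (v # J)) I"
    unfolding cap_Cons by (rule Cons.IH[OF o(1) I c])
  ultimately show ?case
    unfolding cap_Cons cech_diff.simps
    by (simp add: r.H.inv_mult_group Z.m_ac)
qed

lemma cech_diff_one:
  assumes "openin X W" "I \<in> lists \<V>"
  shows "cech_diff P W (\<lambda>J. \<one>\<^bsub>sections P (W \<inter> \<Inter>(set J))\<^esub>) I = \<one>\<^bsub>sections P (W \<inter> \<Inter>(set I))\<^esub>"
proof -
  interpret G: comm_group "sections P (W \<inter> \<Inter>(set I))"
    using assms by (intro comm_group_sections openin_cap)
  have one: "\<one>\<^bsub>sections P (W \<inter> \<Inter>(set J))\<^esub> \<otimes>\<^bsub>sections P (W \<inter> \<Inter>(set J))\<^esub> \<one>\<^bsub>sections P (W \<inter> \<Inter>(set J))\<^esub>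
      = \<one>\<^bsub>sections P (W \<inter> \<Inter>(set J))\<^esub>" if "J \<in> lists \<V>" for J
  proof -
    interpret comm_group "sections P (W \<inter> \<Inter>(set J))"
      using assms that by (intro comm_group_sections openin_cap)
    show ?thesis by simp
  qed
  have c: "cochain (length I) W (\<lambda>J. \<one>\<^bsub>sections P (W \<inter> \<Inter>(set J))\<^esub>)"
    using assms by (auto simp: cochain_def intro!: comm_groupE(2) comm_group_sections openin_cap)
  let ?d = "cech_diff P W (\<lambda>J. \<one>\<^bsub>sections P (W \<inter> \<Inter>(set J))\<^esub>) I"
  \<comment> \<open>Multiplicativity makes the value idempotent, and the unit is the only idempotent
    of a group.\<close>
  have "?d \<otimes>\<^bsub>sections P (W \<inter> \<Inter>(set I))\<^esub> ?d = ?d"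
    unfolding cech_diff_mult[OF assms c c, symmetric]
    using assms(2) one by (intro cech_diff_cong) auto
  then show ?thesis
    using cech_diff_closed[OF assms c] by (simp add: G.r_cancel_one')
qed

lemma cech_diff_inv:
  assumes "openin X W" "I \<in> lists \<V>" "cochain (length I) W s"
  shows "cech_diff P W (\<lambda>J. inv\<^bsub>sections P (W \<inter> \<Inter>(set J))\<^esub> s J) I =
    inv\<^bsub>sections P (W \<inter> \<Inter>(set I))\<^esub> cech_diff P W s I"
proof -
  let ?i = "\<lambda>J. inv\<^bsub>sections P (W \<inter> \<Inter>(set J))\<^esub> s J"
  interpret G: comm_group "sections P (W \<inter> \<Inter>(set I))"
    using assms by (intro comm_group_sections openin_cap)
  have g: "group (sections P (W \<inter> \<Inter>(set J)))" if "J \<in> lists \<V>" for J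
    using comm_group_sections[OF openin_cap[OF assms(1) that]] by (rule comm_group.axioms)
  have c: "cochain (length I) W ?i"
    using assms(3) g by (auto simp: cochain_def group.inv_closed)
  have "cech_diff P W ?i I \<otimes>\<^bsub>sections P (W \<inter> \<Inter>(set I))\<^esub> cech_diff P W s I =
      cech_diff P W (\<lambda>J. \<one>\<^bsub>sections P (W \<inter> \<Inter>(set J))\<^esub>) I"
    unfolding cech_diff_mult[OF assms(1,2) c assms(3), symmetric]
    using assms g by (intro cech_diff_cong) (auto simp: cochain_def group.l_inv)
  then show ?thesis
    using cech_diff_closed[OF assms(1,2)] c assms(3) unfolding cech_diff_one[OF assms(1,2)]
    by (intro G.inv_equality[symmetric])
qed

text \<open>The first term of the cone formula is a restriction to \<open>W \<inter> v\<close>; this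
  lets a second differential pass through it.\<close>

lemma cech_diff_restriction:
  assumes "openin X W" "openin X W'" "W' \<subseteq> W" "I \<in> lists \<V>" "cochain (length I) W s"
  shows "cech_diff P W' (\<lambda>J. restriction P (W \<inter> \<Inter>(set J)) (W' \<inter> \<Inter>(set J)) (s J)) I =
    restriction P (W \<inter> \<Inter>(set I)) (W' \<inter> \<Inter>(set I)) (cech_diff P W s I)"
  using assms
proof (induction I arbitrary: W W' s)
  case Nil
  then interpret r: group_hom "sections P W" "sections P W'" "restriction P W W'"
    by (intro restriction_group_hom)
  show ?case by simp
next
  case (Cons v I)
  let ?Z = "W \<inter> v \<inter> \<Inter>(set I)" and ?V = "W \<inter> \<Inter>(set I)"
  let ?Z' = "W' \<inter> v \<inter> \<Inter>(set I)" and ?V' = "W' \<inter> \<Inter>(set I)"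
  have o: "openin X (W \<inter> v)" "openin X ?Z" "openin X ?V" "openin X (W' \<inter> v)" "openin X ?Z'" "openin X ?V'"
    using Cons.prems open_cover by (auto intro!: openin_cap)
  have sub: "W' \<inter> v \<subseteq> W \<inter> v" "?Z' \<subseteq> ?Z" "?V' \<subseteq> ?V" "?Z' \<subseteq> ?V'" "?Z \<subseteq> ?V" using Cons.prems by auto
  interpret r: group_hom "sections P ?Z" "sections P ?Z'" "restriction P ?Z ?Z'"
    using o sub by (intro restriction_group_hom) auto
  have c: "cochain (length I) (W \<inter> v) (\<lambda>J. s (v # J))"
    using Cons.prems by (auto intro!: cochain_Cons)
  have I: "I \<in> lists \<V>" using Cons.prems by simp
  have "cech_diff P (W \<inter> v) (\<lambda>J. s (v # J)) I \<in> carrier (sections P ?Z)"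
    using cech_diff_closed[OF o(1) I] c by auto
  moreover have s: "s I \<in> carrier (sections P ?V)"
    using Cons.prems by (auto intro!: cochainD[of "length I"])
  moreover have "cech_diff P (W' \<inter> v)
        (\<lambda>J. restriction P (W \<inter> \<Inter>(set (v # J))) (W' \<inter> \<Inter>(set (v # J))) (s (v # J))) I =
      restriction P ?Z ?Z' (cech_diff P (W \<inter> v) (\<lambda>J. s (v # J)) I)"
    unfolding cap_Cons by (rule Cons.IH[OF o(1) o(4) sub(1) I c])
  moreover have "restriction P ?V' ?Z' (restriction P ?V ?V' (s I)) = restriction P ?V ?Z' (s I)"
    "restriction P ?Z ?Z' (restriction P ?V ?Z (s I)) = restriction P ?V ?Z' (s I)"
    "restriction P ?V ?Z (s I) \<in> carrier (sections P ?Z)"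
    using s o sub by auto
  ultimately show ?case
    unfolding cap_Cons cech_diff.simps by simp
qed

text \<open>By the cone formula, \<open>d s\<close> with first entry fixed to \<open>v\<close> is
  the restriction of \<open>s\<close> minus the differential of \<open>s\<close> with first entry
  \<open>v\<close>. Its differential is the restriction of \<open>d s\<close>, the other term
  vanishing by induction, and this cancels the first term of \<open>d (d s)\<close>.\<close>

lemma cech_diff_diff:
  assumes "openin X W" "I \<in> lists \<V>"
    "\<And>J. J \<in> lists \<V> \<Longrightarrow> Suc (Suc (length J)) = length I \<Longrightarrow> s J \<in> carrier (sections P (W \<inter> \<Inter>(set J)))"
  shows "cech_diff P W (cech_diff P W s) I = \<one>\<^bsub>sections P (W \<inter> \<Inter>(set I))\<^esub>"
  using assms
proof (induction I arbitrary: W s)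
  case (Cons v I)
  let ?Z = "W \<inter> v \<inter> \<Inter>(set I)" and ?V = "W \<inter> \<Inter>(set I)"
  let ?sv = "\<lambda>J. s (v # J)"
  let ?r = "\<lambda>J. restriction P (W \<inter> \<Inter>(set J)) (W \<inter> v \<inter> \<Inter>(set J)) (s J)"
  let ?m = "\<lambda>J. inv\<^bsub>sections P (W \<inter> v \<inter> \<Inter>(set J))\<^esub> cech_diff P (W \<inter> v) ?sv J"
  have o: "openin X (W \<inter> v)" "openin X ?Z" "openin X ?V"
    using Cons.prems open_cover by (auto intro!: openin_cap)
  have I: "I \<in> lists \<V>" using Cons.prems by simp
  have sub: "?Z \<subseteq> ?V" by auto
  interpret Z: comm_group "sections P ?Z" by (rule comm_group_sections[OF o(2)])
  have s: "cochain (length I) W s"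
    using Cons.prems by (auto simp: cochain_def)
  have sv: "s (v # J) \<in> carrier (sections P (W \<inter> v \<inter> \<Inter>(set J)))"
    if "J \<in> lists \<V>" "Suc (Suc (length J)) = length I" for J
    using Cons.prems(3)[of "v # J"] Cons.prems(2) that unfolding cap_Cons by simp
  have c: "cochain (length I) (W \<inter> v) (cech_diff P (W \<inter> v) ?sv)"
    unfolding cochain_def using o sv by (auto intro!: cech_diff_closed simp: cochain_def)
  have cm: "cochain (length I) (W \<inter> v) ?m"
    using c comm_group_sections[OF openin_cap[OF o(1)], THEN comm_group.axioms(2)]
    by (auto simp: cochain_def group.inv_closed)
  have cr: "cochain (length I) (W \<inter> v) ?r"
    using s openin_cap[OF o(1)] openin_cap[OF Cons.prems(1)] unfolding cochain_def
    by (auto intro!: restriction_closed)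
  have "cech_diff P (W \<inter> v) (\<lambda>J. cech_diff P W s (v # J)) I
      = cech_diff P (W \<inter> v) ?r I \<otimes>\<^bsub>sections P ?Z\<^esub> cech_diff P (W \<inter> v) ?m I"
    unfolding cech_diff.simps by (rule cech_diff_mult[OF o(1) I cr cm])
  also have "cech_diff P (W \<inter> v) ?m I = inv\<^bsub>sections P ?Z\<^esub> cech_diff P (W \<inter> v) (cech_diff P (W \<inter> v) ?sv) I"
    by (rule cech_diff_inv[OF o(1) I c])
  also have "cech_diff P (W \<inter> v) (cech_diff P (W \<inter> v) ?sv) I = \<one>\<^bsub>sections P ?Z\<^esub>"
    by (rule Cons.IH[OF o(1) I sv])
  also have "cech_diff P (W \<inter> v) ?r I = restriction P ?V ?Z (cech_diff P W s I)"
    using Cons.prems by (intro cech_diff_restriction o I s) auto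
  finally have "cech_diff P (W \<inter> v) (\<lambda>J. cech_diff P W s (v # J)) I = restriction P ?V ?Z (cech_diff P W s I)"
    using restriction_closed[OF o(3,2) sub cech_diff_closed[OF Cons.prems(1) I s]] by simp
  then show ?case
    using restriction_closed[OF o(3,2) sub cech_diff_closed[OF Cons.prems(1) I s]]
    unfolding cap_Cons cech_diff.simps(2)[of P W "cech_diff P W s"] by simp
qed simp

end

text \<open>With \<open>\<phi>\<close> a Godement differential these are the commuting squares of
  the double complex.\<close>

lemma cech_diff_natural:
  assumes P: "cech X P \<V>" and Q: "cech X Q \<V>" and \<phi>: "presheaf_hom X P Q \<phi>"
    and "openin X W" "I \<in> lists \<V>" "cech.cochain P \<V> (length I) W s"
  shows "cech_diff Q W (\<lambda>J. \<phi> (W \<inter> \<Inter>(set J)) (s J)) I = \<phi> (W \<inter> \<Inter>(set I)) (cech_diff P W s I)"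
proof -
  interpret P: cech X P \<V> by fact
  interpret Q: cech X Q \<V> by fact
  have hom: "group_hom (sections P V) (sections Q V) (\<phi> V)" if "openin X V" for V
    using that by (intro group_homI_comm P.comm_group_sections Q.comm_group_sections presheaf_homD(1)[OF \<phi>])
  show ?thesis
    using assms(4-)
  proof (induction I arbitrary: W s)
    case Nil
    then interpret h: group_hom "sections P W" "sections Q W" "\<phi> W" by (intro hom)
    show ?case by simp
  next
    case (Cons v I)
    let ?Z = "W \<inter> v \<inter> \<Inter>(set I)" and ?V = "W \<inter> \<Inter>(set I)"
    have o: "openin X (W \<inter> v)" "openin X ?Z" "openin X ?V"
      using Cons.prems P.open_cover by (auto intro!: P.openin_cap)
    interpret h: group_hom "sections P ?Z" "sections Q ?Z" "\<phi> ?Z" by (rule hom[OF o(2)])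
    have c: "P.cochain (length I) (W \<inter> v) (\<lambda>J. s (v # J))"
      using Cons.prems by (auto intro!: P.cochain_Cons)
    have I: "I \<in> lists \<V>" using Cons.prems by simp
    have "cech_diff P (W \<inter> v) (\<lambda>J. s (v # J)) I \<in> carrier (sections P ?Z)"
      using P.cech_diff_closed[OF o(1) I] c by auto
    moreover have s: "s I \<in> carrier (sections P ?V)"
      using Cons.prems by (auto intro!: P.cochainD[of "length I"])
    moreover have "cech_diff Q (W \<inter> v) (\<lambda>J. \<phi> (W \<inter> \<Inter>(set (v # J))) (s (v # J))) I =
        \<phi> ?Z (cech_diff P (W \<inter> v) (\<lambda>J. s (v # J)) I)"
      unfolding P.cap_Cons by (rule Cons.IH[OF o(1) I c])
    moreover have "restriction Q ?V ?Z (\<phi> ?V (s I)) = \<phi> ?Z (restriction P ?V ?Z (s I))"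
      using o s by (intro presheaf_homD(4)[OF \<phi>, symmetric]) auto
    moreover have "restriction P ?V ?Z (s I) \<in> carrier (sections P ?Z)"
      using o s by (intro P.restriction_closed) auto
    ultimately show ?case
      unfolding P.cap_Cons cech_diff.simps by simp
  qed
qed

section \<open>Contraction of Cech cochains with values in a Godement sheaf\<close>

context godement_presheaf
begin

text \<open>Restrictions, products and inverses in a Godement sheaf are computed point by point, so
  only germs at \<open>x\<close> matter. The ambient sets may differ because the contraction
  compares a cochain over \<open>W\<close> with one over \<open>W \<inter> v\<close>.\<close>

lemma germ_at_cech_diff_cong:
  assumes \<V>: "\<And>v. v \<in> \<V> \<Longrightarrow> openin X v"
    and "openin X W" "openin X W'" "I \<in> lists \<V>" "x \<in> W" "x \<in> W'" "x \<in> \<Inter>(set I)"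
    and "cech.cochain (godement_sheaf X P) \<V> (length I) W s"
    and "cech.cochain (godement_sheaf X P) \<V> (length I) W' t"
    and "\<And>J. J \<in> lists \<V> \<Longrightarrow> Suc (length J) = length I \<Longrightarrow> x \<in> \<Inter>(set J) \<Longrightarrow>
      germ_at (s J) x = germ_at (t J) x"
  shows "germ_at (cech_diff (godement_sheaf X P) W s I) x = germ_at (cech_diff (godement_sheaf X P) W' t I) x"
proof -
  let ?G = "godement_sheaf X P"
  interpret G: cech X ?G \<V>
    using \<V> presheaf_godement_sheaf by (simp add: cech_def presheaf_on_def cech_axioms_def)
  have step: "germ_at (cech_diff ?G W s (v # I)) x = germ_at (s I) x \<otimes>\<^bsub>stalk X P x\<^esub>
      inv\<^bsub>stalk X P x\<^esub> germ_at (cech_diff ?G (W \<inter> v) (\<lambda>J. s (v # J)) I) x"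
    if "openin X W" "v # I \<in> lists \<V>" "x \<in> W" "x \<in> \<Inter>(set (v # I))" "G.cochain (length (v # I)) W s" for W s v I
  proof -
    have o: "openin X (W \<inter> v)" "openin X (W \<inter> v \<inter> \<Inter>(set I))"
      using that \<V> by (auto intro!: G.openin_cap)
    have "cech_diff ?G (W \<inter> v) (\<lambda>J. s (v # J)) I \<in> carrier (sections ?G (W \<inter> v \<inter> \<Inter>(set I)))"
      using that o by (intro G.cech_diff_closed G.cochain_Cons) auto
    then show ?thesis
      using that o by (simp add: sections_godement_sheaf inv_godement restriction_godement_sheaf)
  qed
  show ?thesis
    using assms(2-)
  proof (induction I arbitrary: W W' s t)
    case Nil
    then show ?case by (simp add: sections_godement_sheaf)
  next
    case (Cons v I)
    have "germ_at (cech_diff ?G (W \<inter> v) (\<lambda>J. s (v # J)) I) x = germ_at (cech_diff ?G (W' \<inter> v) (\<lambda>J. t (v # J)) I) x"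
      using Cons.prems \<V> by (intro Cons.IH) (auto intro!: G.cochain_Cons)
    moreover have "germ_at (s I) x = germ_at (t I) x"
      using Cons.prems by auto
    ultimately show ?case
      using step[OF Cons.prems(1,3,4,6,7)] step[OF Cons.prems(2,3,5,6,8)] by simp
  qed
qed

text \<open>A choice of a member of the cover containing each point contracts the Cech complex.\<close>

lemma cech_contraction:
  assumes \<V>: "\<And>v. v \<in> \<V> \<Longrightarrow> openin X v" and cover: "W \<subseteq> \<Union>\<V>" and W: "openin X W"
    and s: "cech.cochain (godement_sheaf X P) \<V> (Suc n) W s"
    and ds: "\<And>I. I \<in> lists \<V> \<Longrightarrow> length I = Suc n \<Longrightarrow>
      cech_diff (godement_sheaf X P) W s I = \<one>\<^bsub>sections (godement_sheaf X P) (W \<inter> \<Inter>(set I))\<^esub>"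
  obtains h where "cech.cochain (godement_sheaf X P) \<V> n W h"
    "\<And>I. I \<in> lists \<V> \<Longrightarrow> length I = n \<Longrightarrow> s I = cech_diff (godement_sheaf X P) W h I"
proof -
  let ?G = "godement_sheaf X P"
  interpret G: cech X ?G \<V>
    using \<V> presheaf_godement_sheaf by (simp add: cech_def presheaf_on_def cech_axioms_def)
  have "\<forall>x\<in>W. \<exists>v. v \<in> \<V> \<and> x \<in> v" using cover by blast
  from bchoice[OF this] obtain c where c: "\<And>x. x \<in> W \<Longrightarrow> c x \<in> \<V> \<and> x \<in> c x"
    by blast
  \<comment> \<open>The choice \<open>c\<close> may vary arbitrarily with the point, because a
    section of the Godement sheaf is an arbitrary family of germs.\<close>
  define h where "h = (\<lambda>I. Germs (\<lambda>x\<in>W \<inter> \<Inter>(set I). germ_at (s (c x # I)) x))"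
  have h: "G.cochain n W h"
    unfolding G.cochain_def h_def
  proof (intro ballI impI Germs_closed)
    fix J x assume J: "J \<in> lists \<V>" "Suc (length J) = n" and x: "x \<in> W \<inter> \<Inter>(set J)"
    have "s (c x # J) \<in> carrier (sections ?G (W \<inter> \<Inter>(set (c x # J))))"
      using J x c by (intro G.cochainD[OF s]) auto
    then show "germ_at (s (c x # J)) x \<in> carrier (stalk X P x)"
      using x c by (intro germ_at_closed) auto
  qed
  have "s I = cech_diff ?G W h I" if I: "I \<in> lists \<V>" "length I = n" for I
  proof (rule godement_eqI)
    show sI: "s I \<in> carrier (sections ?G (W \<inter> \<Inter>(set I)))"
      by (rule G.cochainD[OF s I])
    show "cech_diff ?G W h I \<in> carrier (sections ?G (W \<inter> \<Inter>(set I)))"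
      using h I by (intro G.cech_diff_closed W) auto
    fix x assume x: "x \<in> W \<inter> \<Inter>(set I)"
    let ?v = "c x"
    let ?Z = "W \<inter> ?v \<inter> \<Inter>(set I)"
    have v: "?v \<in> \<V>" "x \<in> ?v" using c x by auto
    have o: "openin X (W \<inter> ?v)" "openin X ?Z" "openin X (W \<inter> \<Inter>(set I))"
      using W v \<V> I by (auto intro!: G.openin_cap)
    have sub: "?Z \<subseteq> W \<inter> \<Inter>(set I)" by auto
    interpret Z: comm_group "sections ?G ?Z" by (rule comm_group_godement[OF o(2)])
    have cv: "G.cochain (length I) (W \<inter> ?v) (\<lambda>J. s (?v # J))"
      using G.cochain_Cons[OF s v(1)] I by simp
    \<comment> \<open>The cone formula at \<open>?v # I\<close>: its vanishing equates
      \<open>s I\<close> on \<open>?Z\<close> with the differential of a cochain over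
      \<open>W \<inter> ?v\<close> whose germs at \<open>x\<close> are those of
      \<open>h\<close>.\<close>
    have "restriction ?G (W \<inter> \<Inter>(set I)) ?Z (s I) \<otimes>\<^bsub>sections ?G ?Z\<^esub>
        inv\<^bsub>sections ?G ?Z\<^esub> cech_diff ?G (W \<inter> ?v) (\<lambda>J. s (?v # J)) I = \<one>\<^bsub>sections ?G ?Z\<^esub>"
      using ds[of "?v # I"] I v unfolding G.cap_Cons by simp
    from Z.inv_solve_right[OF Z.one_closed G.restriction_closed[OF o(3,2) sub sI]
        G.cech_diff_closed[OF o(1) I(1) cv], THEN iffD1, OF this[symmetric]]
    have "restriction ?G (W \<inter> \<Inter>(set I)) ?Z (s I) = cech_diff ?G (W \<inter> ?v) (\<lambda>J. s (?v # J)) I"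
      using G.cech_diff_closed[OF o(1) I(1) cv] by simp
    from arg_cong[OF this, of "\<lambda>s. germ_at s x"]
    have "germ_at (s I) x = germ_at (cech_diff ?G (W \<inter> ?v) (\<lambda>J. s (?v # J)) I) x"
      using x v by (simp add: restriction_godement_sheaf)
    also have "\<dots> = germ_at (cech_diff ?G W h I) x"
    proof (rule germ_at_cech_diff_cong[OF \<V> o(1) W I(1)])
      show "germ_at (s (?v # J)) x = germ_at (h J) x" if "x \<in> \<Inter>(set J)" for J
        using that x by (simp add: h_def)
    qed (use x v cv h I in auto)
    finally show "germ_at (s I) x = germ_at (cech_diff ?G W h I) x" .
  qed
  then show thesis using h that by blast
qed

end

section \<open>Leray's theorem for acyclic coverings\<close>

text \<open>All lists, repetitions included, so no order on the covering and no sign rule is needed.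
  The length is one more than the Cech degree; \<open>[]\<close> is the augmentation.\<close>

definition simplices :: "'p set set \<Rightarrow> nat \<Rightarrow> 'p set list set" where
  "simplices \<V> p = {I \<in> lists \<V>. length I = p}"

definition cech_group ::
    "('p, 'b) ab_presheaf \<Rightarrow> 'p set set \<Rightarrow> 'p set \<Rightarrow> nat \<Rightarrow> ('p set list \<Rightarrow> 'b) monoid" where
  "cech_group P \<V> W p = product_group (simplices \<V> p) (\<lambda>I. sections P (W \<inter> \<Inter>(set I)))"

definition cech_map ::
    "('p, 'b) ab_presheaf \<Rightarrow> 'p set set \<Rightarrow> 'p set \<Rightarrow> nat \<Rightarrow> ('p set list \<Rightarrow> 'b) \<Rightarrow> 'p set list \<Rightarrow> 'b" where
  "cech_map P \<V> W p s = (\<lambda>I\<in>simplices \<V> (Suc p). cech_diff P W s I)"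

text \<open>No topology occurs, so one and the same group serves two topologies in which the
  covering is open. Degree \<open>n\<close> sits at length \<open>Suc n\<close>, and degree 0 has no
  coboundaries because length 0 is the augmentation.\<close>

definition cech_cohomology ::
    "('p, 'b) ab_presheaf \<Rightarrow> 'p set set \<Rightarrow> 'p set \<Rightarrow> nat \<Rightarrow> ('p set list \<Rightarrow> 'b) set monoid" where
  "cech_cohomology P \<V> W n =
     (cech_group P \<V> W (Suc n))\<lparr>carrier := kernel (cech_group P \<V> W (Suc n))
        (cech_group P \<V> W (Suc (Suc n))) (cech_map P \<V> W (Suc n))\<rparr> Mod
     (if n = 0 then {\<one>\<^bsub>cech_group P \<V> W (Suc 0)\<^esub>}
      else cech_map P \<V> W n ` carrier (cech_group P \<V> W n))"

lemma simplicesD: "I \<in> simplices \<V> p \<Longrightarrow> I \<in> lists \<V> \<and> length I = p"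
  by (simp add: simplices_def)

lemma cech_group_simps:
  "carrier (cech_group P \<V> W p) = (\<Pi>\<^sub>E I\<in>simplices \<V> p. carrier (sections P (W \<inter> \<Inter>(set I))))"
  "\<one>\<^bsub>cech_group P \<V> W p\<^esub> = (\<lambda>I\<in>simplices \<V> p. \<one>\<^bsub>sections P (W \<inter> \<Inter>(set I))\<^esub>)"
  "s \<otimes>\<^bsub>cech_group P \<V> W p\<^esub> t = (\<lambda>I\<in>simplices \<V> p. s I \<otimes>\<^bsub>sections P (W \<inter> \<Inter>(set I))\<^esub> t I)"
  by (simp_all add: cech_group_def)

section \<open>Cech cochain groups and their differentials\<close>

context cech
begin

lemma comm_group_cech:
  assumes "openin X W"
  shows "comm_group (cech_group P \<V> W p)"
  unfolding cech_group_def
  by (intro comm_group_product_group comm_group_sections openin_cap assms) (auto dest: simplicesD)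

lemma cochain_cech: "s \<in> carrier (cech_group P \<V> W p) \<Longrightarrow> cochain (Suc p) W s"
  by (auto simp: cochain_def cech_group_simps simplices_def)

lemma cech_map_hom:
  assumes W: "openin X W"
  shows "cech_map P \<V> W p \<in> hom (cech_group P \<V> W p) (cech_group P \<V> W (Suc p))"
proof (rule homI)
  fix s assume s: "s \<in> carrier (cech_group P \<V> W p)"
  show "cech_map P \<V> W p s \<in> carrier (cech_group P \<V> W (Suc p))"
    using cech_diff_closed[OF W] cochain_cech[OF s] unfolding cech_group_simps cech_map_def
    by (auto simp: simplices_def)
next
  fix s t assume s: "s \<in> carrier (cech_group P \<V> W p)" and t: "t \<in> carrier (cech_group P \<V> W p)"
  have "cech_diff P W (s \<otimes>\<^bsub>cech_group P \<V> W p\<^esub> t) I =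
      cech_diff P W s I \<otimes>\<^bsub>sections P (W \<inter> \<Inter>(set I))\<^esub> cech_diff P W t I"
    if I: "I \<in> simplices \<V> (Suc p)" for I
  proof -
    have "cech_diff P W (s \<otimes>\<^bsub>cech_group P \<V> W p\<^esub> t) I =
        cech_diff P W (\<lambda>J. s J \<otimes>\<^bsub>sections P (W \<inter> \<Inter>(set J))\<^esub> t J) I"
      using simplicesD[OF I] by (intro cech_diff_cong) (auto simp: cech_group_simps simplices_def)
    also have "\<dots> = cech_diff P W s I \<otimes>\<^bsub>sections P (W \<inter> \<Inter>(set I))\<^esub> cech_diff P W t I"
      using simplicesD[OF I] cochain_cech[OF s] cochain_cech[OF t] by (intro cech_diff_mult W) auto
    finally show ?thesis .
  qed
  then show "cech_map P \<V> W p (s \<otimes>\<^bsub>cech_group P \<V> W p\<^esub> t) =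
      cech_map P \<V> W p s \<otimes>\<^bsub>cech_group P \<V> W (Suc p)\<^esub> cech_map P \<V> W p t"
    by (auto simp: cech_map_def cech_group_simps(3) intro!: restrict_ext)
qed

lemma cech_map_map:
  assumes W: "openin X W" and s: "s \<in> carrier (cech_group P \<V> W p)"
  shows "cech_map P \<V> W (Suc p) (cech_map P \<V> W p s) = \<one>\<^bsub>cech_group P \<V> W (Suc (Suc p))\<^esub>"
proof -
  have "cech_diff P W (cech_map P \<V> W p s) I = \<one>\<^bsub>sections P (W \<inter> \<Inter>(set I))\<^esub>"
    if I: "I \<in> simplices \<V> (Suc (Suc p))" for I
  proof -
    have "cech_diff P W (cech_map P \<V> W p s) I = cech_diff P W (cech_diff P W s) I"
      using simplicesD[OF I] by (intro cech_diff_cong) (auto simp: cech_map_def simplices_def)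
    also have "\<dots> = \<one>\<^bsub>sections P (W \<inter> \<Inter>(set I))\<^esub>"
      using simplicesD[OF I] cochainD[OF cochain_cech[OF s]] by (intro cech_diff_diff W) auto
    finally show ?thesis .
  qed
  then show ?thesis
    by (auto simp: cech_map_def[of P \<V> W "Suc p"] cech_group_simps(2) intro!: restrict_ext)
qed

end

text \<open>\<open>inj\<close> and \<open>exact\<close> say that the augmented complex
  \<open>K 0\<close>, \<open>K 1\<close>, ... is exact over every finite nonempty intersection, with
  \<open>K 0\<close> a copy of \<open>F\<close>. This is the common form of two different inputs:
  vanishing cohomology with gluing, or evaluation at a focal point.\<close>

locale acyclic_cover = godement_resolution X F
  for X :: "'p topology" and F :: "('p, 'a) ab_presheaf" +
  fixes \<V> :: "'p set set"
  assumes open_member: "v \<in> \<V> \<Longrightarrow> openin X v"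
    and cover: "\<Union>\<V> = topspace X"
    and inj: "\<W> \<subseteq> \<V> \<Longrightarrow> finite \<W> \<Longrightarrow> \<W> \<noteq> {} \<Longrightarrow> s \<in> carrier (sections (K 0) (\<Inter>\<W>)) \<Longrightarrow>
      \<delta> 0 (\<Inter>\<W>) s = \<one>\<^bsub>sections (K (Suc 0)) (\<Inter>\<W>)\<^esub> \<Longrightarrow> s = \<one>\<^bsub>sections (K 0) (\<Inter>\<W>)\<^esub>"
    and exact: "\<W> \<subseteq> \<V> \<Longrightarrow> finite \<W> \<Longrightarrow> \<W> \<noteq> {} \<Longrightarrow> s \<in> carrier (sections (K (Suc n)) (\<Inter>\<W>)) \<Longrightarrow>
      \<delta> (Suc n) (\<Inter>\<W>) s = \<one>\<^bsub>sections (K (Suc (Suc n))) (\<Inter>\<W>)\<^esub> \<Longrightarrow>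
      s \<in> \<delta> n (\<Inter>\<W>) ` carrier (sections (K n) (\<Inter>\<W>))"
begin

abbreviation U :: "'p set" where "U \<equiv> topspace X"

abbreviation E :: "nat \<Rightarrow> nat \<Rightarrow> ('p set list \<Rightarrow> ('p, 'a) godement) monoid" where
  "E p q \<equiv> cech_group (K q) \<V> U p"

abbreviation d :: "nat \<Rightarrow> nat \<Rightarrow> ('p set list \<Rightarrow> ('p, 'a) godement) \<Rightarrow> 'p set list \<Rightarrow> ('p, 'a) godement" where
  "d p q \<equiv> cech_map (K q) \<V> U p"

definition e :: "nat \<Rightarrow> nat \<Rightarrow> ('p set list \<Rightarrow> ('p, 'a) godement) \<Rightarrow> 'p set list \<Rightarrow> ('p, 'a) godement" where
  "e p q s = (\<lambda>I\<in>simplices \<V> p. \<delta> q (U \<inter> \<Inter>(set I)) (s I))"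

lemma cech_K: "cech X (K q) \<V>"
  using godement_presheaf_K open_member by (simp add: cech_def godement_presheaf_def cech_axioms_def)

lemma openin_simplex: "I \<in> simplices \<V> p \<Longrightarrow> openin X (U \<inter> \<Inter>(set I))"
  by (intro cech.openin_cap[OF cech_K[of 0]]) (auto dest: simplicesD)

lemma simplex_nonempty:
  assumes "I \<in> simplices \<V> (Suc p)"
  shows "U \<inter> \<Inter>(set I) = \<Inter>(set I)" "set I \<subseteq> \<V>" "finite (set I)" "set I \<noteq> {}"
proof -
  show *: "set I \<subseteq> \<V>" "finite (set I)" "set I \<noteq> {}"
    using simplicesD[OF assms] by auto
  then obtain v where v: "v \<in> set I" by (meson ex_in_conv)
  then have "v \<subseteq> U"
    using * openin_subset[OF open_member] by auto
  then show "U \<inter> \<Inter>(set I) = \<Inter>(set I)"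
    using Inter_lower[OF v] by (simp add: Int_absorb1)
qed

lemma e_hom: "e p q \<in> hom (E p q) (E p (Suc q))"
proof (rule homI)
  fix s assume s: "s \<in> carrier (E p q)"
  show "e p q s \<in> carrier (E p (Suc q))"
    unfolding e_def cech_group_simps
  proof (rule restrict_PiE_iff[THEN iffD2], rule ballI)
    fix I assume I: "I \<in> simplices \<V> p"
    then have "s I \<in> carrier (sections (K q) (U \<inter> \<Inter>(set I)))"
      using s by (auto simp: cech_group_simps)
    then show "\<delta> q (U \<inter> \<Inter>(set I)) (s I) \<in> carrier (sections (K (Suc q)) (U \<inter> \<Inter>(set I)))"
      by (rule presheaf_homD(2)[OF diff_hom openin_simplex[OF I]])
  qed
next
  fix s t assume s: "s \<in> carrier (E p q)" and t: "t \<in> carrier (E p q)"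
  show "e p q (s \<otimes>\<^bsub>E p q\<^esub> t) = e p q s \<otimes>\<^bsub>E p (Suc q)\<^esub> e p q t"
    unfolding e_def cech_group_simps(3)
  proof (rule restrict_ext)
    fix I assume I: "I \<in> simplices \<V> p"
    then have "s I \<in> carrier (sections (K q) (U \<inter> \<Inter>(set I)))"
      "t I \<in> carrier (sections (K q) (U \<inter> \<Inter>(set I)))"
      using s t by (auto simp: cech_group_simps)
    from presheaf_homD(3)[OF diff_hom openin_simplex[OF I] this] I
    show "\<delta> q (U \<inter> \<Inter>(set I)) ((\<lambda>I\<in>simplices \<V> p. s I \<otimes>\<^bsub>sections (K q) (U \<inter> \<Inter>(set I))\<^esub> t I) I) =
        (\<lambda>I\<in>simplices \<V> p. \<delta> q (U \<inter> \<Inter>(set I)) (s I)) I \<otimes>\<^bsub>sections (K (Suc q)) (U \<inter> \<Inter>(set I))\<^esub>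
        (\<lambda>I\<in>simplices \<V> p. \<delta> q (U \<inter> \<Inter>(set I)) (t I)) I"
      by simp
  qed
qed

lemma e_e: "x \<in> carrier (E p q) \<Longrightarrow> e p (Suc q) (e p q x) = \<one>\<^bsub>E p (Suc (Suc q))\<^esub>"
  unfolding e_def cech_group_simps
proof (rule restrict_ext)
  fix I assume x: "x \<in> (\<Pi>\<^sub>E I\<in>simplices \<V> p. carrier (sections (K q) (U \<inter> \<Inter>(set I))))"
    and I: "I \<in> simplices \<V> p"
  have "x I \<in> carrier (sections (K q) (U \<inter> \<Inter>(set I)))"
    using x I by blast
  then show "\<delta> (Suc q) (U \<inter> \<Inter>(set I)) ((\<lambda>I\<in>simplices \<V> p. \<delta> q (U \<inter> \<Inter>(set I)) (x I)) I) =
      \<one>\<^bsub>sections (K (Suc (Suc q))) (U \<inter> \<Inter>(set I))\<^esub>"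
    using I by (simp add: diff_diff[OF openin_simplex[OF I]])
qed

lemma d_e:
  assumes x: "x \<in> carrier (E p q)"
  shows "d p (Suc q) (e p q x) = e (Suc p) q (d p q x)"
  unfolding cech_map_def e_def[of "Suc p"]
proof (rule restrict_ext)
  fix I assume I: "I \<in> simplices \<V> (Suc p)"
  interpret K: cech X "K q" \<V> by (rule cech_K)
  interpret K': cech X "K (Suc q)" \<V> by (rule cech_K)
  have "cech_diff (K (Suc q)) U (e p q x) I = cech_diff (K (Suc q)) U (\<lambda>J. \<delta> q (U \<inter> \<Inter>(set J)) (x J)) I"
    using simplicesD[OF I] by (intro K'.cech_diff_cong) (auto simp: e_def simplices_def)
  also have "\<dots> = \<delta> q (U \<inter> \<Inter>(set I)) (cech_diff (K q) U x I)"
    using simplicesD[OF I] K.cochain_cech[OF x]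
    by (intro cech_diff_natural[OF cech_K cech_K diff_hom]) auto
  finally show "cech_diff (K (Suc q)) U (e p q x) I =
      \<delta> q (U \<inter> \<Inter>(set I)) ((\<lambda>I\<in>simplices \<V> (Suc p). cech_diff (K q) U x I) I)"
    using I by simp
qed

text \<open>One statement serves injectivity and exactness of the rows: for \<open>p = 0\<close> the
  cochain \<open>h\<close> is unconstrained and the equation says that \<open>x []\<close> is the
  unit.\<close>

lemma d_contraction:
  assumes x: "x \<in> carrier (E p (Suc q))" "d p (Suc q) x = \<one>\<^bsub>E (Suc p) (Suc q)\<^esub>"
  obtains h where "cech.cochain (K (Suc q)) \<V> p U h"
    "\<And>I. I \<in> lists \<V> \<Longrightarrow> length I = p \<Longrightarrow> x I = cech_diff (K (Suc q)) U h I"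
proof -
  interpret G: godement_presheaf X "K q" by (rule godement_presheaf_K)
  interpret K: cech X "K (Suc q)" \<V> by (rule cech_K)
  have "cech_diff (K (Suc q)) U x I = \<one>\<^bsub>sections (K (Suc q)) (U \<inter> \<Inter>(set I))\<^esub>"
    if "I \<in> lists \<V>" "length I = Suc p" for I
    using fun_cong[OF x(2), of I] that by (simp add: cech_map_def cech_group_simps simplices_def)
  then show thesis
    using G.cech_contraction[of \<V> U p x] open_member cover K.cochain_cech[OF x(1)] that by auto
qed

lemma double_complex: "double_complex E d e"
proof (rule double_complex.intro)
  show "comm_group (E p q)" for p q
    by (rule cech.comm_group_cech[OF cech_K]) simp
  show "d p q \<in> hom (E p q) (E (Suc p) q)" for p q
    by (rule cech.cech_map_hom[OF cech_K]) simp
  show "e p q \<in> hom (E p q) (E p (Suc q))" for p q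
    by (rule e_hom)
  show "d (Suc p) q (d p q x) = \<one>\<^bsub>E (Suc (Suc p)) q\<^esub>" if "x \<in> carrier (E p q)" for x p q
    using that by (intro cech.cech_map_map[OF cech_K]) simp
  show "e p (Suc q) (e p q x) = \<one>\<^bsub>E p (Suc (Suc q))\<^esub>" if "x \<in> carrier (E p q)" for x p q
    using that by (rule e_e)
  show "d p (Suc q) (e p q x) = e (Suc p) q (d p q x)" if "x \<in> carrier (E p q)" for x p q
    using that by (rule d_e)
  show "x = \<one>\<^bsub>E 0 (Suc q)\<^esub>"
    if x: "x \<in> carrier (E 0 (Suc q))" "d 0 (Suc q) x = \<one>\<^bsub>E (Suc 0) (Suc q)\<^esub>" for x q
  proof -
    obtain h where "cech.cochain (K (Suc q)) \<V> 0 U h"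
      "\<And>I. I \<in> lists \<V> \<Longrightarrow> length I = 0 \<Longrightarrow> x I = cech_diff (K (Suc q)) U h I"
      using d_contraction[OF x] by blast
    then show ?thesis
      using x(1) unfolding cech_group_simps
      by (intro PiE_ext[OF x(1)[unfolded cech_group_simps]])
        (auto simp: simplices_def intro!: comm_groupE(2) comm_group_K)
  qed
  show "x \<in> d p (Suc q) ` carrier (E p (Suc q))"
    if x: "x \<in> carrier (E (Suc p) (Suc q))" "d (Suc p) (Suc q) x = \<one>\<^bsub>E (Suc (Suc p)) (Suc q)\<^esub>" for x p q
  proof -
    interpret K: cech X "K (Suc q)" \<V> by (rule cech_K)
    obtain h where h: "K.cochain (Suc p) U h"
      "\<And>I. I \<in> lists \<V> \<Longrightarrow> length I = Suc p \<Longrightarrow> x I = cech_diff (K (Suc q)) U h I"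
      using d_contraction[OF x] by blast
    \<comment> \<open>\<open>h\<close> is arbitrary outside the lists of length \<open>p\<close>,
      whereas the carrier of a product consists of extensional functions.\<close>
    let ?y = "restrict h (simplices \<V> p)"
    have y: "?y \<in> carrier (E p (Suc q))"
      using K.cochainD[OF h(1)] by (auto simp: cech_group_simps simplices_def)
    have "x I = cech_diff (K (Suc q)) U ?y I" if I: "I \<in> simplices \<V> (Suc p)" for I
    proof -
      have "cech_diff (K (Suc q)) U ?y I = cech_diff (K (Suc q)) U h I"
        using simplicesD[OF I] by (intro K.cech_diff_cong) (auto simp: simplices_def)
      then show ?thesis using h(2) simplicesD[OF I] by simp
    qed
    then have "x = d p (Suc q) ?y"
      using x(1) by (auto simp: cech_group_simps cech_map_def PiE_iff extensional_def restrict_def)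
    then show ?thesis using y by blast
  qed
  show "x = \<one>\<^bsub>E (Suc p) 0\<^esub>"
    if x: "x \<in> carrier (E (Suc p) 0)" "e (Suc p) 0 x = \<one>\<^bsub>E (Suc p) (Suc 0)\<^esub>" for x p
  proof -
    have "x I = \<one>\<^bsub>sections (K 0) (U \<inter> \<Inter>(set I))\<^esub>" if I: "I \<in> simplices \<V> (Suc p)" for I
    proof -
      note V = simplex_nonempty[OF I]
      have "x I \<in> carrier (sections (K 0) (U \<inter> \<Inter>(set I)))"
        using x(1) I by (auto simp: cech_group_simps)
      moreover have "\<delta> 0 (U \<inter> \<Inter>(set I)) (x I) = \<one>\<^bsub>sections (K (Suc 0)) (U \<inter> \<Inter>(set I))\<^esub>"
        using fun_cong[OF x(2), of I] I by (simp add: e_def cech_group_simps)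
      ultimately show ?thesis
        using inj[OF V(2,3,4)] unfolding V(1) by simp
    qed
    then show ?thesis
      using x(1) by (auto simp: cech_group_simps PiE_iff extensional_def restrict_def)
  qed
  show "x \<in> e (Suc p) q ` carrier (E (Suc p) q)"
    if x: "x \<in> carrier (E (Suc p) (Suc q))" "e (Suc p) (Suc q) x = \<one>\<^bsub>E (Suc p) (Suc (Suc q))\<^esub>" for x p q
  proof -
    have "\<exists>y. y \<in> carrier (sections (K q) (U \<inter> \<Inter>(set I))) \<and> x I = \<delta> q (U \<inter> \<Inter>(set I)) y"
      if I: "I \<in> simplices \<V> (Suc p)" for I
    proof -
      note V = simplex_nonempty[OF I]
      have "x I \<in> carrier (sections (K (Suc q)) (U \<inter> \<Inter>(set I)))"
        using x(1) I by (auto simp: cech_group_simps)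
      moreover have "\<delta> (Suc q) (U \<inter> \<Inter>(set I)) (x I) = \<one>\<^bsub>sections (K (Suc (Suc q))) (U \<inter> \<Inter>(set I))\<^esub>"
        using fun_cong[OF x(2), of I] I by (simp add: e_def cech_group_simps)
      ultimately show ?thesis
        using exact[OF V(2,3,4)] unfolding V(1) by blast
    qed
    \<comment> \<open>A column is a product over simplices, so primitives may be chosen for each
      simplex independently.\<close>
    then have "\<forall>I\<in>simplices \<V> (Suc p). \<exists>y. y \<in> carrier (sections (K q) (U \<inter> \<Inter>(set I))) \<and>
        x I = \<delta> q (U \<inter> \<Inter>(set I)) y" by blast
    from bchoice[OF this] obtain y where y: "\<And>I. I \<in> simplices \<V> (Suc p) \<Longrightarrow>
        y I \<in> carrier (sections (K q) (U \<inter> \<Inter>(set I))) \<and> x I = \<delta> q (U \<inter> \<Inter>(set I)) (y I)"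
      by blast
    let ?y = "restrict y (simplices \<V> (Suc p))"
    have "?y \<in> carrier (E (Suc p) q)" using y by (auto simp: cech_group_simps)
    moreover have "x = e (Suc p) q ?y"
      using x(1) y by (auto simp: cech_group_simps e_def PiE_iff extensional_def restrict_def)
    ultimately show ?thesis by blast
  qed
qed

sublocale D: double_complex E d e
  by (rule double_complex)

sublocale T: double_complex "\<lambda>p q. E q p" "\<lambda>p q. e q p" "\<lambda>p q. d q p"
  by (rule D.transpose)

lemma simplices_0: "simplices \<V> 0 = {[]}"
  by (auto simp: simplices_def)

text \<open>The empty list is the only simplex of length 0, and its intersection is taken inside
  \<open>U\<close>. The column with first index 0 is therefore the complex of global sections up to
  the renaming \<open>?c\<close>.\<close>

lemma edge_cohomology_iso_sheaf_cohomology: "D.edge_cohomology n \<cong> sheaf_cohomology X F n"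
proof -
  let ?c = "\<lambda>s. \<lambda>I\<in>{[]::'p set list}. s :: ('p, 'a) godement"
  let ?G = "sections (K (Suc n)) U"
  let ?Z = "cocycles X F n"
  let ?B = "coboundaries X F n"
  have U: "openin X U" by simp
  interpret G: comm_group ?G by (rule comm_group_K[OF U])
  interpret h: group_hom "sections (K n) U" ?G "\<delta> n U" by (rule diff_group_hom[OF U])
  interpret h': group_hom ?G "sections (K (Suc (Suc n))) U" "\<delta> (Suc n) U" by (rule diff_group_hom[OF U])
  have Z: "?Z = kernel ?G (sections (K (Suc (Suc n))) U) (\<delta> (Suc n) U)"
    by (simp add: cocycles_def godement_complex_def)
  have B: "?B = (if n = 0 then {\<one>\<^bsub>?G\<^esub>} else \<delta> n U ` carrier (sections (K n) U))"
    by (cases n) (auto simp: godement_complex_def)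
  interpret Z: comm_group "?G\<lparr>carrier := ?Z\<rparr>"
    unfolding Z by (rule comm_group_update_carrier[OF G.comm_group_axioms h'.subgroup_kernel])
  have c: "?c \<in> iso (sections (K q) U) (E 0 q)" for q
    by (auto simp: iso_def hom_def bij_betw_def inj_on_def cech_group_simps simplices_0 fun_eq_iff
        PiE_iff extensional_def image_iff split: if_splits intro!: exI)
  have e: "e 0 q (?c s) = ?c (\<delta> q U s)" for q s
    by (auto simp: e_def simplices_0 intro!: restrict_ext)
  have cc: "?c ` carrier (sections (K q) U) = carrier (E 0 q)" for q
    using c[of q] by (auto simp: iso_def bij_betw_def)
  have cinj: "?c s = ?c t \<longleftrightarrow> s = t" for s t
    by (metis restrict_apply' singletonI)
  have c1: "?c \<one>\<^bsub>sections (K q) U\<^esub> = \<one>\<^bsub>E 0 q\<^esub>" for q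
    by (auto simp: cech_group_simps simplices_0 intro!: restrict_ext)
  have B': "(if n = 0 then {\<one>\<^bsub>E 0 (Suc 0)\<^esub>} else e 0 n ` carrier (E 0 n)) = ?c ` ?B"
    using e c1[of "Suc 0"] unfolding B cc[symmetric] by (auto simp: image_image)
  have Z': "kernel (E 0 (Suc n)) (E 0 (Suc (Suc n))) (e 0 (Suc n)) = ?c ` ?Z"
    unfolding Z kernel_def cc[symmetric] using e cinj by (auto simp: image_iff c1[symmetric])
  have "\<one>\<^bsub>?G\<^esub> \<in> ?Z"
    unfolding Z by (rule subgroup.one_closed[OF h'.subgroup_kernel])
  moreover have "\<delta> n U ` carrier (sections (K n) U) \<subseteq> ?Z"
    by (auto simp: Z kernel_def diff_diff[OF U])
  ultimately have "?B \<subseteq> ?Z"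
    unfolding B by auto
  moreover have "subgroup ?B ?G"
    unfolding B using h.img_is_subgroup G.triv_subgroup by auto
  moreover have "subgroup (?c ` ?B) (E 0 (Suc n))"
  proof -
    interpret cc: group_hom ?G "E 0 (Suc n)" ?c
      using c[of "Suc n"] by (intro group_homI_comm comm_group_K U D.grp) (auto simp: iso_def)
    show ?thesis using \<open>subgroup ?B ?G\<close> by (rule cc.subgroup_img_is_subgroup)
  qed
  ultimately show ?thesis
    unfolding D.edge_cohomology_def sheaf_cohomology_def B' Z' godement_complex_def
    by (intro FactGroup_iso_of_correspondence[OF Z.is_group D.grp G.comm_group_axioms,
          where f = ?c and g = id])
      (use c[of "Suc n"] cinj in \<open>auto simp: iso_def hom_def Z kernel_def\<close>)
qed

text \<open>The row with second index 0 has coefficients in \<open>K 0\<close>, a copy of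
  \<open>F\<close>, so its edge cohomology is the Cech cohomology; the other edge gives the sheaf
  cohomology.\<close>

theorem cech_cohomology_iso:
  "cech_cohomology (base_presheaf F) \<V> (topspace X) n \<cong> sheaf_cohomology X F n"
  "group (cech_cohomology (base_presheaf F) \<V> (topspace X) n)"
proof -
  have eq: "T.edge_cohomology n = cech_cohomology (base_presheaf F) \<V> (topspace X) n"
    by (simp add: T.edge_cohomology_def cech_cohomology_def godement_power.simps)
  show "group (cech_cohomology (base_presheaf F) \<V> (topspace X) n)"
    using T.group_edge_cohomology[of n] unfolding eq .
  have "T.edge_cohomology n \<cong> D.edge_cohomology n"
    by (rule T.edge_cohomology_transpose)
  then show "cech_cohomology (base_presheaf F) \<V> (topspace X) n \<cong> sheaf_cohomology X F n"
    unfolding eq using edge_cohomology_iso_sheaf_cohomology by (rule iso_trans)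
qed

end

section \<open>Monomial open sets in the combinatorial topology\<close>

lemma binoid_algebra_simps:
  "carrier (binoid_algebra :: ('m::binoid \<Rightarrow>\<^sub>0 'k::field) ring) = {f. Poly_Mapping.lookup f \<infinity> = 0}"
  "f \<otimes>\<^bsub>binoid_algebra\<^esub> g = erase_infinity (f * g :: 'm \<Rightarrow>\<^sub>0 'k)"
  "\<one>\<^bsub>binoid_algebra\<^esub> = (erase_infinity 1 :: 'm \<Rightarrow>\<^sub>0 'k)"
  "\<zero>\<^bsub>binoid_algebra\<^esub> = (0 :: 'm \<Rightarrow>\<^sub>0 'k)"
  "f \<oplus>\<^bsub>binoid_algebra\<^esub> g = (f + g :: 'm \<Rightarrow>\<^sub>0 'k)"
  by (simp_all add: binoid_algebra_def)

lemma T_infinity [simp]: "(T \<infinity> :: 'm::binoid \<Rightarrow>\<^sub>0 'k::field) = 0"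
  by (simp add: T_def)

lemma T_in_carrier: "(T a :: 'm::binoid \<Rightarrow>\<^sub>0 'k::field) \<in> carrier binoid_algebra"
  by (auto simp: T_def binoid_algebra_simps lookup_single)

lemma keys_T: "Poly_Mapping.keys (T a :: 'm::binoid \<Rightarrow>\<^sub>0 'k::field) \<subseteq> {a}"
  by (simp add: T_def)

lemma T_0: "(T 0 :: 'm::binoid \<Rightarrow>\<^sub>0 'k::field) = \<one>\<^bsub>binoid_algebra\<^esub>"
  using erase_infinity_single[of "0 :: 'm" "1 :: 'k"] by (simp add: T_def binoid_algebra_simps)

lemma primeideal_T_mult:
  fixes \<pp> :: "('m::binoid \<Rightarrow>\<^sub>0 'k::field) set"
  assumes "primeideal \<pp> binoid_algebra"
  shows "T (a + b) \<in> \<pp> \<longleftrightarrow> T a \<in> \<pp> \<or> T b \<in> \<pp>"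
proof -
  interpret primeideal \<pp> binoid_algebra by fact
  show ?thesis
    using I_prime[OF T_in_carrier T_in_carrier, of a b] I_r_closed[OF _ T_in_carrier, of "T a" b]
      I_l_closed[OF _ T_in_carrier, of "T b" a]
    by (auto simp: T_mult)
qed

lemma primeideal_T_multiple:
  fixes \<pp> :: "('m::binoid \<Rightarrow>\<^sub>0 'k::field) set"
  assumes p: "primeideal \<pp> binoid_algebra" and a: "T a \<notin> \<pp>"
  shows "T (\<Sum>i<n::nat. a) \<notin> \<pp>"
proof (induction n)
  case 0
  interpret primeideal \<pp> binoid_algebra by fact
  show ?case
    using I_notcarr one_imp_carrier by (auto simp: T_0)
next
  case (Suc n)
  then show ?case using primeideal_T_mult[OF p] a by simp
qed

lemma D_T_Int:
  "D {T a} \<inter> D {T b} = (D {T (a + b)} :: ('m::binoid \<Rightarrow>\<^sub>0 'k::field) set set)"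
  using primeideal_T_mult by (auto simp: D_def Spec_def)

lemma single_mem_ideal:
  fixes \<pp> :: "('m::binoid \<Rightarrow>\<^sub>0 'k::field) set"
  assumes "ideal \<pp> binoid_algebra" "T a \<in> \<pp>" "a + b \<noteq> \<infinity>"
  shows "Poly_Mapping.single (a + b) c \<in> \<pp>"
proof -
  interpret ideal \<pp> binoid_algebra by fact
  have ab: "a \<noteq> \<infinity>" "b \<noteq> \<infinity>" using assms(3) by auto
  have "Poly_Mapping.single b c \<in> carrier binoid_algebra"
    using ab by (simp add: binoid_algebra_simps lookup_single)
  then have "T a \<otimes>\<^bsub>binoid_algebra\<^esub> Poly_Mapping.single b c \<in> \<pp>"
    by (rule I_r_closed[OF assms(2)])
  then show ?thesis
    using ab assms(3) by (simp add: T_def binoid_algebra_simps mult_single erase_infinity_single)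
qed

lemma mem_ideal_of_terms:
  fixes \<pp> :: "('m::binoid \<Rightarrow>\<^sub>0 'k::field) set"
  assumes "ideal \<pp> binoid_algebra"
    and terms: "\<And>a. a \<in> Poly_Mapping.keys f \<Longrightarrow> Poly_Mapping.single a (Poly_Mapping.lookup f a) \<in> \<pp>"
  shows "f \<in> \<pp>"
proof -
  interpret ideal \<pp> binoid_algebra by fact
  let ?t = "\<lambda>a. Poly_Mapping.single a (Poly_Mapping.lookup f a)"
  have "(\<Sum>a\<in>A. ?t a) \<in> \<pp>" if "finite A" "A \<subseteq> Poly_Mapping.keys f" for A
    using that
  proof (induction A)
    case empty
    show ?case using additive_subgroup.zero_closed[OF additive_subgroup_axioms] unfolding binoid_algebra_simps by simp
  next
    case (insert a A)
    then have "?t a \<oplus>\<^bsub>binoid_algebra\<^esub> (\<Sum>a\<in>A. ?t a) \<in> \<pp>"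
      using terms by (intro additive_subgroup.a_closed[OF additive_subgroup_axioms]) auto
    then show ?case using insert by (simp add: binoid_algebra_simps)
  qed
  moreover have "(\<Sum>a\<in>Poly_Mapping.keys f. ?t a) = f"
    by (rule poly_mapping_eqI) (auto simp: lookup_sum lookup_single when_def sum.delta in_keys_iff)
  ultimately show ?thesis by (metis finite_keys order_refl)
qed

text \<open>A nonzero scalar is a unit, and the zero monomial has the same open set as
  \<open>T \<infinity>\<close>, the empty one.\<close>

lemma D_monomial:
  fixes P :: "'m::binoid \<Rightarrow>\<^sub>0 'k::field"
  assumes "monomial P"
  obtains a where "D {P} = D {T a}"
proof -
  obtain c a where P: "P = Poly_Mapping.map ((*) c) (T a)"
    using assms by (auto simp: monomial_def)
  show thesis
  proof (cases "c = 0 \<or> a = \<infinity>")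
    case True
    then have "P = 0" unfolding P
      by (intro poly_mapping_eqI) (auto simp: map.rep_eq)
    then show ?thesis using that[of \<infinity>] by simp
  next
    case False
    then have P': "P = Poly_Mapping.single a c" unfolding P T_def
      by (intro poly_mapping_eqI) (auto simp: map.rep_eq lookup_single when_def)
    \<comment> \<open>If \<open>0\<close> were \<open>\<infinity>\<close>, then so would be
      \<open>a = a + 0\<close>. Hence the inverse scalar, placed at exponent 0, is an element of the
      algebra.\<close>
    have "a + 0 \<noteq> a + \<infinity>" using False by simp
    then have inf: "(0 :: 'm) \<noteq> \<infinity>" by metis
    have "P \<in> \<pp> \<longleftrightarrow> T a \<in> \<pp>" if p: "primeideal \<pp> binoid_algebra" for \<pp> :: "('m \<Rightarrow>\<^sub>0 'k) set"
    proof
      interpret primeideal \<pp> binoid_algebra by fact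
      assume "T a \<in> \<pp>"
      then show "P \<in> \<pp>"
        using single_mem_ideal[OF is_ideal, of a 0 c] False by (simp add: P')
    next
      interpret primeideal \<pp> binoid_algebra by fact
      assume "P \<in> \<pp>"
      moreover have "Poly_Mapping.single 0 (inverse c) \<in> carrier (binoid_algebra :: ('m \<Rightarrow>\<^sub>0 'k) ring)"
        using inf by (simp add: binoid_algebra_simps lookup_single)
      ultimately have "P \<otimes>\<^bsub>binoid_algebra\<^esub> Poly_Mapping.single 0 (inverse c) \<in> \<pp>"
        by (rule I_r_closed)
      then show "T a \<in> \<pp>"
        using False by (simp add: P' T_def binoid_algebra_simps mult_single erase_infinity_single)
    qed
    then show ?thesis using that[of a] by (auto simp: D_def Spec_def)
  qed
qed

lemma Inter_D_monomial:
  fixes \<W> :: "('m::binoid \<Rightarrow>\<^sub>0 'k::field) set set set"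
  assumes "finite \<W>" "\<W> \<noteq> {}" "\<And>W. W \<in> \<W> \<Longrightarrow> \<exists>P. monomial P \<and> W = D {P}"
  obtains a where "\<Inter>\<W> = D {T a}"
proof -
  have "\<exists>a. \<Inter>\<W> = D {T a}"
    using assms
  proof (induction rule: finite_ne_induct)
    case (singleton W)
    then obtain P where "monomial P" "W = D {P}" by auto
    then show ?case using D_monomial[of P] by auto
  next
    case (insert W \<W>)
    then obtain P b where "monomial P" "W = D {P}" "\<Inter>\<W> = D {T b}" by blast
    moreover obtain a where "D {P} = D {T a}" using D_monomial[OF \<open>monomial P\<close>] .
    ultimately show ?case using D_T_Int[of a b] by auto
  qed
  then show thesis using that by blast
qed

lemma openin_zariski_D:
  fixes S :: "('m::binoid \<Rightarrow>\<^sub>0 'k::field) set"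
  assumes S: "S \<subseteq> carrier binoid_algebra"
  shows "openin zariski_topology (D S)"
proof -
  interpret R: cring "binoid_algebra :: ('m \<Rightarrow>\<^sub>0 'k) ring" by (rule cring_binoid_algebra)
  have "genideal binoid_algebra S \<subseteq> \<pp> \<longleftrightarrow> S \<subseteq> \<pp>" if "primeideal \<pp> binoid_algebra" for \<pp>
    using R.genideal_self[OF S] R.genideal_minimal[OF primeideal.axioms(1)[OF that], of S] by blast
  then have "D (genideal binoid_algebra S) = D S" by (auto simp: D_def Spec_def)
  then show ?thesis
    using R.genideal_ideal[OF S] by (auto simp: openin_zariski_topology)
qed

lemma zariski_finer: "openin combinatorial_topology V \<Longrightarrow> openin zariski_topology V"
  by (auto simp: openin_combinatorial_topology combinatorial_ideal_def ideal_span_def intro!: openin_zariski_D)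

text \<open>The ideal of \<open>M\<close> is the principal one generated by \<open>a\<close>: every
  term of an element of its span is a multiple of \<open>T a\<close>, so a prime contains the span
  as soon as it contains \<open>T a\<close>.\<close>

lemma openin_combinatorial_D_T:
  "openin combinatorial_topology (D {T a :: 'm::binoid \<Rightarrow>\<^sub>0 'k::field})"
proof -
  define I where "I = insert \<infinity> (range ((+) a))"
  have "binoid_ideal I"
    by (auto simp: binoid_ideal_def I_def add.assoc)
  moreover have "ideal_span I \<subseteq> \<pp> \<longleftrightarrow> T a \<in> \<pp>" if p: "primeideal \<pp> binoid_algebra"
    for \<pp> :: "('m \<Rightarrow>\<^sub>0 'k) set"
  proof
    interpret primeideal \<pp> binoid_algebra by fact
    have "a \<in> I" unfolding I_def by (metis add.right_neutral insertCI rangeI)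
    then have "T a \<in> (ideal_span I :: ('m \<Rightarrow>\<^sub>0 'k) set)"
      using keys_T[of a] T_in_carrier[of a] by (auto simp: ideal_span_def)
    then show "ideal_span I \<subseteq> \<pp> \<Longrightarrow> T a \<in> \<pp>" by blast
    show "ideal_span I \<subseteq> \<pp>" if a: "T a \<in> \<pp>"
    proof
      fix f assume f: "f \<in> (ideal_span I :: ('m \<Rightarrow>\<^sub>0 'k) set)"
      show "f \<in> \<pp>"
      proof (rule mem_ideal_of_terms[OF is_ideal])
        fix k assume k: "k \<in> Poly_Mapping.keys f"
        then have "k \<noteq> \<infinity>" "k \<in> I"
          using f by (auto simp: ideal_span_def binoid_algebra_simps in_keys_iff)
        then obtain b where "k = a + b" by (auto simp: I_def)
        then show "Poly_Mapping.single k (Poly_Mapping.lookup f k) \<in> \<pp>"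
          using single_mem_ideal[OF is_ideal a] \<open>k \<noteq> \<infinity>\<close> by simp
      qed
    qed
  qed
  then have "D {T a} = D (ideal_span I :: ('m \<Rightarrow>\<^sub>0 'k) set)"
    by (auto simp: D_def Spec_def)
  ultimately show ?thesis
    by (auto simp: openin_combinatorial_topology combinatorial_ideal_def)
qed

text \<open>The linear extension of \<open>T\<^sup>b \<mapsto> 1\<close> for \<open>b \<in> N\<close> and \<open>T\<^sup>b \<mapsto> 0\<close> otherwise, a ring homomorphism
  when \<open>N\<close> is a face of \<open>M\<close>.\<close>

definition face_eval :: "'m set \<Rightarrow> ('m \<Rightarrow>\<^sub>0 'k::field) \<Rightarrow> 'k" where
  "face_eval N f = (\<Sum>b\<in>Poly_Mapping.keys f. if b \<in> N then Poly_Mapping.lookup f b else 0)"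

lemma face_eval_superset:
  "finite A \<Longrightarrow> Poly_Mapping.keys f \<subseteq> A \<Longrightarrow>
    face_eval N f = (\<Sum>b\<in>A. if b \<in> N then Poly_Mapping.lookup f b else 0)"
  unfolding face_eval_def by (rule sum.mono_neutral_left) (auto simp: in_keys_iff)

lemma face_eval_add: "face_eval N (f + g) = face_eval N f + face_eval N g"
proof -
  let ?A = "Poly_Mapping.keys f \<union> Poly_Mapping.keys g"
  have "Poly_Mapping.keys (f + g) \<subseteq> ?A" by (rule keys_add)
  then show ?thesis
    by (subst (1 2 3) face_eval_superset[of ?A]) (auto simp: lookup_add sum.distrib[symmetric] intro!: sum.cong)
qed

lemma face_eval_single: "face_eval N (Poly_Mapping.single a c) = (if a \<in> N then c else 0)"
  by (subst face_eval_superset[of "{a}"]) (auto simp: lookup_single)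

lemma face_eval_0 [simp]: "face_eval N 0 = 0"
  by (simp add: face_eval_def)

lemma poly_mapping_single_induct [case_names zero add]:
  assumes "Q 0" "\<And>f a b. Q f \<Longrightarrow> Q (Poly_Mapping.single a b + f)"
  shows "Q (f :: 'a \<Rightarrow>\<^sub>0 'b::comm_monoid_add)"
proof (induction f rule: update_induct)
  case (update f a b)
  have "Poly_Mapping.update a b f = Poly_Mapping.single a b + f"
    using update(1) by (intro poly_mapping_eqI) (auto simp: lookup_update lookup_add lookup_single in_keys_iff)
  then show ?case using assms(2) update by simp
qed (fact assms(1))

text \<open>Both sides are additive in each factor, so single terms suffice; there the face
  condition says that the indicator of \<open>N\<close> is multiplicative.\<close>

lemma face_eval_mult:
  fixes f g :: "'m::binoid \<Rightarrow>\<^sub>0 'k::field"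
  assumes N: "\<And>a b. a + b \<in> N \<longleftrightarrow> a \<in> N \<and> b \<in> N"
  shows "face_eval N (f * g) = face_eval N f * face_eval N g"
proof (induction f rule: poly_mapping_single_induct)
  case (add f a b)
  have "face_eval N (Poly_Mapping.single a b * g) = face_eval N (Poly_Mapping.single a b) * face_eval N g"
    by (induction g rule: poly_mapping_single_induct)
      (auto simp: distrib_left face_eval_add face_eval_single mult_single N)
  then show ?case using add by (simp add: distrib_right face_eval_add)
qed simp

lemma face_eval_erase_infinity:
  "\<infinity> \<notin> N \<Longrightarrow> face_eval N (erase_infinity f) = face_eval N (f :: 'm::binoid \<Rightarrow>\<^sub>0 'k::field)"
  by (subst (2) erase_infinity_split) (simp add: face_eval_add face_eval_single)

text \<open>Erasing the coefficient at \<open>\<infinity>\<close> does not change the evaluation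
  because \<open>\<infinity>\<close> lies outside \<open>N\<close>. The set is then the kernel of a
  ring homomorphism to a field, and it is proper since \<open>1\<close> maps to
  \<open>1\<close>.\<close>

lemma primeideal_face:
  assumes N: "\<And>a b :: 'm::binoid. a + b \<in> N \<longleftrightarrow> a \<in> N \<and> b \<in> N" "0 \<in> N" "\<infinity> \<notin> N"
  shows "primeideal {f \<in> carrier binoid_algebra. face_eval N f = (0 :: 'k::field)} binoid_algebra"
proof -
  let ?R = "binoid_algebra :: ('m \<Rightarrow>\<^sub>0 'k) ring"
  let ?p = "{f \<in> carrier ?R. face_eval N f = 0}"
  interpret R: cring ?R by (rule cring_binoid_algebra)
  have mult: "face_eval N (f \<otimes>\<^bsub>?R\<^esub> g) = face_eval N f * face_eval N g" for f g :: "'m \<Rightarrow>\<^sub>0 'k"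
    by (simp add: binoid_algebra_simps face_eval_erase_infinity[OF N(3)] face_eval_mult[OF N(1)])
  have add: "face_eval N (f \<oplus>\<^bsub>?R\<^esub> g) = face_eval N f + face_eval N g" for f g :: "'m \<Rightarrow>\<^sub>0 'k"
    by (simp add: binoid_algebra_simps face_eval_add)
  have zero: "face_eval N \<zero>\<^bsub>?R\<^esub> = 0"
    by (simp add: binoid_algebra_simps)
  have one: "face_eval N \<one>\<^bsub>?R\<^esub> = (1 :: 'k)"
    using N(2,3) face_eval_single[of N 0 "1 :: 'k"] unfolding T_0[symmetric] T_def by auto
  show ?thesis
  proof (rule primeidealI)
    show "ideal ?p ?R"
    proof (rule idealI)
      show "subgroup ?p (add_monoid ?R)"
      proof (rule subgroup.intro)
        fix f assume f: "f \<in> ?p"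
        then have "\<ominus>\<^bsub>?R\<^esub> f \<in> carrier ?R" by auto
        moreover have "face_eval N (\<ominus>\<^bsub>?R\<^esub> f) = 0"
          using add[of f "\<ominus>\<^bsub>?R\<^esub> f"] R.r_neg[of f] zero f by simp
        ultimately show "inv\<^bsub>add_monoid ?R\<^esub> f \<in> ?p"
          by (simp add: a_inv_def)
      qed (auto simp: add zero)
    qed (auto simp: mult R.ring_axioms)
    show "carrier ?R \<noteq> ?p" using one R.one_closed by force
  qed (auto simp: mult R.cring_axioms)
qed

section \<open>The smallest face containing an exponent, and its focal point\<close>

lemma sum_const_add: "(\<Sum>i<n::nat. a) + (\<Sum>i<m. a) = (\<Sum>i<n + m. a :: 'm::comm_monoid_add)"
  by (induction m) (simp_all add: add.assoc[symmetric])

text \<open>The focal point of \<open>D {T a}\<close> is the kernel of the evaluation at the smallest face containing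
  \<open>a\<close>, which consists of the divisors of the multiples of \<open>a\<close>.\<close>

lemma D_T_focal:
  fixes a :: "'m::binoid"
  assumes ne: "D {T a :: 'm \<Rightarrow>\<^sub>0 'k::field} \<noteq> {}"
  obtains \<pp> where "\<pp> \<in> D {T a :: 'm \<Rightarrow>\<^sub>0 'k}"
    "\<And>N. openin combinatorial_topology N \<Longrightarrow> \<pp> \<in> N \<Longrightarrow> D {T a} \<subseteq> N"
proof -
  define N where "N = {b. \<exists>(n::nat) c. b + c = (\<Sum>i<n. a)}"
  have T: "T (\<Sum>i<n. a) \<notin> \<qq>" if "\<qq> \<in> D {T a}" for \<qq> :: "('m \<Rightarrow>\<^sub>0 'k) set" and n :: nat
    using that primeideal_T_multiple[of \<qq> a] by (auto simp: D_def Spec_def)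
  \<comment> \<open>Nonemptiness enters here: a prime in \<open>D {T a}\<close> contains
    \<open>T \<infinity>\<close>, which is zero, but no power of \<open>T a\<close>.\<close>
  have inf: "\<infinity> \<notin> N"
  proof
    assume "\<infinity> \<in> N"
    then obtain n :: nat and c where "\<infinity> + c = (\<Sum>i<n. a)" unfolding N_def by blast
    then have n: "(\<Sum>i<n. a) = \<infinity>" by simp
    obtain \<qq> where q: "\<qq> \<in> D {T a :: 'm \<Rightarrow>\<^sub>0 'k}" using ne by blast
    then interpret primeideal \<qq> binoid_algebra by (simp add: D_def Spec_def)
    show False
      using T[OF q, of n] additive_subgroup.zero_closed[OF additive_subgroup_axioms] unfolding n T_infinity binoid_algebra_simps by simp
  qed
  have face: "b + c \<in> N \<longleftrightarrow> b \<in> N \<and> c \<in> N" for b c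
  proof
    assume "b + c \<in> N"
    then obtain n :: nat and d where "b + c + d = (\<Sum>i<n. a)" by (auto simp: N_def)
    then have "b + (c + d) = (\<Sum>i<n. a)" "c + (b + d) = (\<Sum>i<n. a)" by (simp_all add: ac_simps)
    then show "b \<in> N \<and> c \<in> N" unfolding N_def by blast
  next
    assume "b \<in> N \<and> c \<in> N"
    then obtain n m :: nat and b' c' where "b + b' = (\<Sum>i<n. a)" "c + c' = (\<Sum>i<m. a)" by (auto simp: N_def)
    then have "(b + c) + (b' + c') = (\<Sum>i<n + m. a)"
      by (simp add: sum_const_add[symmetric] ac_simps)
        (metis add.assoc add.commute)
    then show "b + c \<in> N" unfolding N_def by blast
  qed
  have "(0::'m) + 0 = (\<Sum>i<0::nat. a)" by simp
  then have zero: "0 \<in> N" unfolding N_def by blast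
  have "a + 0 = (\<Sum>i<1::nat. a)" by simp
  then have aN: "a \<in> N" unfolding N_def by blast
  let ?p = "{f \<in> carrier binoid_algebra. face_eval N f = (0 :: 'k)}"
  have prime: "primeideal ?p binoid_algebra"
    by (rule primeideal_face[OF face zero inf])
  have "face_eval N (T a) = (1 :: 'k)"
    using aN inf face_eval_single[of N a "1 :: 'k"] by (auto simp: T_def)
  then have "?p \<in> D {T a}"
    using prime by (simp add: D_def Spec_def)
  \<comment> \<open>A neighbourhood of the focal point comes from an ideal \<open>I\<close> whose
    span contains some \<open>f\<close> with nonzero evaluation, so an exponent \<open>b\<close> of
    \<open>f\<close> lies in both \<open>I\<close> and \<open>N\<close>. As \<open>b\<close> divides
    a multiple of \<open>a\<close>, that multiple is in \<open>I\<close>, and its monomial lies in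
    no prime of \<open>D {T a}\<close>.\<close>
  moreover have "D {T a} \<subseteq> V" if V: "openin combinatorial_topology V" "?p \<in> V" for V
  proof -
    obtain I where I: "binoid_ideal I" "V = D (ideal_span I)"
      using V by (auto simp: openin_combinatorial_topology combinatorial_ideal_def)
    obtain f where f: "f \<in> ideal_span I" "f \<notin> ?p"
      using V(2) by (auto simp: I D_def)
    then have "face_eval N f \<noteq> 0" by (simp add: ideal_span_def)
    then obtain b where b: "b \<in> Poly_Mapping.keys f" "b \<in> N"
      unfolding face_eval_def
      by (elim sum.not_neutral_contains_not_neutral) (simp split: if_splits)
    then have "b \<in> I" using f by (auto simp: ideal_span_def)
    moreover obtain n :: nat and c where "b + c = (\<Sum>i<n. a)" using b(2) by (auto simp: N_def)
    ultimately have "(\<Sum>i<n. a) \<in> I" using I(1) by (metis binoid_ideal_def)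
    then have TI: "T (\<Sum>i<n. a) \<in> (ideal_span I :: ('m \<Rightarrow>\<^sub>0 'k) set)"
      using keys_T[of "\<Sum>i<n. a"] T_in_carrier[of "\<Sum>i<n. a"] unfolding ideal_span_def by blast
    show ?thesis
    proof
      fix \<qq> assume q: "\<qq> \<in> D {T a :: 'm \<Rightarrow>\<^sub>0 'k}"
      then show "\<qq> \<in> V"
        using T[OF q, of n] TI by (auto simp: I D_def)
    qed
  qed
  ultimately show thesis by (rule that)
qed

section \<open>Comparison of Zariski and combinatorial cohomology\<close>

text \<open>Vanishing cohomology gives exactness from \<open>K 2\<close> on. Injectivity on
  \<open>K 0\<close> and exactness at \<open>K 1\<close> come from uniqueness and existence in the
  sheaf axiom.\<close>

lemma acyclic_cover_zariski:
  fixes X :: "'p topology"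
  assumes F: "sheaf X F" and open_member: "\<And>v. v \<in> \<V> \<Longrightarrow> openin X v" and cover: "\<Union>\<V> = topspace X"
    and acyclic: "\<And>\<W> k. \<W> \<subseteq> \<V> \<Longrightarrow> finite \<W> \<Longrightarrow> \<W> \<noteq> {} \<Longrightarrow> k \<ge> 1 \<Longrightarrow>
      trivial_group (sheaf_cohomology (subtopology X (\<Inter>\<W>)) F k)"
  shows "acyclic_cover X F \<V>"
proof -
  have pF: "presheaf X F" using F by (simp add: sheaf_def)
  interpret godement_sheaf_resolution X F
    by unfold_locales (fact pF, fact F)
  have o: "openin X (\<Inter>\<W>)" if "\<W> \<subseteq> \<V>" "finite \<W>" "\<W> \<noteq> {}" for \<W>
    using that open_member by (intro openin_Inter) auto
  show ?thesis
  proof unfold_locales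
    fix \<W> s
    assume W: "\<W> \<subseteq> \<V>" "finite \<W>" "\<W> \<noteq> {}"
    note oW = o[OF W]
    {
      assume "s \<in> carrier (sections (K 0) (\<Inter>\<W>))" "\<delta> 0 (\<Inter>\<W>) s = \<one>\<^bsub>sections (K (Suc 0)) (\<Inter>\<W>)\<^esub>"
      then show "s = \<one>\<^bsub>sections (K 0) (\<Inter>\<W>)\<^esub>" by (rule diff_0_inj[OF oW])
    next
      fix n
      assume s: "s \<in> carrier (sections (K (Suc n)) (\<Inter>\<W>))"
        "\<delta> (Suc n) (\<Inter>\<W>) s = \<one>\<^bsub>sections (K (Suc (Suc n))) (\<Inter>\<W>)\<^esub>"
      interpret S: open_subspace X F "\<Inter>\<W>"
        by unfold_locales (rule oW)
      show "s \<in> \<delta> n (\<Inter>\<W>) ` carrier (sections (K n) (\<Inter>\<W>))"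
      proof (cases n)
        case 0
        then show ?thesis using diff_0_exact[OF oW] s by simp
      next
        case (Suc m)
        then show ?thesis
          using S.exact_of_trivial_cohomology[OF acyclic[OF W]] s by simp
      qed
    }
  qed (use open_member cover in auto)
qed

text \<open>A nonempty intersection is contracted by its focal point. Over an empty one all powers
  have trivial sections: \<open>K 0\<close> by the assumption \<open>empty\<close>, the higher ones
  as products over no points.\<close>

lemma acyclic_cover_focal:
  fixes X :: "'p topology"
  assumes F: "presheaf X F" and open_member: "\<And>v. v \<in> \<V> \<Longrightarrow> openin X v" and cover: "\<Union>\<V> = topspace X"
    and empty: "\<And>s t. s \<in> carrier (sections F {}) \<Longrightarrow> t \<in> carrier (sections F {}) \<Longrightarrow> s = t"
    and focal: "\<And>\<W>. \<W> \<subseteq> \<V> \<Longrightarrow> finite \<W> \<Longrightarrow> \<W> \<noteq> {} \<Longrightarrow> \<Inter>\<W> \<noteq> {} \<Longrightarrow>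
      \<exists>x\<in>\<Inter>\<W>. \<forall>N. openin X N \<and> x \<in> N \<longrightarrow> \<Inter>\<W> \<subseteq> N"
  shows "acyclic_cover X F \<V>"
proof -
  interpret godement_resolution X F
    by unfold_locales (fact F)
  have o: "openin X (\<Inter>\<W>)" if "\<W> \<subseteq> \<V>" "finite \<W>" "\<W> \<noteq> {}" for \<W>
    using that open_member by (intro openin_Inter) auto
  have triv: "s = t" if "s \<in> carrier (sections (K n) {})" "t \<in> carrier (sections (K n) {})" for n s t
  proof (cases n)
    case 0
    then show ?thesis
      using that empty by (auto simp: godement_power.simps base_presheaf_def transport_group_def)
  next
    case (Suc m)
    then show ?thesis
      using that by (intro godement_eqI[of s X "K m" "{}" t]) auto
  qed
  have one: "\<one>\<^bsub>sections (K n) {}\<^esub> \<in> carrier (sections (K n) {})" for n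
    by (intro comm_groupE(2) comm_group_K) simp
  show ?thesis
  proof unfold_locales
    fix \<W> s
    assume W: "\<W> \<subseteq> \<V>" "finite \<W>" "\<W> \<noteq> {}"
    note oW = o[OF W]
    {
      assume s: "s \<in> carrier (sections (K 0) (\<Inter>\<W>))" "\<delta> 0 (\<Inter>\<W>) s = \<one>\<^bsub>sections (K (Suc 0)) (\<Inter>\<W>)\<^esub>"
      show "s = \<one>\<^bsub>sections (K 0) (\<Inter>\<W>)\<^esub>"
      proof (cases "\<Inter>\<W> = {}")
        case True
        then show ?thesis using triv one s by simp
      next
        case False
        from focal[OF W this] obtain x
          where x: "x \<in> \<Inter>\<W>" "\<forall>N. openin X N \<and> x \<in> N \<longrightarrow> \<Inter>\<W> \<subseteq> N"
          by (rule bexE)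
        show ?thesis by (rule focal_inj[OF oW x(1) _ s]) (use x(2) in simp)
      qed
    next
      fix n
      assume s: "s \<in> carrier (sections (K (Suc n)) (\<Inter>\<W>))"
        "\<delta> (Suc n) (\<Inter>\<W>) s = \<one>\<^bsub>sections (K (Suc (Suc n))) (\<Inter>\<W>)\<^esub>"
      show "s \<in> \<delta> n (\<Inter>\<W>) ` carrier (sections (K n) (\<Inter>\<W>))"
      proof (cases "\<Inter>\<W> = {}")
        case True
        interpret h: group_hom "sections (K n) {}" "sections (K (Suc n)) {}" "\<delta> n {}"
          by (rule diff_group_hom) simp
        have "s = \<delta> n {} \<one>\<^bsub>sections (K n) {}\<^esub>"
          using s True h.hom_closed[OF one] by (intro triv) auto
        then show ?thesis unfolding True using one[of n] by (rule image_eqI)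
      next
        case False
        from focal[OF W this] obtain x
          where x: "x \<in> \<Inter>\<W>" "\<forall>N. openin X N \<and> x \<in> N \<longrightarrow> \<Inter>\<W> \<subseteq> N"
          by (rule bexE)
        show ?thesis by (rule focal_exact[OF oW x(1) _ s]) (use x(2) in simp)
      qed
    }
  qed (use open_member cover in auto)
qed

theorem proposition3p35:
  fixes \<AA> :: "('m::binoid \<Rightarrow>\<^sub>0 'k::field) set"
    and U :: "('m \<Rightarrow>\<^sub>0 'k) set set"
    and Ps :: "('m \<Rightarrow>\<^sub>0 'k) set"
    and F :: "(('m \<Rightarrow>\<^sub>0 'k) set, 'a) ab_presheaf"
  assumes "finitely_generated_binoid TYPE('m)"
    and "cancellative_binoid TYPE('m)"
    and "torsion_free_up_to_nilpotence TYPE('m)"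
    and "combinatorial_ideal \<AA>"
    and "U = D \<AA>"
    and "U = (\<Union>P\<in>Ps. D {P})"
    and "\<And>P. P \<in> Ps \<Longrightarrow> monomial P"
    and "sheaf (subtopology zariski_topology U) F"
    and "acyclic_covering ((\<lambda>P. D {P}) ` Ps) U F"
  shows "\<forall>j. H_Zar U F j \<cong> H_comb U F j"
proof
  fix j
  let ?X = "subtopology zariski_topology U" and ?Y = "subtopology combinatorial_topology U"
  let ?V = "(\<lambda>P. D {P}) ` Ps"
  have U: "openin combinatorial_topology U"
    using assms(4,5) by (auto simp: openin_combinatorial_topology)
  have topX: "topspace ?X = U" and topY: "topspace ?Y = U"
    using openin_subset[OF U] openin_subset[OF zariski_finer[OF U]] by auto
  have finer: "openin ?X V" if "openin ?Y V" for V
    using that zariski_finer by (auto simp: openin_subtopology)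
  have cover: "\<Union>?V = U" using assms(6) by auto
  have openY: "openin ?Y v" if v: "v \<in> ?V" for v
  proof -
    obtain P where P: "v = D {P}" "P \<in> Ps" using v by (rule imageE)
    obtain a where "D {P} = D {T a}" using D_monomial[OF assms(7)[OF P(2)]] .
    then have "openin combinatorial_topology v" using P openin_combinatorial_D_T by simp
    moreover have "v \<subseteq> U" using P assms(6) by auto
    ultimately show ?thesis by (simp add: openin_open_subtopology[OF U])
  qed
  have X: "acyclic_cover ?X F ?V"
  proof (rule acyclic_cover_zariski[OF assms(8)])
    fix \<W> :: "('m \<Rightarrow>\<^sub>0 'k) set set set" and k :: nat
    assume W: "\<W> \<subseteq> ?V" "finite \<W>" "\<W> \<noteq> {}" "k \<ge> 1"
    have "\<Inter>\<W> \<subseteq> U" using W cover by blast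
    \<comment> \<open>Acyclicity is stated with subspaces of the whole spectrum, the criterion with
      subspaces of \<open>U\<close>.\<close>
    then have "subtopology ?X (\<Inter>\<W>) = subtopology zariski_topology (\<Inter>\<W>)"
      by (simp add: subtopology_subtopology Int_absorb1)
    then show "trivial_group (sheaf_cohomology (subtopology ?X (\<Inter>\<W>)) F k)"
      using assms(9) W by (simp add: acyclic_covering_def H_Zar_def)
  qed (use finer openY cover topX in auto)
  have Y: "acyclic_cover ?Y F ?V"
  proof (rule acyclic_cover_focal)
    show "presheaf ?Y F"
      using assms(8) finer by (auto simp: sheaf_def intro: presheaf_coarser)
    \<comment> \<open>The empty family covers the empty set, so the uniqueness axiom identifies all
      sections over it.\<close>
    show "s = t" if "s \<in> carrier (sections F {})" "t \<in> carrier (sections F {})" for s t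
      using assms(8) that unfolding sheaf_def by (metis Union_empty empty_iff)
    fix \<W> :: "('m \<Rightarrow>\<^sub>0 'k) set set set"
    assume W: "\<W> \<subseteq> ?V" "finite \<W>" "\<W> \<noteq> {}" "\<Inter>\<W> \<noteq> {}"
    have "\<exists>P. monomial P \<and> W = D {P}" if "W \<in> \<W>" for W
      using that W(1) assms(7) by blast
    then obtain a where a: "\<Inter>\<W> = D {T a}" using Inter_D_monomial[OF W(2,3)] by blast
    then obtain x where "x \<in> \<Inter>\<W>" "\<And>N. openin combinatorial_topology N \<Longrightarrow> x \<in> N \<Longrightarrow> \<Inter>\<W> \<subseteq> N"
      using D_T_focal[of a] W(4) by (metis (no_types, lifting))
    moreover have "\<Inter>\<W> \<subseteq> U" using W cover by blast
    ultimately show "\<exists>x\<in>\<Inter>\<W>. \<forall>N. openin ?Y N \<and> x \<in> N \<longrightarrow> \<Inter>\<W> \<subseteq> N"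
      by (auto simp: openin_subtopology intro!: bexI[of _ x])
  qed (use openY cover topY in auto)
  \<comment> \<open>The middle term of the chain has the same arguments \<open>?V\<close> and
    \<open>U\<close> for both topologies, so no further comparison of Cech groups is needed.\<close>
  have "H_Zar U F j \<cong> cech_cohomology (base_presheaf F) ?V U j"
    using group.iso_sym[OF acyclic_cover.cech_cohomology_iso(2,1)[OF X]]
    unfolding H_Zar_def topX .
  also have "\<dots> \<cong> H_comb U F j"
    using acyclic_cover.cech_cohomology_iso(1)[OF Y] unfolding H_comb_def topY .
  finally show "H_Zar U F j \<cong> H_comb U F j" .
qed

end
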